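(* Let $m,n,r$ be positive integers with $r\le m$ and $r\le n$, and let $G=K_m\star_r K_n$. Then $J_{\overline{G}}$ is strongly unmixed, where $\overline{G}=\overline{K_m\star_rK_n}$.
   Context: All graphs are finite and simple. For a graph $G$ on $[n]=\{1,\dots,n\}$ and a field $K$, the binomial edge ideal $J_G\subseteq K[x_1,\dots,x_n,y_1,\dots,y_n]$ is generated by all $x_iy_j-x_jy_i$ with $\{i,j\}\in E(G)$, $i<j$. For $T\subseteq V(G)$, $G\setminus T$ is the induced subgraph on $V(G)\setminus T$ and $c_G(T)$ is its number of connected components. A cut vertex is a vertex whose removal increases the number of connected components. A set $T\subseteq V(G)$ is a cutset if each $t\in T$ is a cut vertex of $G\setminus(T\setminus\{t\})$; $\mathfrak{C}(G)$ is the set of all cutsets. $J_G$ is unmixed if all its minimal primes have the same height; equivalently $c_G(T)=|T|+c$ for all $T\in\mathfrak{C}(G)$, where $c$ is the number of connected components of $G$. For a vertex $v$, $G_v$ is the graph with $V(G_v)=V(G)$ and $E(G_v)=E(G)\cup\{\{i,j\}: i,j\in\mathcal{N}_G(v),\, i\ne j\}$, where $\mathcal{N}_G(v)$ is the set of neighbours of $v$. Recursively, $J_G$ is strongly unmixed if every connected component of $G$ is complete, or if $J_G$ is unmixed and there exists a cut vertex $v$ of $G$ such that $J_{G\setminus\{v\}}$, $J_{G_v}$ and $J_{G_v\setminus\{v\}}$ are all strongly unmixed. Star product: let $K_m,K_n$ be disjoint complete graphs with vertex sets $\{x_1,\dots,x_m\}$ and $\{y_1,\dots,y_n\}$. $K_m\star_rK_n$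 has vertex set $V(K_m)\sqcup V(K_n)$ and edge set $E(K_m)\cup E(K_n)\cup\{\{x_i,y_i\}:1\le i\le r\}$. The graph $\overline{K_m\star_rK_n}$ is obtained from it by adding new vertices $f_{x_i},f_{y_i}$ and edges $\{x_i,f_{x_i}\},\{y_i,f_{y_i}\}$ for $2\le i\le r$. *)

theory Defs
  imports "HOL-Algebra.Ideal" "HOL-Library.Poly_Mapping" "HOL-Library.Extended_Nat"
begin

section \<open>Finite simple graphs\<close>

record 'v ugraph =
  verts :: "'v set"
  edges :: "'v set set"

definition simple_graph :: "'v ugraph \<Rightarrow> bool" where
  "simple_graph G \<longleftrightarrow> finite (verts G) \<and> edges G \<subseteq> {e. e \<subseteq> verts G \<and> card e = 2}"

definition neighbours :: "'v ugraph \<Rightarrow> 'v \<Rightarrow> 'v set" where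
  "neighbours G v = {w \<in> verts G. {v, w} \<in> edges G}"

definition complete_graph :: "'v set \<Rightarrow> 'v ugraph" where
  "complete_graph V = \<lparr>verts = V, edges = {{u, w} | u w. u \<in> V \<and> w \<in> V \<and> u \<noteq> w}\<rparr>"

definition delete_verts :: "'v ugraph \<Rightarrow> 'v set \<Rightarrow> 'v ugraph" where
  "delete_verts G T = \<lparr>verts = verts G - T, edges = {e \<in> edges G. e \<inter> T = {}}\<rparr>"

definition connected_rel :: "'v ugraph \<Rightarrow> 'v rel" where
  "connected_rel G = {(u, w). u \<in> verts G \<and> w \<in> verts G \<and> (u, w) \<in> {(a, b). {a, b} \<in> edges G}\<^sup>*}"

definition components :: "'v ugraph \<Rightarrow> 'v set set" where
  "components G = verts G // connected_rel G"

definition cut_vertex :: "'v ugraph \<Rightarrow> 'v \<Rightarrow> bool" where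
  "cut_vertex G v \<longleftrightarrow>
     v \<in> verts G \<and> card (components (delete_verts G {v})) > card (components G)"

text \<open>The graph \<open>G\<^sub>v\<close>: the neighbourhood of \<open>v\<close> is made into a clique.\<close>

definition complete_nbhd :: "'v ugraph \<Rightarrow> 'v \<Rightarrow> 'v ugraph" where
  "complete_nbhd G v =
     \<lparr>verts = verts G,
      edges = edges G \<union> {{i, j} | i j. i \<in> neighbours G v \<and> j \<in> neighbours G v \<and> i \<noteq> j}\<rparr>"

definition all_components_complete :: "'v ugraph \<Rightarrow> bool" where
  "all_components_complete G \<longleftrightarrow>
     (\<forall>C\<in>components G. \<forall>u\<in>C. \<forall>w\<in>C. u \<noteq> w \<longrightarrow> {u, w} \<in> edges G)"

lemma simple_graph_delete_verts: "simple_graph G \<Longrightarrow> simple_graph (delete_verts G T)"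
  by (auto simp: simple_graph_def delete_verts_def)

lemma simple_graph_complete_nbhd: "simple_graph G \<Longrightarrow> simple_graph (complete_nbhd G v)"
  by (auto simp: simple_graph_def complete_nbhd_def neighbours_def card_insert_if)


section \<open>Unmixed ideals\<close>

definition minimal_primes :: "('a, 'b) ring_scheme \<Rightarrow> 'a set \<Rightarrow> 'a set set" where
  "minimal_primes R I =
     {P. primeideal P R \<and> I \<subseteq> P \<and> (\<forall>Q. primeideal Q R \<and> I \<subseteq> Q \<and> Q \<subseteq> P \<longrightarrow> Q = P)}"

text \<open>The height of a prime ideal \<open>P\<close>: the supremum of the lengths \<open>l\<close> of the chains
  \<open>C 0 \<subset> C 1 \<subset> \<dots> \<subset> C l = P\<close> of prime ideals.\<close>

definition prime_height :: "('a, 'b) ring_scheme \<Rightarrow> 'a set \<Rightarrow> enat" where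
  "prime_height R P =
     Sup {enat l | l. \<exists>C :: nat \<Rightarrow> 'a set.
            (\<forall>i\<le>l. primeideal (C i) R) \<and> (\<forall>i<l. C i \<subset> C (Suc i)) \<and> C l = P}"

definition unmixed :: "('a, 'b) ring_scheme \<Rightarrow> 'a set \<Rightarrow> bool" where
  "unmixed R I \<longleftrightarrow>
     (\<forall>P\<in>minimal_primes R I. \<forall>Q\<in>minimal_primes R I. prime_height R P = prime_height R Q)"


section \<open>Polynomial rings and binomial edge ideals\<close>

text \<open>A polynomial maps monomials, i.e. finitely supported exponent functions, to coefficients.
  The polynomial ring over the field \<open>'k\<close> in the set \<open>X\<close> of variables is the subring of those
  polynomials in which only variables from \<open>X\<close> occur.\<close>

definition poly_ring :: "'x set \<Rightarrow> (('x \<Rightarrow>\<^sub>0 nat) \<Rightarrow>\<^sub>0 'k::field) ring" where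
  "poly_ring X =
     \<lparr>carrier = {p. \<forall>m\<in>Poly_Mapping.keys p. Poly_Mapping.keys m \<subseteq> X},
      mult = (*), one = 1, zero = 0, add = (+)\<rparr>"

lemma poly_ring_add_closed:
  assumes "p \<in> carrier (poly_ring X)" "q \<in> carrier (poly_ring X)"
  shows "p + q \<in> carrier (poly_ring X)"
  using assms Poly_Mapping.keys_add[of p q] unfolding poly_ring_def by (auto dest!: subsetD)

lemma poly_ring_mult_closed:
  assumes "p \<in> carrier (poly_ring X)" "q \<in> carrier (poly_ring X)"
  shows "p * q \<in> carrier (poly_ring X)"
proof -
  have "Poly_Mapping.keys m \<subseteq> X" if m: "m \<in> Poly_Mapping.keys (p * q)" for m
  proof -
    obtain a b where ab: "m = a + b" "a \<in> Poly_Mapping.keys p" "b \<in> Poly_Mapping.keys q"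
      using m Poly_Mapping.keys_mult[of p q] by auto
    have "Poly_Mapping.keys a \<subseteq> X" "Poly_Mapping.keys b \<subseteq> X"
      using ab assms by (auto simp: poly_ring_def)
    then show ?thesis
      unfolding ab(1) using Poly_Mapping.keys_add[of a b] by (metis Un_least order_trans)
  qed
  then show ?thesis by (simp add: poly_ring_def)
qed

lemma cring_poly_ring: "cring (poly_ring X)"
proof (rule cringI)
  let ?R = "poly_ring X"
  have "\<exists>q\<in>carrier ?R. q \<oplus>\<^bsub>?R\<^esub> p = \<zero>\<^bsub>?R\<^esub>" if "p \<in> carrier ?R" for p
    using that by (intro bexI[of _ "- p"]) (simp_all add: poly_ring_def)
  then show "abelian_group ?R"
    using poly_ring_add_closed[of _ X]
    by (intro abelian_groupI) (simp_all add: poly_ring_def add_ac)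
  show "comm_monoid ?R"
    using poly_ring_mult_closed[of _ X]
    by (intro comm_monoidI) (simp_all add: poly_ring_def mult_ac)
qed (simp add: poly_ring_def distrib_right)

datatype 'v edge_var = XVar 'v | YVar 'v

type_synonym ('v, 'k) edge_poly = "('v edge_var \<Rightarrow>\<^sub>0 nat) \<Rightarrow>\<^sub>0 'k"

definition var :: "'x \<Rightarrow> ('x \<Rightarrow>\<^sub>0 nat) \<Rightarrow>\<^sub>0 'k::field" where
  "var z = Poly_Mapping.single (Poly_Mapping.single z 1) 1"

definition edge_ring :: "'v ugraph \<Rightarrow> ('v, 'k::field) edge_poly ring" where
  "edge_ring G = poly_ring (XVar ` verts G \<union> YVar ` verts G)"

text \<open>Vertices carry no order here, so both binomials \<open>\<plusminus>(x\<^sub>i y\<^sub>j - x\<^sub>j y\<^sub>i)\<close> of an edge \<open>{i, j}\<close> are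
  among the generators; they generate the same ideal as the ones with \<open>i < j\<close>.\<close>

definition binomial_edge_ideal :: "'v ugraph \<Rightarrow> ('v, 'k::field) edge_poly set" where
  "binomial_edge_ideal G =
     Idl\<^bsub>edge_ring G\<^esub> {var (XVar i) * var (YVar j) - var (XVar j) * var (YVar i) | i j. {i, j} \<in> edges G}"

text \<open>Here \<open>K\<close> only serves to pass the coefficient field: \<open>strongly_unmixed TYPE('k) G\<close> says that
  \<open>J\<^sub>G\<close>, as an ideal of the polynomial ring over \<open>'k\<close>, is strongly unmixed.\<close>

inductive strongly_unmixed :: "'k::field itself \<Rightarrow> 'v ugraph \<Rightarrow> bool" for K :: "'k::field itself" where
  complete:
    "all_components_complete G \<Longrightarrow> strongly_unmixed K G"
| cut:
    "\<lbrakk>unmixed (edge_ring G :: ('v, 'k) edge_poly ring) (binomial_edge_ideal G);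
      cut_vertex G v;
      strongly_unmixed K (delete_verts G {v});
      strongly_unmixed K (complete_nbhd G v);
      strongly_unmixed K (delete_verts (complete_nbhd G v) {v})\<rbrakk>
     \<Longrightarrow> strongly_unmixed K G"


section \<open>The star product of two complete graphs\<close>

text \<open>\<open>FX i\<close> and \<open>FY i\<close> are the vertices \<open>f\<close> attached to \<open>x\<^sub>i\<close> and \<open>y\<^sub>i\<close>.\<close>

datatype star_vertex = X nat | Y nat | FX nat | FY nat

definition star_product :: "nat \<Rightarrow> nat \<Rightarrow> nat \<Rightarrow> star_vertex ugraph" where
  "star_product m n r =
     (let Km = complete_graph (X ` {1..m}); Kn = complete_graph (Y ` {1..n}) in
      \<lparr>verts = verts Km \<union> verts Kn,
       edges = edges Km \<union> edges Kn \<union> {{X i, Y i} | i. 1 \<le> i \<and> i \<le> r}\<rparr>)"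

definition star_product_bar :: "nat \<Rightarrow> nat \<Rightarrow> nat \<Rightarrow> star_vertex ugraph" where
  "star_product_bar m n r =
     \<lparr>verts = verts (star_product m n r) \<union> FX ` {2..r} \<union> FY ` {2..r},
      edges = edges (star_product m n r)
        \<union> {{X i, FX i} | i. 2 \<le> i \<and> i \<le> r} \<union> {{Y i, FY i} | i. 2 \<le> i \<and> i \<le> r}\<rparr>"

lemma simple_graph_star_product_bar:
  "r \<le> m \<Longrightarrow> r \<le> n \<Longrightarrow> simple_graph (star_product_bar m n r)"
  by (auto simp: simple_graph_def star_product_bar_def star_product_def complete_graph_def
      Let_def card_insert_if)

end

theory Submission
  imports Defs
begin

text \<open>
  The proof has a combinatorial and an algebraic half, joined by a counting condition on cutsets.
  Write \<open>c(T)\<close> for the number of components left after deleting \<open>T\<close>, and call a graph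
  \<^emph>\<open>balanced\<close> if \<open>c(T) = |T| + c({})\<close> for every cutset \<open>T\<close>.

  \<^emph>\<open>Algebra: a balanced graph has an unmixed binomial edge ideal\<close>
  (\<open>unmixed_if_cutset_balanced\<close>). If a prime \<open>P\<close> contains \<open>J\<^sub>G\<close>, let \<open>T\<close> be the set of vertices
  \<open>v\<close> with both \<open>x\<^sub>v\<close> and \<open>y\<^sub>v\<close> in \<open>P\<close>. Modulo \<open>P\<close> the vectors \<open>(x\<^sub>v, y\<^sub>v)\<close> along a path outside
  \<open>T\<close> are nonzero and pairwise proportional, so \<open>P\<close> contains the prime \<open>P\<^sub>T\<close> (\<open>cut_prime\<close>), the
  kernel of the map that kills the variables of \<open>T\<close> and sends \<open>x\<^sub>v\<close> to \<open>z\<^sub>v a\<^sub>C\<close> and \<open>y\<^sub>v\<close> to \<open>z\<^sub>v b\<^sub>C\<close>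
  for \<open>v\<close> in the component \<open>C\<close>. Hence every minimal prime is some \<open>P\<^sub>T\<close>, and minimality forces
  \<open>T\<close> to be a cutset: if \<open>t\<close> is not a cut vertex once the rest of \<open>T\<close> is gone, putting \<open>t\<close> back
  merges no components and \<open>P\<close> can be made smaller. The height of \<open>P\<^sub>T\<close> is \<open>|V| + |T| - c(T)\<close>,
  which does not depend on \<open>T\<close> in a balanced graph.

  For the height, a chain of that length is written down explicitly: kill the variables of \<open>T\<close> one by
  one, then merge the vertices of each component one by one. No chain is longer
  (\<open>prime_chain_length_le\<close>): choosing \<open>g\<^sub>i\<close> in the \<open>i\<close>-th step of a chain of length \<open>l\<close>
  ending in \<open>P\<close>, and \<open>d\<close> variables that are algebraically independent modulo \<open>P\<close>, the products of
  powers of all these \<open>l + d\<close> polynomials are linearly independent, and a dimension count gives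
  \<open>l + d \<le> 2|V|\<close>.

  \<^emph>\<open>Combinatorics: being balanced comes for free along the recursion\<close>
  (\<open>splittable_cutset_balanced\<close>). Suppose that deleting \<open>v\<close> creates exactly one new component, and
  that \<open>G - v\<close> and \<open>G\<^sub>v\<close> are balanced. A cutset of \<open>G\<close> avoiding \<open>v\<close> is a cutset of \<open>G\<^sub>v\<close>
  leaving as many components; a cutset containing \<open>v\<close> is, without \<open>v\<close>, a cutset of \<open>G - v\<close>. So
  \<open>G\<close> is balanced too, and cutsets never have to be enumerated: it suffices to run the recursion down
  to disjoint unions of complete graphs with cut vertices that split off one component each.

  For the star product, all graphs met on the way consist, apart from isolated vertices, of two cliques
  joined by a matching and by shared vertices, with leaves (whiskers) attached. Each link but one carries whiskers, so cutting at a
  whiskered vertex of a link isolates a leaf while the remaining link keeps the rest together, and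
  completing its neighbourhood either turns a matching edge into a shared vertex or fuses the two
  cliques (\<open>matched_cliques_splittable\<close>). Once a single link without whiskers is left, cutting there
  separates the cliques.
\<close>

abbreviation keys :: "('a \<Rightarrow>\<^sub>0 'b::zero) \<Rightarrow> 'a set" where "keys \<equiv> Poly_Mapping.keys"
abbreviation lookup :: "('a \<Rightarrow>\<^sub>0 'b::zero) \<Rightarrow> 'a \<Rightarrow> 'b" where "lookup \<equiv> Poly_Mapping.lookup"
abbreviation single :: "'a \<Rightarrow> 'b \<Rightarrow> 'a \<Rightarrow>\<^sub>0 'b::zero" where "single \<equiv> Poly_Mapping.single"

section \<open>Prime ideals of a polynomial ring\<close>

lemma mem_poly_ring_iff:
  "p \<in> carrier (poly_ring S) \<longleftrightarrow> (\<forall>m\<in>keys p. keys m \<subseteq> S)"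
  by (simp add: poly_ring_def)

lemma poly_ring_simps [simp]:
  "p \<otimes>\<^bsub>poly_ring S\<^esub> q = p * q" "p \<oplus>\<^bsub>poly_ring S\<^esub> q = p + q"
  "\<zero>\<^bsub>poly_ring S\<^esub> = 0" "\<one>\<^bsub>poly_ring S\<^esub> = 1"
  by (simp_all add: poly_ring_def)

lemma zero_in_poly_ring [simp]: "0 \<in> carrier (poly_ring S)"
  and one_in_poly_ring [simp]: "1 \<in> carrier (poly_ring S)"
  by (simp_all add: mem_poly_ring_iff)

lemma uminus_in_poly_ring: "p \<in> carrier (poly_ring S) \<Longrightarrow> - p \<in> carrier (poly_ring S)"
  by (simp add: mem_poly_ring_iff in_keys_iff)

lemma diff_in_poly_ring:
  "p \<in> carrier (poly_ring S) \<Longrightarrow> q \<in> carrier (poly_ring S) \<Longrightarrow> p - q \<in> carrier (poly_ring S)"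
  using poly_ring_add_closed[OF _ uminus_in_poly_ring, of p S q] by simp

lemma single_in_poly_ring:
  "keys m \<subseteq> S \<Longrightarrow> single m c \<in> carrier (poly_ring S)"
  by (simp add: mem_poly_ring_iff)

lemma sum_in_poly_ring:
  "(\<And>i. i \<in> A \<Longrightarrow> f i \<in> carrier (poly_ring S)) \<Longrightarrow> sum f A \<in> carrier (poly_ring S)"
  by (induction A rule: infinite_finite_induct) (auto intro: poly_ring_add_closed)

lemma power_in_poly_ring: "p \<in> carrier (poly_ring S) \<Longrightarrow> p ^ k \<in> carrier (poly_ring S)"
  by (induction k) (auto intro: poly_ring_mult_closed)

lemma prime_poly_ringD:
  assumes "primeideal P (poly_ring S)"
  shows "P \<subseteq> carrier (poly_ring S)" "0 \<in> P" "1 \<notin> P"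
    and "\<And>a b. a \<in> P \<Longrightarrow> b \<in> P \<Longrightarrow> a + b \<in> P"
    and "\<And>a b. a \<in> P \<Longrightarrow> b \<in> P \<Longrightarrow> a - b \<in> P"
    and "\<And>a b. a \<in> P \<Longrightarrow> b \<in> carrier (poly_ring S) \<Longrightarrow> b * a \<in> P"
    and "\<And>a b. a \<in> carrier (poly_ring S) \<Longrightarrow> b \<in> carrier (poly_ring S) \<Longrightarrow> a * b \<in> P \<Longrightarrow> a \<in> P \<or> b \<in> P"
proof -
  interpret primeideal P "poly_ring S" by fact
  show sub: "P \<subseteq> carrier (poly_ring S)" using a_subset by simp
  show "0 \<in> P" using additive_subgroup.zero_closed[OF additive_subgroup_axioms] by simp
  show "1 \<notin> P" using I_notcarr one_imp_carrier by auto
  show add: "a + b \<in> P" if "a \<in> P" "b \<in> P" for a b using additive_subgroup.a_closed[OF additive_subgroup_axioms that] by simp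
  show mult: "b * a \<in> P" if "a \<in> P" "b \<in> carrier (poly_ring S)" for a b
    using I_l_closed[OF that] by simp
  show "a - b \<in> P" if "a \<in> P" "b \<in> P" for a b
    using add[OF that(1) mult[OF that(2), of "- 1"]] by (simp add: uminus_in_poly_ring)
  show "a \<in> P \<or> b \<in> P"
    if "a \<in> carrier (poly_ring S)" "b \<in> carrier (poly_ring S)" "a * b \<in> P" for a b
    using I_prime[OF that(1,2)] that(3) by simp
qed

lemma prime_sum_closed:
  assumes "primeideal P (poly_ring S)" "\<And>i. i \<in> A \<Longrightarrow> f i \<in> P"
  shows "sum f A \<in> P"
  using assms(2)
  by (induction A rule: infinite_finite_induct) (auto intro: prime_poly_ringD[OF assms(1)])

text \<open>
  Stated for a ring homomorphism on the whole type, of which the carrier is a subring; this keeps all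
  later homomorphisms free of side conditions about carriers.
\<close>

lemma kernel_primeideal:
  fixes \<phi> :: "(('x \<Rightarrow>\<^sub>0 nat) \<Rightarrow>\<^sub>0 'k::field) \<Rightarrow> 'b::idom"
  assumes add: "\<And>p q. \<phi> (p + q) = \<phi> p + \<phi> q"
    and mult: "\<And>p q. \<phi> (p * q) = \<phi> p * \<phi> q"
    and one: "\<phi> 1 = 1"
  shows "primeideal {p \<in> carrier (poly_ring S). \<phi> p = 0} (poly_ring S)"
proof -
  interpret cring "poly_ring S :: (('x \<Rightarrow>\<^sub>0 nat) \<Rightarrow>\<^sub>0 'k) ring" by (rule cring_poly_ring)
  let ?R = "poly_ring S :: (('x \<Rightarrow>\<^sub>0 nat) \<Rightarrow>\<^sub>0 'k) ring"
  let ?I = "{p \<in> carrier ?R. \<phi> p = 0}"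
  have zero: "\<phi> 0 = 0" using add[of 0 0] by (metis add_0 add_cancel_right_left)
  have uminus: "\<phi> (- p) = - \<phi> p" for p using add[of p "- p"] zero by (simp add: eq_neg_iff_add_eq_0 add.commute)
  have a_inv: "\<ominus>\<^bsub>?R\<^esub> p = - p" if "p \<in> carrier ?R" for p
    using that by (intro minus_equality) (simp_all add: uminus_in_poly_ring)
  have "subgroup ?I (add_monoid ?R)"
  proof (rule add.subgroupI)
    show "?I \<subseteq> carrier ?R" by auto
    show "?I \<noteq> {}" using zero zero_in_poly_ring by blast
    show "\<ominus>\<^bsub>?R\<^esub> p \<in> ?I" if "p \<in> ?I" for p
      using that by (simp add: a_inv uminus uminus_in_poly_ring)
    show "p \<oplus>\<^bsub>?R\<^esub> q \<in> ?I" if "p \<in> ?I" "q \<in> ?I" for p q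
      using that by (simp add: add poly_ring_add_closed)
  qed
  then have "ideal ?I ?R"
    by (intro idealI) (auto simp: mult ring_axioms poly_ring_mult_closed)
  moreover have "carrier ?R \<noteq> ?I" using one one_in_poly_ring by force
  ultimately show ?thesis
    by (intro primeidealI) (auto simp: mult cring_poly_ring)
qed


section \<open>The height of a prime is at most the number of dependent variables\<close>

lemma poly_mapping_eq_sum_single:
  assumes "finite F" "keys p \<subseteq> F"
  shows "p = (\<Sum>m\<in>F. single m (lookup p m))"
  using assms
  by (intro poly_mapping_eqI)
     (auto simp: lookup_sum lookup_single when_def in_keys_iff)

text \<open>
  Families are indexed rather than given as sets, because in the application it is part of the
  claim that different indices give different polynomials; injectivity follows from independence.
\<close>

lemma card_independent_family_le:
  fixes u :: "'i \<Rightarrow> ('a::comm_monoid_add \<Rightarrow>\<^sub>0 'k::field)"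
  assumes "finite I" "finite F"
    and keys: "\<And>i. i \<in> I \<Longrightarrow> keys (u i) \<subseteq> F"
    and indep: "\<And>c. (\<Sum>i\<in>I. single 0 (c i) * u i) = 0 \<Longrightarrow> \<forall>i\<in>I. c i = 0"
  shows "card I \<le> card F"
proof -
  let ?s = "\<lambda>(c::'k) (p :: 'a \<Rightarrow>\<^sub>0 'k). single 0 c * p"
  interpret V: vector_space ?s
    by unfold_locales (simp_all add: algebra_simps single_add mult_single flip: mult.assoc)
  have inj: "inj_on u I"
  proof (rule inj_onI, rule ccontr)
    fix i j assume ij: "i \<in> I" "j \<in> I" "u i = u j" "i \<noteq> j"
    define c where "c k = (if k = i then 1 else if k = j then -1 else 0 :: 'k)" for k
    have "(\<Sum>k\<in>I. ?s (c k) (u k)) = (\<Sum>k\<in>{i,j}. ?s (c k) (u k))"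
      using assms(1) ij by (intro sum.mono_neutral_right) (auto simp: c_def)
    also have "\<dots> = 0" using ij by (simp add: c_def single_uminus)
    finally have "c i = 0" using indep ij(1) by blast
    then show False by (simp add: c_def)
  qed
  have "V.independent (u ` I)"
    unfolding V.dependent_finite[OF finite_imageI[OF assms(1)]]
  proof safe
    fix c i assume 0: "(\<Sum>v\<in>u ` I. ?s (c v) v) = 0" and i: "i \<in> I" and nz: "c (u i) \<noteq> 0"
    have "(\<Sum>i\<in>I. ?s (c (u i)) (u i)) = 0"
      using 0 by (simp add: sum.reindex[OF inj])
    then show False using indep[of "\<lambda>i. c (u i)"] i nz by blast
  qed
  moreover have "u ` I \<subseteq> V.span ((\<lambda>m. single m 1) ` F)"
  proof (intro subsetI, elim imageE)
    fix p i assume p: "p = u i" "i \<in> I"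
    have "p = (\<Sum>m\<in>F. ?s (lookup p m) (single m 1))"
      using poly_mapping_eq_sum_single[OF assms(2) keys[OF p(2)]] p by (simp add: mult_single)
    also have "\<dots> \<in> V.span ((\<lambda>m. single m 1) ` F)"
      by (intro V.span_sum V.span_scale V.span_base) auto
    finally show "p \<in> V.span ((\<lambda>m. single m 1) ` F)" .
  qed
  ultimately have "card (u ` I) \<le> card ((\<lambda>m. single m (1::'k)) ` F)"
    using V.independent_span_bound[of "(\<lambda>m. single m 1) ` F" "u ` I"] assms(2) by blast
  also have "\<dots> \<le> card F" using assms(2) by (rule card_image_le)
  finally show ?thesis by (simp add: card_image[OF inj])
qed

text \<open>
  Elements that are either zero or independent of \<open>P'\<close> become independent of each other over the
  powers of any \<open>g \<in> P' - P\<close>, modulo the smaller prime \<open>P\<close>: reducing modulo \<open>P'\<close> kills everything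
  but \<open>s 0\<close>, so \<open>s 0 = 0\<close>; then \<open>g\<close> can be cancelled, as \<open>P\<close> is prime, and one repeats.
\<close>

lemma power_expansion_in_prime:
  assumes P: "primeideal P (poly_ring S)" and P': "primeideal P' (poly_ring S)"
    and "P \<subseteq> P'" and g: "g \<in> P'" "g \<notin> P"
    and s: "\<And>j. s j \<in> carrier (poly_ring S)" "\<And>j. j \<le> J \<Longrightarrow> s j \<in> P' \<Longrightarrow> s j = 0"
    and sum: "(\<Sum>j\<le>J. g ^ j * s j) \<in> P"
  shows "\<forall>j\<le>J. s j = 0"
  using s sum
proof (induction J arbitrary: s)
  case 0
  then show ?case using \<open>P \<subseteq> P'\<close> by auto
next
  case (Suc J)
  have g_carr: "g \<in> carrier (poly_ring S)" using g prime_poly_ringD(1)[OF P'] by auto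
  let ?t = "\<Sum>j\<le>J. g ^ j * s (Suc j)"
  have t_carr: "?t \<in> carrier (poly_ring S)"
    by (intro sum_in_poly_ring poly_ring_mult_closed power_in_poly_ring g_carr Suc.prems)
  have split: "(\<Sum>j\<le>Suc J. g ^ j * s j) = s 0 + g * ?t"
    unfolding sum.atMost_Suc_shift by (simp add: sum_distrib_left mult.assoc)
  have "t * g \<in> P'" if "t \<in> carrier (poly_ring S)" for t
    using prime_poly_ringD(6)[OF P' g(1) that] .
  then have "g * ?t \<in> P'" using t_carr by (metis mult.commute)
  moreover have "s 0 + g * ?t \<in> P'" using Suc.prems(3) \<open>P \<subseteq> P'\<close> split by auto
  ultimately have "s 0 \<in> P'" using prime_poly_ringD(5)[OF P'] by force
  then have s0: "s 0 = 0" using Suc.prems(2) by simp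
  then have "g * ?t \<in> P" using Suc.prems(3) split by simp
  then have "?t \<in> P" using prime_poly_ringD(7)[OF P g_carr t_carr] g by blast
  then have "\<forall>j\<le>J. s (Suc j) = 0"
    by (intro Suc.IH[of "\<lambda>j. s (Suc j)"]) (rule Suc.prems(1), erule (1) Suc.prems(2)[OF iffD2[OF Suc_le_mono]])
  then show ?case using s0 by (metis Suc_le_mono not0_implies_Suc)
qed

definition power_prod :: "'a::comm_monoid_mult list \<Rightarrow> nat list \<Rightarrow> 'a" where
  "power_prod gs js = prod_list (map2 (^) gs js)"

lemma power_prod_simps [simp]:
  "power_prod [] js = 1" "power_prod (g # gs) (j # js) = g ^ j * power_prod gs js"
  by (simp_all add: power_prod_def)

definition exponent_lists :: "nat \<Rightarrow> nat \<Rightarrow> nat list set" where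
  "exponent_lists l J = {js. set js \<subseteq> {..J} \<and> length js = l}"

lemma finite_exponent_lists [simp]: "finite (exponent_lists l J)"
  and card_exponent_lists: "card (exponent_lists l J) = Suc J ^ l"
  unfolding exponent_lists_def by (simp_all add: finite_lists_length_eq card_lists_length_eq)

lemma exponent_lists_Suc:
  "exponent_lists (Suc l) J = (\<lambda>(j, js). j # js) ` ({..J} \<times> exponent_lists l J)"
  by (auto simp: exponent_lists_def length_Suc_conv image_iff)

lemma sum_exponent_lists_Suc:
  "(\<Sum>js\<in>exponent_lists (Suc l) J. f js) = (\<Sum>j\<le>J. \<Sum>js\<in>exponent_lists l J. f (j # js))"
proof -
  have "inj_on (\<lambda>(j, js). j # js) ({..J} \<times> exponent_lists l J)" by (auto simp: inj_on_def)
  then show ?thesis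
    by (simp add: exponent_lists_Suc sum.reindex sum.cartesian_product case_prod_unfold o_def)
qed

lemma power_prod_in_poly_ring:
  "set gs \<subseteq> carrier (poly_ring S) \<Longrightarrow> length js = length gs \<Longrightarrow>
     power_prod gs js \<in> carrier (poly_ring S)"
  by (induction gs arbitrary: js)
     (auto simp: length_Suc_conv intro!: poly_ring_mult_closed power_in_poly_ring)

text \<open>
  The invariant carried along a chain of primes from \<open>P\<close> up to \<open>Q\<close>. Linear independence of power
  products, with the coefficients written out, takes the place of algebraic independence, so that
  nothing has to be substituted into polynomials.
\<close>

definition lifts_independence ::
    "(('x \<Rightarrow>\<^sub>0 nat) \<Rightarrow>\<^sub>0 'k::field) list \<Rightarrow> 'x set \<Rightarrow> (('x \<Rightarrow>\<^sub>0 nat) \<Rightarrow>\<^sub>0 'k) set \<Rightarrow>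
      (('x \<Rightarrow>\<^sub>0 nat) \<Rightarrow>\<^sub>0 'k) set \<Rightarrow> bool" where
  "lifts_independence gs S Q P \<longleftrightarrow>
    (\<forall>J A. \<forall>c :: nat list \<Rightarrow> ('x \<Rightarrow>\<^sub>0 nat) \<Rightarrow> 'k.
      (\<forall>m\<in>A. keys m \<subseteq> S) \<longrightarrow>
      (\<forall>d. (\<Sum>m\<in>A. single m (d m)) \<in> Q \<longrightarrow> (\<forall>m\<in>A. d m = 0)) \<longrightarrow>
      (\<Sum>js\<in>exponent_lists (length gs) J.
         power_prod gs js * (\<Sum>m\<in>A. single m (c js m))) \<in> P \<longrightarrow>
      (\<forall>js\<in>exponent_lists (length gs) J. \<forall>m\<in>A. c js m = 0))"

text \<open>
  One polynomial is picked from every step of the chain, and every step contributes its powers through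
  \<open>power_expansion_in_prime\<close>. This is the statement that the transcendence degree of the residue
  ring drops in every step, phrased with linear independence only.
\<close>

lemma prime_chain_independent:
  fixes C :: "nat \<Rightarrow> (('x \<Rightarrow>\<^sub>0 nat) \<Rightarrow>\<^sub>0 'k::field) set"
  assumes "\<And>i. i \<le> l \<Longrightarrow> primeideal (C i) (poly_ring S)" "\<And>i. i < l \<Longrightarrow> C i \<subset> C (Suc i)"
  shows "\<exists>gs. length gs = l \<and> set gs \<subseteq> carrier (poly_ring S) \<and> lifts_independence gs S (C l) (C 0)"
  using assms
proof (induction l arbitrary: C)
  case 0
  have "exponent_lists 0 J = {[]}" for J by (auto simp: exponent_lists_def)
  then show ?case by (auto simp: lifts_independence_def)
next
  case (Suc l)
  have "\<exists>gs. length gs = l \<and> set gs \<subseteq> carrier (poly_ring S)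
      \<and> lifts_independence gs S (C (Suc l)) (C (Suc 0))"
    using Suc.prems by (intro Suc.IH[of "\<lambda>i. C (Suc i)"]) auto
  then obtain gs where gs: "length gs = l" "set gs \<subseteq> carrier (poly_ring S)"
    and indep: "lifts_independence gs S (C (Suc l)) (C 1)"
    by auto
  have P0: "primeideal (C 0) (poly_ring S)" and P1: "primeideal (C 1) (poly_ring S)"
    using Suc.prems(1) by auto
  obtain g where g: "g \<in> C 1" "g \<notin> C 0" and sub: "C 0 \<subseteq> C 1"
    using Suc.prems(2)[of 0] by auto
  have g_carr: "g \<in> carrier (poly_ring S)" using g prime_poly_ringD(1)[OF P1] by auto
  have "lifts_independence (g # gs) S (C (Suc l)) (C 0)"
    unfolding lifts_independence_def
  proof (intro allI impI)
    fix J A and c :: "nat list \<Rightarrow> ('x \<Rightarrow>\<^sub>0 nat) \<Rightarrow> 'k"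
    assume A: "\<forall>m\<in>A. keys m \<subseteq> S"
        "\<forall>d. (\<Sum>m\<in>A. single m (d m)) \<in> C (Suc l) \<longrightarrow> (\<forall>m\<in>A. d m = 0)"
      and sum: "(\<Sum>js\<in>exponent_lists (length (g # gs)) J.
         power_prod (g # gs) js * (\<Sum>m\<in>A. single m (c js m))) \<in> C 0"
    define s where
      "s j = (\<Sum>js\<in>exponent_lists l J. power_prod gs js * (\<Sum>m\<in>A. single m (c (j # js) m)))" for j
    have s_carr: "s j \<in> carrier (poly_ring S)" for j
      unfolding s_def using A gs
      by (intro sum_in_poly_ring poly_ring_mult_closed power_prod_in_poly_ring single_in_poly_ring)
         (auto simp: exponent_lists_def)
    have zero: "\<forall>js\<in>exponent_lists l J. \<forall>m\<in>A. c (j # js) m = 0" if "s j \<in> C 1" for j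
      using indep[unfolded lifts_independence_def gs(1), THEN spec, THEN spec, THEN spec,
          of A "\<lambda>js. c (j # js)" J] A that
      unfolding s_def by blast
    have s0: "s j = 0" if "s j \<in> C 1" for j
      using zero[OF that] by (simp add: s_def)
    have sum': "(\<Sum>j\<le>J. g ^ j * s j) \<in> C 0"
      using sum by (simp add: sum_exponent_lists_Suc s_def sum_distrib_left mult.assoc gs(1))
    have "\<forall>j\<le>J. s j = 0"
      by (rule power_expansion_in_prime[OF P0 P1 sub g]) (fact s_carr, erule s0, fact sum')
    then have "\<forall>j\<le>J. \<forall>js\<in>exponent_lists l J. \<forall>m\<in>A. c (j # js) m = 0"
      using zero prime_poly_ringD(2)[OF P1] by metis
    then show "\<forall>js\<in>exponent_lists (length (g # gs)) J. \<forall>m\<in>A. c js m = 0"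
      by (auto simp: exponent_lists_Suc gs(1))
  qed
  then show ?case using gs g_carr by (intro exI[of _ "g # gs"]) auto
qed

text \<open>
  Bounding every exponent separately, rather than the total degree, makes the number of monomials an
  exact power, for the variables of \<open>S\<close> and of any subset alike.
\<close>

definition monomial_box :: "'x set \<Rightarrow> nat \<Rightarrow> ('x \<Rightarrow>\<^sub>0 nat) set" where
  "monomial_box S B = {m. keys m \<subseteq> S \<and> (\<forall>z. lookup m z \<le> B)}"

lemma
  assumes "finite S"
  shows finite_monomial_box: "finite (monomial_box S B)"
    and card_monomial_box: "card (monomial_box S B) = Suc B ^ card S"
proof -
  let ?r = "\<lambda>m. restrict (lookup m) S"
  have "bij_betw ?r (monomial_box S B) (S \<rightarrow>\<^sub>E {..B})"
  proof (rule bij_betw_imageI)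
    show "inj_on ?r (monomial_box S B)"
    proof (rule inj_onI, rule poly_mapping_eqI)
      fix m m' z
      assume m: "m \<in> monomial_box S B" "m' \<in> monomial_box S B" "?r m = ?r m'"
      show "lookup m z = lookup m' z"
      proof (cases "z \<in> S")
        case True
        then show ?thesis using fun_cong[OF m(3), of z] by simp
      next
        case False
        then have "z \<notin> keys m" "z \<notin> keys m'"
          using m by (auto simp: monomial_box_def)
        then show ?thesis by (simp add: in_keys_iff)
      qed
    qed
    show "?r ` monomial_box S B = (S \<rightarrow>\<^sub>E {..B})"
    proof safe
      fix f assume f: "f \<in> S \<rightarrow>\<^sub>E {..B}"
      let ?f = "\<lambda>z. if z \<in> S then f z else 0"
      let ?m = "Abs_poly_mapping ?f"
      have "finite {z. ?f z \<noteq> 0}" by (rule finite_subset[OF _ assms]) auto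
      then have lookup: "lookup ?m = ?f" by (rule lookup_Abs_poly_mapping)
      have "?m \<in> monomial_box S B"
        using f by (auto simp: monomial_box_def in_keys_iff lookup PiE_iff split: if_splits)
      moreover have "?r ?m = f"
        using f by (auto simp: lookup fun_eq_iff PiE_iff extensional_def)
      ultimately show "f \<in> ?r ` monomial_box S B" by (rule rev_image_eqI[OF _ sym])
    qed (auto simp: monomial_box_def)
  qed
  then have "finite (monomial_box S B) = finite (S \<rightarrow>\<^sub>E {..B})"
      "card (monomial_box S B) = card (S \<rightarrow>\<^sub>E {..B})"
    by (rule bij_betw_finite bij_betw_same_card)+
  then show "finite (monomial_box S B)" "card (monomial_box S B) = Suc B ^ card S"
    using assms by (auto simp: card_PiE finite_PiE)
qed

lemma monomial_box_mult:
  assumes "keys p \<subseteq> monomial_box S A" "keys q \<subseteq> monomial_box S B"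
  shows "keys (p * q) \<subseteq> monomial_box S (A + B)"
proof
  fix m assume "m \<in> keys (p * q)"
  then obtain a b where "m = a + b" "a \<in> monomial_box S A" "b \<in> monomial_box S B"
    using Poly_Mapping.keys_mult[of p q] assms by blast
  then show "m \<in> monomial_box S (A + B)"
    using Poly_Mapping.keys_add[of a b] by (auto simp: monomial_box_def lookup_add add_mono)
qed

lemma monomial_box_mono: "A \<le> B \<Longrightarrow> monomial_box S A \<subseteq> monomial_box S B"
  by (auto simp: monomial_box_def intro: order_trans)

lemma monomial_box_power:
  "keys p \<subseteq> monomial_box S A \<Longrightarrow> keys (p ^ j) \<subseteq> monomial_box S (j * A)"
proof (induction j)
  case 0
  then show ?case by (auto simp: monomial_box_def)
next
  case (Suc j)
  then show ?case using monomial_box_mult[of p S A "p ^ j" "j * A"] by simp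
qed

lemma monomial_box_power_prod:
  assumes "\<forall>g\<in>set gs. keys g \<subseteq> monomial_box S A" "length js = length gs" "set js \<subseteq> {..J}"
  shows "keys (power_prod gs js) \<subseteq> monomial_box S (length gs * (J * A))"
  using assms
proof (induction gs arbitrary: js)
  case Nil
  then show ?case by (auto simp: monomial_box_def)
next
  case (Cons g gs)
  then obtain j js' where js: "js = j # js'" by (cases js) auto
  have g: "keys (g ^ j) \<subseteq> monomial_box S (J * A)"
    using monomial_box_power[of g S A j] monomial_box_mono[of "j * A" "J * A" S] Cons.prems js by force
  have "keys (power_prod gs js') \<subseteq> monomial_box S (length gs * (J * A))"
    using Cons js by auto
  from monomial_box_mult[OF g this] show ?case by (simp add: js)
qed

lemma ex_monomial_box:
  assumes "finite G" "G \<subseteq> carrier (poly_ring S)"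
  shows "\<exists>A. \<forall>g\<in>G. keys g \<subseteq> monomial_box S A"
proof -
  define F where "F = (\<Union>g\<in>G. \<Union>m\<in>keys g. lookup m ` keys m)"
  have "finite F" unfolding F_def using assms(1) by auto
  have "lookup m z \<le> Max (insert 0 F)" if "g \<in> G" "m \<in> keys g" for g m z
  proof (cases "z \<in> keys m")
    case True
    then show ?thesis using that \<open>finite F\<close> by (intro Max_ge) (auto simp: F_def)
  qed (simp add: in_keys_iff)
  moreover have "keys m \<subseteq> S" if "g \<in> G" "m \<in> keys g" for g m
    using subsetD[OF assms(2) that(1)] that(2) by (simp add: mem_poly_ring_iff)
  ultimately show ?thesis
    by (intro exI[of _ "Max (insert 0 F)"]) (auto simp: monomial_box_def subset_iff)
qed

text \<open>
  The assumption on \<open>U\<close> says that its variables are algebraically independent modulo the last prime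
  of the chain. With exponents up to \<open>J\<close>, the chain and \<open>U\<close> produce \<open>(J + 1) ^ (l + |U|)\<close> linearly
  independent polynomials, whose exponents are bounded by a multiple of \<open>J\<close>; they live in a space of
  dimension at most \<open>(M (J + 1)) ^ |S|\<close> with \<open>M\<close> independent of \<open>J\<close>. For large \<open>J\<close> this forces
  \<open>l + |U| \<le> |S|\<close>.
\<close>

theorem prime_chain_length_le:
  fixes C :: "nat \<Rightarrow> (('x \<Rightarrow>\<^sub>0 nat) \<Rightarrow>\<^sub>0 'k::field) set"
  assumes "finite S" "U \<subseteq> S"
    and primes: "\<And>i. i \<le> l \<Longrightarrow> primeideal (C i) (poly_ring S)" "\<And>i. i < l \<Longrightarrow> C i \<subset> C (Suc i)"
    and indep: "\<And>p. p \<in> C l \<Longrightarrow> p \<in> carrier (poly_ring U) \<Longrightarrow> p = 0"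
  shows "l + card U \<le> card S"
proof (rule ccontr)
  assume neg: "\<not> l + card U \<le> card S"
  have "\<exists>gs. length gs = l \<and> set gs \<subseteq> carrier (poly_ring S) \<and> lifts_independence gs S (C l) (C 0)"
    by (rule prime_chain_independent) (fact primes)+
  then obtain gs where gs: "length gs = l" "set gs \<subseteq> carrier (poly_ring S)"
    and gs_indep: "lifts_independence gs S (C l) (C 0)" by blast
  obtain D where D: "\<forall>g\<in>set gs. keys g \<subseteq> monomial_box S D"
    using ex_monomial_box[OF _ gs(2)] by auto
  have "finite U" using assms finite_subset by blast
  \<comment> \<open>The bound \<open>l * (J * D) + J\<close> on the exponents is below \<open>M * Suc J\<close>.\<close>
  define M where "M = Suc (l * D)"
  have bound: "Suc J ^ (l + card U) \<le> (M * Suc J) ^ card S" for J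
  proof -
    let ?A = "monomial_box U J"
    let ?I = "exponent_lists l J \<times> ?A"
    let ?u = "\<lambda>(js, m). power_prod gs js * single m (1::'k)"
    have fin: "finite ?A" by (rule finite_monomial_box[OF \<open>finite U\<close>])
    have "card ?I \<le> card (monomial_box S (l * (J * D) + J))"
    proof (rule card_independent_family_le[of _ _ ?u])
      show "finite ?I" using fin by simp
      show "finite (monomial_box S (l * (J * D) + J))" by (rule finite_monomial_box[OF assms(1)])
      show "keys (?u i) \<subseteq> monomial_box S (l * (J * D) + J)" if "i \<in> ?I" for i
      proof -
        obtain js m where i: "i = (js, m)" "js \<in> exponent_lists l J" "m \<in> ?A" using \<open>i \<in> ?I\<close> by auto
        have "keys (power_prod gs js) \<subseteq> monomial_box S (l * (J * D))"
          using monomial_box_power_prod[OF D, of js J] i gs by (auto simp: exponent_lists_def)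
        moreover have "keys (single m (1::'k)) \<subseteq> monomial_box S J"
          using i \<open>U \<subseteq> S\<close> by (auto simp: monomial_box_def)
        ultimately show ?thesis unfolding i(1) prod.case by (rule monomial_box_mult)
      qed
      fix c :: "nat list \<times> ('x \<Rightarrow>\<^sub>0 nat) \<Rightarrow> 'k"
      assume 0: "(\<Sum>i\<in>?I. single 0 (c i) * ?u i) = 0"
      have "(\<Sum>js\<in>exponent_lists l J. power_prod gs js * (\<Sum>m\<in>?A. single m (c (js, m))))
          = (\<Sum>i\<in>?I. single 0 (c i) * ?u i)"
        unfolding sum_distrib_left sum.cartesian_product
        by (rule sum.cong) (auto simp: mult_single mult.left_commute[of "single 0 _"])
      then have *: "(\<Sum>js\<in>exponent_lists l J. power_prod gs js * (\<Sum>m\<in>?A. single m (c (js, m)))) \<in> C 0"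
        using 0 prime_poly_ringD(2)[OF primes(1)[of 0]] by simp
      have "\<forall>d. (\<Sum>m\<in>?A. single m (d m)) \<in> C l \<longrightarrow> (\<forall>m\<in>?A. d m = 0)"
      proof (intro allI impI ballI)
        fix d m assume d: "(\<Sum>m\<in>?A. single m (d m)) \<in> C l" and m: "m \<in> ?A"
        have "(\<Sum>m\<in>?A. single m (d m)) = 0"
          by (intro indep d sum_in_poly_ring single_in_poly_ring) (simp add: monomial_box_def)
        then have "lookup (\<Sum>m\<in>?A. single m (d m)) m = 0" by simp
        then show "d m = 0" using m fin by (simp add: lookup_sum lookup_single when_def)
      qed
      moreover have "\<forall>m\<in>?A. keys m \<subseteq> S"
        using \<open>U \<subseteq> S\<close> by (auto simp: monomial_box_def)
      ultimately have "\<forall>js\<in>exponent_lists l J. \<forall>m\<in>?A. c (js, m) = 0"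
        using gs_indep[unfolded lifts_independence_def gs(1), THEN spec, THEN spec, THEN spec,
            of ?A "\<lambda>js m. c (js, m)" J] * by blast
      then show "\<forall>i\<in>?I. c i = 0" by auto
    qed
    also have "\<dots> = Suc (l * (J * D) + J) ^ card S" by (rule card_monomial_box[OF assms(1)])
    also have "\<dots> \<le> (M * Suc J) ^ card S"
      by (rule power_mono) (simp_all add: M_def algebra_simps)
    also have "card ?I = Suc J ^ (l + card U)"
      by (simp only: card_cartesian_product card_exponent_lists card_monomial_box[OF \<open>finite U\<close>] power_add)
    finally show ?thesis .
  qed
  \<comment> \<open>For this \<open>J\<close> the bound would give \<open>Suc J \<le> J\<close>.\<close>
  define J where "J = M ^ card S"
  have "Suc J ^ card S * Suc J = Suc J ^ Suc (card S)" by simp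
  also have "\<dots> \<le> Suc J ^ (l + card U)" using neg by (intro power_increasing) auto
  also have "\<dots> \<le> Suc J ^ card S * J" 
    using bound[of J] unfolding power_mult_distrib J_def[symmetric] by (simp only: mult.commute)
  finally show False by (simp only: mult_le_cancel1) simp
qed

section \<open>Toric prime ideals\<close>

text \<open>
  The monomial map that kills the variables of \<open>Z\<close> and sends any other monomial \<open>m\<close> to a monomial
  with exponent \<open>\<mu> m\<close> maps \<open>p\<close> to the polynomial with coefficients \<open>fibre_sum Z \<mu> g p\<close>. Its kernel is
  \<open>toric_ideal S Z \<mu>\<close>. Grades may be of any type, so that they can be pairs of functions below.
\<close>

definition fibre_sum ::
    "'x set \<Rightarrow> (('x \<Rightarrow>\<^sub>0 nat) \<Rightarrow> 'g) \<Rightarrow> 'g \<Rightarrow> (('x \<Rightarrow>\<^sub>0 nat) \<Rightarrow>\<^sub>0 'k::field) \<Rightarrow> 'k" where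
  "fibre_sum Z \<mu> g p =
     (\<Sum>m | m \<in> keys p \<and> keys m \<inter> Z = {} \<and> \<mu> m = g. lookup p m)"

definition toric_ideal ::
    "'x set \<Rightarrow> 'x set \<Rightarrow> (('x \<Rightarrow>\<^sub>0 nat) \<Rightarrow> 'g) \<Rightarrow> (('x \<Rightarrow>\<^sub>0 nat) \<Rightarrow>\<^sub>0 'k::field) set" where
  "toric_ideal S Z \<mu> = {p \<in> carrier (poly_ring S). \<forall>g. fibre_sum Z \<mu> g p = 0}"

lemma fibre_sum_superset:
  assumes "finite F" "keys p \<subseteq> F"
  shows "fibre_sum Z \<mu> g p =
    (\<Sum>m\<in>F. if keys m \<inter> Z = {} \<and> \<mu> m = g then lookup p m else 0)"
proof -
  have "fibre_sum Z \<mu> g p = (\<Sum>m\<in>{m\<in>F. keys m \<inter> Z = {} \<and> \<mu> m = g}. lookup p m)"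
    unfolding fibre_sum_def using assms
    by (intro sum.mono_neutral_left) (auto simp: in_keys_iff)
  then show ?thesis using assms(1) by (simp add: sum.If_cases Int_def)
qed

lemma fibre_sum_add: "fibre_sum Z \<mu> g (p + q) = fibre_sum Z \<mu> g p + fibre_sum Z \<mu> g q"
proof -
  let ?F = "keys p \<union> keys q"
  have "finite ?F" "keys (p + q) \<subseteq> ?F" by (auto simp: Poly_Mapping.keys_add)
  then show ?thesis
    by (auto simp add: fibre_sum_superset[of ?F] lookup_add simp flip: sum.distrib intro!: sum.cong)
qed

lemma fibre_sum_single:
  "fibre_sum Z \<mu> g (single m c) =
     (if keys m \<inter> Z = {} \<and> \<mu> m = g then c else 0)"
  by (simp add: fibre_sum_superset[of "{m}"])

lemma fibre_sum_diff:
  "fibre_sum Z \<mu> g (p - q) = fibre_sum Z \<mu> g p - fibre_sum Z \<mu> g q"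
  using fibre_sum_add[of Z \<mu> g "p - q" q] by simp

lemma keys_add_nat: "keys (m + m' :: 'x \<Rightarrow>\<^sub>0 nat) = keys m \<union> keys m'"
  by (auto simp: in_keys_iff lookup_add)

lemma additive_multiplicative:
  fixes \<phi> :: "('a::comm_monoid_add \<Rightarrow>\<^sub>0 'k::field) \<Rightarrow> 'b::comm_ring"
  assumes add: "\<And>p q. \<phi> (p + q) = \<phi> p + \<phi> q"
    and single: "\<And>a b c d. \<phi> (single (a + b) (c * d))
      = \<phi> (single a c) * \<phi> (single b d)"
  shows "\<phi> (p * q) = \<phi> p * \<phi> q"
proof -
  have zero: "\<phi> 0 = 0" using add[of 0 0] by (metis add_0 add_cancel_right_left)
  have sum: "\<phi> (\<Sum>i\<in>I. f i) = (\<Sum>i\<in>I. \<phi> (f i))" for I :: "'i set" and f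
    by (induction I rule: infinite_finite_induct) (simp_all add: zero add)
  let ?s = "\<lambda>p a. single a (lookup p a)"
  have expand: "p = (\<Sum>a\<in>keys p. ?s p a)" for p :: "'a \<Rightarrow>\<^sub>0 'k"
    by (rule poly_mapping_eq_sum_single) auto
  have "p * q = (\<Sum>a\<in>keys p. ?s p a) * (\<Sum>b\<in>keys q. ?s q b)"
    using expand[of p] expand[of q] by simp
  also have "\<dots> = (\<Sum>a\<in>keys p. \<Sum>b\<in>keys q.
      single (a + b) (lookup p a * lookup q b))"
    by (simp add: sum_product mult_single)
  finally have "\<phi> (p * q) = (\<Sum>a\<in>keys p. \<phi> (?s p a)) * (\<Sum>b\<in>keys q. \<phi> (?s q b))"
    by (simp add: sum single sum_product)
  also have "\<dots> = \<phi> (\<Sum>a\<in>keys p. ?s p a) * \<phi> (\<Sum>b\<in>keys q. ?s q b)"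
    by (simp add: sum)
  also have "\<dots> = \<phi> p * \<phi> q" using expand[of p] expand[of q] by simp
  finally show ?thesis .
qed

text \<open>
  Exponents in \<open>nat \<Rightarrow>\<^sub>0 nat\<close> carry a linear order compatible with addition, so the target of the
  monomial map is an integral domain.
\<close>

lemma toric_ideal_prime_weight:
  fixes w :: "('x \<Rightarrow>\<^sub>0 nat) \<Rightarrow> (nat \<Rightarrow>\<^sub>0 nat)"
  assumes w: "w 0 = 0" "\<And>a b. w (a + b) = w a + w b"
  shows "primeideal (toric_ideal S Z w :: (('x \<Rightarrow>\<^sub>0 nat) \<Rightarrow>\<^sub>0 'k::field) set) (poly_ring S)"
proof -
  define \<phi> :: "(('x \<Rightarrow>\<^sub>0 nat) \<Rightarrow>\<^sub>0 'k) \<Rightarrow> ((nat \<Rightarrow>\<^sub>0 nat) \<Rightarrow>\<^sub>0 'k)" where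
    "\<phi> p = (\<Sum>m\<in>keys p.
       if keys m \<inter> Z = {} then single (w m) (lookup p m) else 0)" for p
  have lookup: "lookup (\<phi> p) g = fibre_sum Z w g p" for p g
    unfolding \<phi>_def fibre_sum_superset[OF finite_keys order_refl] lookup_sum
    by (rule sum.cong) (auto simp: lookup_single when_def)
  have add: "\<phi> (p + q) = \<phi> p + \<phi> q" for p q
    by (rule poly_mapping_eqI) (simp add: lookup lookup_add fibre_sum_add)
  have single: "\<phi> (single m c) =
      (if keys m \<inter> Z = {} then single (w m) c else 0)" for m c
    by (rule poly_mapping_eqI) (auto simp: lookup fibre_sum_single lookup_single when_def)
  have mult: "\<phi> (p * q) = \<phi> p * \<phi> q" for p q
    by (rule additive_multiplicative[OF add]) (auto simp: single keys_add_nat w mult_single)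
  have one: "\<phi> 1 = 1"
    using single[of 0 1] by (simp add: w)
  have "\<phi> p = 0 \<longleftrightarrow> (\<forall>g. fibre_sum Z w g p = 0)" for p
    by (auto simp: poly_mapping_eq_iff fun_eq_iff lookup)
  then have "toric_ideal S Z w = {p \<in> carrier (poly_ring S). \<phi> p = 0}"
    by (simp add: toric_ideal_def)
  then show ?thesis using kernel_primeideal[of \<phi> S] add mult one by simp
qed

text \<open>
  Under the assumptions, every fibre of \<open>\<mu>'\<close> on monomials free of \<open>Z'\<close> is a union of fibres of \<open>\<mu>\<close>
  on monomials free of \<open>Z\<close>, and a sum over it vanishes fibre by fibre.
\<close>

lemma toric_ideal_mono:
  assumes free: "\<And>m :: 'x \<Rightarrow>\<^sub>0 nat. keys m \<subseteq> S \<Longrightarrow> keys m \<inter> Z' = {} \<Longrightarrow> keys m \<inter> Z = {}"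
    and coarser: "\<And>m m'. keys m \<subseteq> S \<Longrightarrow> keys m' \<subseteq> S \<Longrightarrow>
      keys m \<inter> Z' = {} \<Longrightarrow> keys m' \<inter> Z = {} \<Longrightarrow> \<mu> m = \<mu> m' \<Longrightarrow>
      keys m' \<inter> Z' = {} \<and> \<mu>' m = \<mu>' m'"
  shows "(toric_ideal S Z \<mu> :: (('x \<Rightarrow>\<^sub>0 nat) \<Rightarrow>\<^sub>0 'k::field) set) \<subseteq> toric_ideal S Z' \<mu>'"
proof
  fix p :: "('x \<Rightarrow>\<^sub>0 nat) \<Rightarrow>\<^sub>0 'k" assume p: "p \<in> toric_ideal S Z \<mu>"
  then have S: "keys m \<subseteq> S" if "m \<in> keys p" for m
    using that by (simp add: toric_ideal_def mem_poly_ring_iff)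
  have "fibre_sum Z' \<mu>' g' p = 0" for g'
  proof -
    let ?F = "{m. m \<in> keys p \<and> keys m \<inter> Z' = {} \<and> \<mu>' m = g'}"
    have "fibre_sum Z' \<mu>' g' p = (\<Sum>g\<in>\<mu> ` ?F. \<Sum>m | m \<in> ?F \<and> \<mu> m = g. lookup p m)"
      unfolding fibre_sum_def by (rule sum.image_gen) simp
    also have "\<dots> = (\<Sum>g\<in>\<mu> ` ?F. fibre_sum Z \<mu> g p)"
    proof (rule sum.cong[OF refl])
      fix g assume "g \<in> \<mu> ` ?F"
      then obtain m0 where m0: "m0 \<in> ?F" "g = \<mu> m0" by auto
      have "{m. m \<in> ?F \<and> \<mu> m = g} = {m. m \<in> keys p \<and> keys m \<inter> Z = {} \<and> \<mu> m = g}"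
      proof (intro Collect_cong iffI)
        fix m assume "m \<in> ?F \<and> \<mu> m = g"
        then show "m \<in> keys p \<and> keys m \<inter> Z = {} \<and> \<mu> m = g"
          using free[of m] S[of m] by simp
      next
        fix m assume m: "m \<in> keys p \<and> keys m \<inter> Z = {} \<and> \<mu> m = g"
        then have "keys m \<inter> Z' = {} \<and> \<mu>' m0 = \<mu>' m"
          using m0 S by (intro coarser) auto
        then show "m \<in> ?F \<and> \<mu> m = g" using m m0 by auto
      qed
      then show "(\<Sum>m | m \<in> ?F \<and> \<mu> m = g. lookup p m) = fibre_sum Z \<mu> g p"
        by (simp add: fibre_sum_def)
    qed
    also have "\<dots> = 0" using p by (simp add: toric_ideal_def)
    finally show ?thesis .
  qed
  then show "p \<in> toric_ideal S Z' \<mu>'" using p by (simp add: toric_ideal_def)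
qed

lemma single_in_toric_ideal_iff:
  assumes "keys m \<subseteq> S"
  shows "single m 1 \<in> toric_ideal S Z \<mu> \<longleftrightarrow> keys m \<inter> Z \<noteq> {}"
  using assms by (auto simp: toric_ideal_def fibre_sum_single single_in_poly_ring)

lemma binomial_in_toric_ideal_iff:
  assumes "keys m \<subseteq> S" "keys m' \<subseteq> S"
    and "keys m \<inter> Z = {}" "keys m' \<inter> Z = {}"
  shows "single m 1 - single m' 1 \<in> toric_ideal S Z \<mu> \<longleftrightarrow> \<mu> m = \<mu> m'"
  using assms
  by (auto simp: toric_ideal_def fibre_sum_diff fibre_sum_single single_in_poly_ring diff_in_poly_ring)

text \<open>
  A toric ideal is spanned by its monomials and its binomials: modulo these, each monomial of \<open>p\<close> may
  be replaced by a representative of its fibre, and the coefficients collected there are the fibre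
  sums, which are zero.
\<close>

lemma toric_ideal_subset_prime:
  fixes P :: "(('x \<Rightarrow>\<^sub>0 nat) \<Rightarrow>\<^sub>0 'k::field) set"
  assumes P: "primeideal P (poly_ring S)"
    and killed: "\<And>m. keys m \<subseteq> S \<Longrightarrow> keys m \<inter> Z \<noteq> {} \<Longrightarrow> single m 1 \<in> P"
    and binomial: "\<And>m m'. keys m \<subseteq> S \<Longrightarrow> keys m' \<subseteq> S \<Longrightarrow>
      keys m \<inter> Z = {} \<Longrightarrow> keys m' \<inter> Z = {} \<Longrightarrow> \<mu> m = \<mu> m' \<Longrightarrow>
      single m 1 - single m' 1 \<in> P"
  shows "toric_ideal S Z \<mu> \<subseteq> P"
proof
  fix p :: "('x \<Rightarrow>\<^sub>0 nat) \<Rightarrow>\<^sub>0 'k" assume p: "p \<in> toric_ideal S Z \<mu>"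
  then have S: "keys m \<subseteq> S" if "m \<in> keys p" for m
    using that by (simp add: toric_ideal_def mem_poly_ring_iff)
  have scale: "single 0 c * a \<in> P" if "a \<in> P" for c a
    by (rule prime_poly_ringD(6)[OF P that]) (simp add: single_in_poly_ring)
  define F where "F = {m \<in> keys p. keys m \<inter> Z = {}}"
  have "finite F" by (simp add: F_def)
  define r where "r g = (SOME m. m \<in> F \<and> \<mu> m = g)" for g
  have r: "r (\<mu> m) \<in> F \<and> \<mu> (r (\<mu> m)) = \<mu> m" if "m \<in> F" for m
    unfolding r_def by (rule someI[of _ m]) (use that in auto)
  let ?c = "lookup p"
  have "(\<Sum>m\<in>F. single (r (\<mu> m)) (?c m))
      = (\<Sum>g\<in>\<mu> ` F. \<Sum>m | m \<in> F \<and> \<mu> m = g. single (r (\<mu> m)) (?c m))"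
    by (rule sum.image_gen) fact
  also have "\<dots> = (\<Sum>g\<in>\<mu> ` F. single (r g) (fibre_sum Z \<mu> g p))"
  proof (rule sum.cong[OF refl])
    fix g
    have "(\<Sum>m\<in>A. single (r g) (?c m)) = single (r g) (\<Sum>m\<in>A. ?c m)" for A
      by (induction A rule: infinite_finite_induct) (simp_all add: single_add)
    moreover have "{m. m \<in> F \<and> \<mu> m = g} = {m. m \<in> keys p \<and> keys m \<inter> Z = {} \<and> \<mu> m = g}"
      by (auto simp: F_def)
    ultimately show "(\<Sum>m | m \<in> F \<and> \<mu> m = g. single (r (\<mu> m)) (?c m))
        = single (r g) (fibre_sum Z \<mu> g p)"
      by (simp add: fibre_sum_def)
  qed
  also have "\<dots> = 0" using p by (simp add: toric_ideal_def)
  finally have zero: "(\<Sum>m\<in>F. single (r (\<mu> m)) (?c m)) = 0" .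
  have "p = (\<Sum>m\<in>keys p. single m (?c m))"
    by (rule poly_mapping_eq_sum_single) auto
  also have "\<dots> = (\<Sum>m\<in>F. single m (?c m)) + (\<Sum>m\<in>keys p - F. single m (?c m))"
    by (subst add.commute, rule sum.subset_diff) (auto simp: F_def)
  also have "\<dots> = (\<Sum>m\<in>F. single 0 (?c m) * (single m 1 - single (r (\<mu> m)) 1))
      + (\<Sum>m\<in>keys p - F. single 0 (?c m) * single m 1)"
    using zero by (simp add: right_diff_distrib mult_single sum_subtractf)
  also have "\<dots> \<in> P"
  proof (intro prime_poly_ringD(4)[OF P] prime_sum_closed[OF P] scale)
    show "single m 1 - single (r (\<mu> m)) 1 \<in> P" if "m \<in> F" for m
      using that r[OF that] S by (intro binomial) (auto simp: F_def)
    show "single m 1 \<in> P" if "m \<in> keys p - F" for m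
      using that S by (intro killed) (auto simp: F_def)
  qed
  finally show "p \<in> P" .
qed

section \<open>The primes of labelled vertex sets\<close>

definition edge_vars :: "'v set \<Rightarrow> 'v edge_var set" where
  "edge_vars V = XVar ` V \<union> YVar ` V"

definition vertex_degree :: "('v edge_var \<Rightarrow>\<^sub>0 nat) \<Rightarrow> 'v \<Rightarrow> nat" where
  "vertex_degree m v = lookup m (XVar v) + lookup m (YVar v)"

text \<open>
  The labels \<open>c v\<close> stand for the components: \<open>vertex_degree\<close> is the exponent of \<open>z\<^sub>v\<close> and
  \<open>label_degree\<close> the exponent of \<open>a\<^sub>C\<close> under \<open>x\<^sub>v \<mapsto> z\<^sub>v a\<^sub>C\<close>, \<open>y\<^sub>v \<mapsto> z\<^sub>v b\<^sub>C\<close>. The exponent of \<open>b\<^sub>C\<close> is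
  determined by these two.
\<close>

definition label_degree :: "'v set \<Rightarrow> ('v \<Rightarrow> 'v) \<Rightarrow> ('v edge_var \<Rightarrow>\<^sub>0 nat) \<Rightarrow> 'v \<Rightarrow> nat" where
  "label_degree V c m a = (\<Sum>v | v \<in> V \<and> c v = a. lookup m (XVar v))"

definition grade :: "'v set \<Rightarrow> ('v \<Rightarrow> 'v) \<Rightarrow> ('v edge_var \<Rightarrow>\<^sub>0 nat) \<Rightarrow> ('v \<Rightarrow> nat) \<times> ('v \<Rightarrow> nat)" where
  "grade V c m = (restrict (vertex_degree m) V, label_degree V c m)"

definition label_ideal :: "'v set \<Rightarrow> 'v edge_var set \<Rightarrow> ('v \<Rightarrow> 'v) \<Rightarrow> ('v, 'k::field) edge_poly set" where
  "label_ideal V Z c = toric_ideal (edge_vars V) Z (grade V c)"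

lemma edge_vars_simps [simp]:
  "XVar v \<in> edge_vars V \<longleftrightarrow> v \<in> V" "YVar v \<in> edge_vars V \<longleftrightarrow> v \<in> V"
  by (auto simp: edge_vars_def)

lemma finite_edge_vars: "finite V \<Longrightarrow> finite (edge_vars V)"
  by (simp add: edge_vars_def)

lemma card_edge_vars: "finite V \<Longrightarrow> card (edge_vars V) = 2 * card V"
  unfolding edge_vars_def by (subst card_Un_disjoint) (auto simp: card_image inj_on_def)

lemma edge_vars_mono: "V \<subseteq> W \<Longrightarrow> edge_vars V \<subseteq> edge_vars W"
  by (auto simp: edge_vars_def)

lemma edge_vars_Diff: "edge_vars (V - T) = edge_vars V - edge_vars T"
  by (auto simp: edge_vars_def)

lemma vertex_degree_add: "vertex_degree (m + m') v = vertex_degree m v + vertex_degree m' v"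
  by (simp add: vertex_degree_def lookup_add)

lemma label_degree_add: "label_degree V c (m + m') a = label_degree V c m a + label_degree V c m' a"
  by (simp add: label_degree_def lookup_add sum.distrib)

lemma vertex_degree_single:
  "vertex_degree (single (XVar u) 1) v = (if u = v then 1 else 0)"
  "vertex_degree (single (YVar u) 1) v = (if u = v then 1 else 0)"
  by (auto simp: vertex_degree_def lookup_single when_def)

lemma label_degree_single:
  assumes "finite V" "u \<in> V"
  shows "label_degree V c (single (XVar u) 1) a = (if c u = a then 1 else 0)"
    and "label_degree V c (single (YVar u) 1) a = 0"
proof -
  have "label_degree V c (single (XVar u) 1) a = (\<Sum>v | v \<in> V \<and> c v = a. if u = v then 1 else 0)"
    unfolding label_degree_def by (rule sum.cong) (auto simp: lookup_single when_def)
  then show "label_degree V c (single (XVar u) 1) a = (if c u = a then 1 else 0)"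
    using assms by simp
  show "label_degree V c (single (YVar u) 1) a = 0"
    unfolding label_degree_def by (rule sum.neutral) (auto simp: lookup_single when_def)
qed

lemma grade_eq_iff:
  "grade V c m = grade V c m' \<longleftrightarrow>
     (\<forall>v\<in>V. vertex_degree m v = vertex_degree m' v) \<and>
     (\<forall>a. label_degree V c m a = label_degree V c m' a)"
  by (auto simp: grade_def fun_eq_iff restrict_def)

lemma grade_add_cancel:
  "grade V c (m + n) = grade V c (m' + n) \<longleftrightarrow> grade V c m = grade V c m'"
  by (simp add: grade_eq_iff vertex_degree_add label_degree_add)

text \<open>
  The two families of degrees are packed into one exponent vector over \<open>nat\<close>, with vertex degrees at
  even and label degrees at odd places.
\<close>

lemma label_ideal_prime:
  assumes "finite V" "c ` V \<subseteq> V"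
  shows "primeideal (label_ideal V Z c :: ('v, 'k::field) edge_poly set) (poly_ring (edge_vars V))"
proof -
  obtain e :: "'v \<Rightarrow> nat" where e: "inj_on e V"
    using finite_imp_inj_to_nat_seg[OF assms(1)] by auto
  define w :: "('v edge_var \<Rightarrow>\<^sub>0 nat) \<Rightarrow> (nat \<Rightarrow>\<^sub>0 nat)" where
    "w m = (\<Sum>v\<in>V. single (2 * e v) (vertex_degree m v)
      + single (Suc (2 * e (c v))) (lookup m (XVar v)))" for m
  have w0: "w 0 = 0" by (simp add: w_def vertex_degree_def)
  have w_add: "w (m + m') = w m + w m'" for m m'
    by (simp add: w_def vertex_degree_add lookup_add single_add sum.distrib algebra_simps)
  have odd: "Suc (2 * i) \<noteq> 2 * j" "2 * j \<noteq> Suc (2 * i)" for i j :: nat by presburger+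
  have even_part: "lookup (w m) (2 * e v) = vertex_degree m v" if "v \<in> V" for m v
  proof -
    have "lookup (w m) (2 * e v) = (\<Sum>u\<in>V. if u = v then vertex_degree m u else 0)"
      unfolding w_def lookup_sum
      using inj_onD[OF e _ _ that] by (intro sum.cong) (auto simp: lookup_add lookup_single when_def odd)
    then show ?thesis using that assms(1) by simp
  qed
  have odd_part: "lookup (w m) (Suc (2 * e a)) = label_degree V c m a" if "a \<in> V" for m a
  proof -
    have "lookup (w m) (Suc (2 * e a)) = (\<Sum>u\<in>V. if c u = a then lookup m (XVar u) else 0)"
      unfolding w_def lookup_sum
      using inj_onD[OF e _ _ that] assms(2) by (intro sum.cong) (auto simp: lookup_add lookup_single when_def odd)
    then show ?thesis using assms(1) by (simp add: label_degree_def sum.If_cases Int_def)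
  qed
  have w_eq: "w m = w m'" if "grade V c m = grade V c m'" for m m'
  proof -
    have "w m = (\<Sum>v\<in>V. single (2 * e v) (vertex_degree m v))
        + (\<Sum>a\<in>c ` V. single (Suc (2 * e a)) (label_degree V c m a))" for m
    proof -
      have "(\<Sum>v\<in>V. single (Suc (2 * e (c v))) (lookup m (XVar v)))
        = (\<Sum>a\<in>c ` V. \<Sum>v | v \<in> V \<and> c v = a. single (Suc (2 * e (c v))) (lookup m (XVar v)))"
        by (rule sum.image_gen) fact
      also have "\<dots> = (\<Sum>a\<in>c ` V. single (Suc (2 * e a)) (label_degree V c m a))"
      proof (rule sum.cong[OF refl])
        fix a
        have "(\<Sum>v\<in>A. single k (f v)) = single k (\<Sum>v\<in>A. f v)"
          for A and k :: nat and f :: "'v \<Rightarrow> nat"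
          by (induction A rule: infinite_finite_induct) (simp_all add: single_add)
        then show "(\<Sum>v | v \<in> V \<and> c v = a. single (Suc (2 * e (c v))) (lookup m (XVar v)))
          = single (Suc (2 * e a)) (label_degree V c m a)"
          by (simp add: label_degree_def)
      qed
      finally show ?thesis by (simp add: w_def sum.distrib)
    qed
    then show ?thesis using that by (simp add: grade_eq_iff)
  qed
  have outside: "label_degree V c m a = 0" if "a \<notin> V" for m a
    using that assms(2) by (auto simp: label_degree_def intro!: sum.neutral)
  have grade_eq: "grade V c m = grade V c m'" if "w m = w m'" for m m'
    using even_part[of _ m] even_part[of _ m'] odd_part[of _ m] odd_part[of _ m'] outside that
    by (metis grade_eq_iff)
  have "(toric_ideal (edge_vars V) Z (grade V c) :: ('v, 'k) edge_poly set) = toric_ideal (edge_vars V) Z w"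
    using w_eq grade_eq by (intro equalityI toric_ideal_mono) blast+
  then show ?thesis
    unfolding label_ideal_def using toric_ideal_prime_weight[OF w0 w_add] by simp
qed

definition has_prime_chain :: "('a, 'b) ring_scheme \<Rightarrow> nat \<Rightarrow> 'a set \<Rightarrow> bool" where
  "has_prime_chain R l P \<longleftrightarrow>
     (\<exists>C :: nat \<Rightarrow> 'a set. (\<forall>i\<le>l. primeideal (C i) R) \<and> (\<forall>i<l. C i \<subset> C (Suc i)) \<and> C l = P)"

lemma has_prime_chain_0: "primeideal P R \<Longrightarrow> has_prime_chain R 0 P"
  unfolding has_prime_chain_def by auto

lemma has_prime_chain_Suc:
  assumes "has_prime_chain R l P" "primeideal Q R" "P \<subset> Q"
  shows "has_prime_chain R (Suc l) Q"
proof -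
  obtain C where C: "\<forall>i\<le>l. primeideal (C i) R" "\<forall>i<l. C i \<subset> C (Suc i)" "C l = P"
    using assms(1) by (auto simp: has_prime_chain_def)
  let ?C = "C(Suc l := Q)"
  have "?C i \<subset> ?C (Suc i)" if "i < Suc l" for i
    using that C assms(3) by (cases "i = l") auto
  then show ?thesis
    unfolding has_prime_chain_def using C assms(2) by (intro exI[of _ ?C]) auto
qed

lemma monomial_eqI:
  fixes m m' :: "'v edge_var \<Rightarrow>\<^sub>0 nat"
  assumes "\<And>v. lookup m (XVar v) = lookup m' (XVar v)"
    and "\<And>v. lookup m (YVar v) = lookup m' (YVar v)"
  shows "m = m'"
proof (rule poly_mapping_eqI)
  show "lookup m z = lookup m' z" for z
    using assms by (cases z) auto
qed

lemma lookup_outside: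
  assumes "keys m \<subseteq> edge_vars V" "v \<notin> V"
  shows "lookup m (XVar v) = 0" "lookup m (YVar v) = 0"
  using assms by (auto simp: edge_vars_def in_keys_iff subset_iff)

lemma label_degree_id: "label_degree V id m v = (if v \<in> V then lookup m (XVar v) else 0)"
proof -
  have "{u. u \<in> V \<and> id u = v} = (if v \<in> V then {v} else {})" by auto
  then show ?thesis by (simp add: label_degree_def)
qed

lemma grade_id_inj:
  assumes "keys m \<subseteq> edge_vars V" "keys m' \<subseteq> edge_vars V"
    and "grade V id m = grade V id m'"
  shows "m = m'"
proof (rule monomial_eqI)
  fix v
  show x: "lookup m (XVar v) = lookup m' (XVar v)"
    using assms lookup_outside[of m V v] lookup_outside[of m' V v]
    by (cases "v \<in> V") (auto simp: grade_eq_iff label_degree_id split: if_splits)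
  show "lookup m (YVar v) = lookup m' (YVar v)"
    using assms x lookup_outside[of m V v] lookup_outside[of m' V v]
    by (cases "v \<in> V") (auto simp: grade_eq_iff vertex_degree_def)
qed

text \<open>
  With every vertex labelled by itself, the grade of a monomial determines the monomial, so killing one
  more variable enlarges the ideal.
\<close>

lemma label_ideal_kill_chain:
  fixes K :: "'k::field itself"
  assumes "finite V" "Z \<subseteq> edge_vars V"
  shows "has_prime_chain (poly_ring (edge_vars V)) (card Z) (label_ideal V Z id :: ('v, 'k) edge_poly set)"
proof -
  have "finite Z" using assms finite_edge_vars finite_subset by blast
  then show ?thesis using assms(2)
  proof (induction Z)
    case empty
    show ?case
      unfolding card.empty by (intro has_prime_chain_0 label_ideal_prime[OF assms(1)]) simp
  next
    case (insert z Z)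
    let ?P = "label_ideal V Z id :: ('v, 'k) edge_poly set"
    let ?Q = "label_ideal V (insert z Z) id :: ('v, 'k) edge_poly set"
    have "?P \<subseteq> ?Q"
      unfolding label_ideal_def by (rule toric_ideal_mono) (use grade_id_inj in blast)+
    moreover have "single (single z 1) 1 \<in> ?Q - ?P"
      using insert unfolding label_ideal_def by (auto simp: single_in_toric_ideal_iff)
    ultimately have "?P \<subset> ?Q" by blast
    moreover have "primeideal ?Q (poly_ring (edge_vars V))"
      by (rule label_ideal_prime[OF assms(1)]) simp
    ultimately show ?case
      using has_prime_chain_Suc insert by (metis card_insert_disjoint insert_subset)
  qed
qed

text \<open>
  Labels are idempotent, that is, a class is named by one of its members. Thus the number of classes
  is the number of fixed points, and a class can be split by making one of its vertices its own label
  without searching for a fresh name. Deleted vertices are their own labels.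
\<close>

definition labelling :: "'v set \<Rightarrow> 'v set \<Rightarrow> ('v \<Rightarrow> 'v) \<Rightarrow> bool" where
  "labelling V T c \<longleftrightarrow> T \<subseteq> V \<and> (\<forall>v\<in>V - T. c v \<in> V - T \<and> c (c v) = c v) \<and> (\<forall>t\<in>T. c t = t)"

lemma labelling_image: "labelling V T c \<Longrightarrow> c ` V \<subseteq> V"
  by (auto simp: labelling_def)

text \<open>
  On \<open>W\<close>, the classes of \<open>c\<close> are unions of classes of \<open>c'\<close>, so label degrees for \<open>c\<close> are sums of
  label degrees for \<open>c'\<close>.
\<close>

lemma grade_coarsen:
  assumes "finite V" "W \<subseteq> V"
    and finer: "\<And>u v. u \<in> W \<Longrightarrow> v \<in> W \<Longrightarrow> c' u = c' v \<Longrightarrow> c u = c v"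
    and m: "\<And>v. v \<in> V - W \<Longrightarrow> lookup m (XVar v) = 0"
    and m': "\<And>v. v \<in> V - W \<Longrightarrow> lookup m' (XVar v) = 0"
    and grade: "grade V c' m = grade V c' m'"
  shows "grade V c m = grade V c m'"
proof -
  have expand: "label_degree V c m a = (\<Sum>b\<in>c' ` {v\<in>W. c v = a}. label_degree V c' m b)"
    if m: "\<And>v. v \<in> V - W \<Longrightarrow> lookup m (XVar v) = 0" for m a
  proof -
    let ?x = "\<lambda>v. lookup m (XVar v)"
    have "finite W" using assms finite_subset by blast
    have restrict: "label_degree V d m a = (\<Sum>v | v \<in> W \<and> d v = a. ?x v)" for d a
      unfolding label_degree_def
    proof (rule sum.mono_neutral_right)
      show "\<forall>v\<in>{v. v \<in> V \<and> d v = a} - {v. v \<in> W \<and> d v = a}. ?x v = 0"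
        using m by blast
    qed (use assms in auto)
    have "label_degree V c m a = (\<Sum>b\<in>c' ` {v\<in>W. c v = a}. \<Sum>v | v \<in> {v\<in>W. c v = a} \<and> c' v = b. ?x v)"
      unfolding restrict by (rule sum.image_gen) (use \<open>finite W\<close> in simp)
    also have "\<dots> = (\<Sum>b\<in>c' ` {v\<in>W. c v = a}. label_degree V c' m b)"
    proof (rule sum.cong[OF refl])
      fix b assume "b \<in> c' ` {v\<in>W. c v = a}"
      then have "{v. v \<in> {v\<in>W. c v = a} \<and> c' v = b} = {v. v \<in> W \<and> c' v = b}"
        using finer by auto
      then show "(\<Sum>v | v \<in> {v\<in>W. c v = a} \<and> c' v = b. ?x v) = label_degree V c' m b"
        by (simp add: restrict)
    qed
    finally show ?thesis .
  qed
  have "label_degree V c m a = label_degree V c m' a" for a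
    using expand[of m a, OF m] expand[of m' a, OF m'] grade by (simp add: grade_eq_iff)
  then show ?thesis using grade by (simp add: grade_eq_iff)
qed

text \<open>
  The chain is built backwards: making one moved vertex \<open>u\<close> its own label gives a smaller prime, since
  the minor of \<open>u\<close> and \<open>c u\<close> no longer belongs to it. Once no vertex is moved, only killed variables
  are left.
\<close>

lemma label_ideal_merge_chain:
  fixes K :: "'k::field itself"
  assumes "finite V" "labelling V T c"
  shows "has_prime_chain (poly_ring (edge_vars V)) (2 * card T + card {v \<in> V. c v \<noteq> v})
    (label_ideal V (edge_vars T) c :: ('v, 'k) edge_poly set)"
  using assms(2)
proof (induction "card {v \<in> V. c v \<noteq> v}" arbitrary: c)
  case 0
  then have fixed: "c v = v" if "v \<in> V" for v using that \<open>finite V\<close> by auto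
  then have "grade V c = grade V id"
    by (auto simp: grade_def label_degree_def intro!: ext sum.cong)
  then have eq: "label_ideal V (edge_vars T) c = (label_ideal V (edge_vars T) id :: ('v, 'k) edge_poly set)"
    by (simp only: label_ideal_def)
  have T: "T \<subseteq> V" "finite T" using 0 assms(1) finite_subset by (auto simp: labelling_def)
  then show ?case
    using label_ideal_kill_chain[OF assms(1) edge_vars_mono[OF T(1)], where 'k='k] 0
    by (simp only: eq card_edge_vars) simp
next
  case (Suc n)
  let ?Z = "edge_vars T"
  have "card {v \<in> V. c v \<noteq> v} \<noteq> 0" using Suc.hyps(2) by simp
  then have "{v \<in> V. c v \<noteq> v} \<noteq> {}" by (metis card.empty)
  then obtain u where u: "u \<in> V" "c u \<noteq> u" by blast
  note c = Suc.prems[unfolded labelling_def]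
  have uT: "u \<notin> T" "c u \<in> V" "c u \<notin> T" "c (c u) = c u" using c u by auto
  have fresh: "c v \<noteq> u" if "v \<in> V" for v using c u uT that by (cases "v \<in> T") auto
  let ?c = "c(u := u)"
  have lab: "labelling V T ?c"
    unfolding labelling_def
  proof (intro conjI ballI)
    fix v assume v: "v \<in> V - T"
    show "?c v \<in> V - T" using c u uT v by auto
    show "?c (?c v) = ?c v" using c u uT v by auto
  qed (use c in auto)
  have "{v \<in> V. c v \<noteq> v} = insert u {v \<in> V. ?c v \<noteq> v}" using u by auto
  then have card: "card {v \<in> V. c v \<noteq> v} = Suc (card {v \<in> V. ?c v \<noteq> v})"
    using assms(1) by simp
  then have n: "n = card {v \<in> V. ?c v \<noteq> v}" using Suc.hyps(2) by linarith
  have IH: "has_prime_chain (poly_ring (edge_vars V)) (2 * card T + card {v \<in> V. ?c v \<noteq> v})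
      (label_ideal V ?Z ?c :: ('v, 'k) edge_poly set)"
    by (rule Suc.hyps(1)[OF n lab])
  let ?P = "label_ideal V ?Z ?c :: ('v, 'k) edge_poly set" and ?Q = "label_ideal V ?Z c :: ('v, 'k) edge_poly set"
  have "?P \<subseteq> ?Q"
    unfolding label_ideal_def
  proof (rule toric_ideal_mono, assumption, intro conjI, assumption)
    fix m m' assume "grade V ?c m = grade V ?c m'"
    then show "grade V c m = grade V c m'"
      by (rule grade_coarsen[OF assms(1) order_refl, rotated -1]) (use u uT fresh in \<open>auto split: if_splits\<close>)
  qed
  moreover
  let ?m = "single (XVar u) 1 + single (YVar (c u)) 1 :: 'v edge_var \<Rightarrow>\<^sub>0 nat"
  let ?m' = "single (XVar (c u)) 1 + single (YVar u) 1 :: 'v edge_var \<Rightarrow>\<^sub>0 nat"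
  have keys: "keys ?m \<subseteq> edge_vars V" "keys ?m' \<subseteq> edge_vars V"
      "keys ?m \<inter> ?Z = {}" "keys ?m' \<inter> ?Z = {}"
    using u uT by (auto simp: keys_add_nat)
  have "grade V c ?m = grade V c ?m'"
    using assms(1) u uT
    by (simp add: grade_eq_iff vertex_degree_add label_degree_add vertex_degree_single
        label_degree_single del: One_nat_def)
  then have "single ?m 1 - single ?m' 1 \<in> ?Q"
    unfolding label_ideal_def binomial_in_toric_ideal_iff[OF keys] .
  moreover have "label_degree V ?c ?m u \<noteq> label_degree V ?c ?m' u"
    using assms(1) u uT by (simp add: label_degree_add label_degree_single del: One_nat_def)
  then have "grade V ?c ?m \<noteq> grade V ?c ?m'" by (auto simp: grade_eq_iff)
  then have "single ?m 1 - single ?m' 1 \<notin> ?P"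
    unfolding label_ideal_def binomial_in_toric_ideal_iff[OF keys] .
  ultimately have less: "?P \<subset> ?Q" by blast
  have "primeideal ?Q (poly_ring (edge_vars V))"
    by (rule label_ideal_prime[OF assms(1) labelling_image[OF Suc.prems]])
  from has_prime_chain_Suc[OF IH this less] show ?case
    unfolding card add_Suc_right .
qed

text \<open>
  The parameters \<open>z\<^sub>v a\<^sub>C\<close> for all \<open>v\<close>, together with one \<open>z\<^sub>v b\<^sub>C\<close> for each class \<open>C\<close>, are
  algebraically independent: the grade of a monomial in the corresponding variables determines it, as
  the exponent of \<open>x\<^sub>v\<close> is the vertex degree if \<open>v\<close> is moved, and for the fixed vertex of a class it is
  what remains of the label degree.
\<close>

lemma label_ideal_independent:
  assumes "finite V" "labelling V T c"
    and p: "p \<in> label_ideal V (edge_vars T) c"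
      "p \<in> carrier (poly_ring (XVar ` (V - T) \<union> YVar ` {v \<in> V - T. c v = v}))"
  shows "p = 0"
proof -
  let ?U = "XVar ` (V - T) \<union> YVar ` {v \<in> V - T. c v = v}"
  note c = assms(2)[unfolded labelling_def]
  have inj: "m = m'"
    if m: "keys m \<subseteq> ?U" and m': "keys m' \<subseteq> ?U" and eq: "grade V c m = grade V c m'" for m m'
  proof -
    have y0: "lookup m (YVar v) = 0" "lookup m' (YVar v) = 0"
      if "\<not> (v \<in> V - T \<and> c v = v)" for v
      using m m' that by (auto simp: in_keys_iff subset_iff)
    have x0: "lookup m (XVar v) = 0" "lookup m' (XVar v) = 0"
      if "v \<notin> V - T" for v
      using m m' that by (auto simp: in_keys_iff subset_iff)
    have deg: "vertex_degree m v = vertex_degree m' v" if "v \<in> V" for v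
      using eq that by (simp add: grade_eq_iff)
    have x_moved: "lookup m (XVar v) = lookup m' (XVar v)"
      if "v \<in> V" "c v \<noteq> v" for v
      using deg[OF that(1)] y0[of v] that by (simp add: vertex_degree_def)
    have x: "lookup m (XVar v) = lookup m' (XVar v)" for v
    proof (cases "v \<in> V - T \<and> c v = v")
      case True
      let ?C = "{u. u \<in> V \<and> c u = v}"
      have "label_degree V c m v = lookup m (XVar v) + (\<Sum>u\<in>?C - {v}. lookup m (XVar u))" for m
        unfolding label_degree_def using True assms(1) by (intro sum.remove) auto
      moreover have "(\<Sum>u\<in>?C - {v}. lookup m (XVar u)) = (\<Sum>u\<in>?C - {v}. lookup m' (XVar u))"
        by (rule sum.cong) (auto intro: x_moved)
      moreover have "label_degree V c m v = label_degree V c m' v" using eq by (simp add: grade_eq_iff)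
      ultimately show ?thesis by simp
    next
      case False
      then show ?thesis using x_moved x0 by (cases "v \<in> V - T") auto
    qed
    show "m = m'"
    proof (rule monomial_eqI[OF x])
      show "lookup m (YVar v) = lookup m' (YVar v)" for v
        using deg[of v] x[of v] y0[of v] by (cases "v \<in> V - T \<and> c v = v") (auto simp: vertex_degree_def)
    qed
  qed
  have "lookup p m = 0" for m
  proof (cases "m \<in> keys p")
    case True
    have keys: "keys m \<subseteq> ?U" if "m \<in> keys p" for m
      using p(2) that by (simp add: mem_poly_ring_iff)
    have "{m'. m' \<in> keys p \<and> keys m' \<inter> edge_vars T = {} \<and> grade V c m' = grade V c m} = {m}"
      using True inj keys by (fastforce simp: edge_vars_def)
    then have "fibre_sum (edge_vars T) (grade V c) (grade V c m) p = lookup p m"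
      by (simp add: fibre_sum_def)
    moreover have "fibre_sum (edge_vars T) (grade V c) (grade V c m) p = 0"
      using p(1) unfolding label_ideal_def toric_ideal_def by blast
    ultimately show ?thesis by simp
  qed (simp add: in_keys_iff)
  then show ?thesis by (intro poly_mapping_eqI) simp
qed

theorem prime_height_label_ideal:
  fixes K :: "'k::field itself"
  assumes "finite V" "labelling V T c"
  shows "prime_height (poly_ring (edge_vars V)) (label_ideal V (edge_vars T) c :: ('v, 'k) edge_poly set)
    = enat (2 * card T + card {v \<in> V. c v \<noteq> v})"
proof -
  let ?R = "poly_ring (edge_vars V) :: ('v, 'k) edge_poly ring"
  let ?P = "label_ideal V (edge_vars T) c :: ('v, 'k) edge_poly set"
  let ?h = "2 * card T + card {v \<in> V. c v \<noteq> v}"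
  let ?F = "{v \<in> V - T. c v = v}"
  let ?U = "XVar ` (V - T) \<union> YVar ` ?F"
  have T: "T \<subseteq> V" "finite T" "\<forall>t\<in>T. c t = t"
    using assms finite_subset by (auto simp: labelling_def)
  have card_U: "card ?U = card (V - T) + card ?F"
    using assms(1) by (subst card_Un_disjoint) (auto simp: card_image inj_on_def)
  have "V - T = ?F \<union> {v \<in> V. c v \<noteq> v}" using T by auto
  then have "card (V - T) = card (?F \<union> {v \<in> V. c v \<noteq> v})" by (rule arg_cong)
  also have "\<dots> = card ?F + card {v \<in> V. c v \<noteq> v}"
    using assms(1) by (intro card_Un_disjoint) auto
  finally have card_VT: "card (V - T) = card ?F + card {v \<in> V. c v \<noteq> v}" .
  have card_V: "card (V - T) + card T = card V"
    using T assms(1) by (simp add: card_Diff_subset card_mono)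
  have "l \<le> ?h" if "has_prime_chain ?R l ?P" for l
  proof -
    obtain C where C: "\<forall>i\<le>l. primeideal (C i) ?R" "\<forall>i<l. C i \<subset> C (Suc i)" "C l = ?P"
      using \<open>has_prime_chain ?R l ?P\<close> by (auto simp: has_prime_chain_def)
    have "l + card ?U \<le> card (edge_vars V)"
    proof (rule prime_chain_length_le[of _ _ _ C])
      show "finite (edge_vars V)" by (rule finite_edge_vars[OF assms(1)])
      show "?U \<subseteq> edge_vars V" by auto
      show "p = 0" if "p \<in> C l" "p \<in> carrier (poly_ring ?U)" for p
        using label_ideal_independent[OF assms] that C(3) by auto
    qed (use C in auto)
    then show ?thesis
      using card_U card_VT card_V by (simp add: card_edge_vars[OF assms(1)])
  qed
  moreover have "has_prime_chain ?R ?h ?P" by (rule label_ideal_merge_chain[OF assms])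
  ultimately have "Sup {enat l | l. has_prime_chain ?R l ?P} = enat ?h"
    by (intro cSup_eq_maximum) auto
  then show ?thesis by (simp only: prime_height_def has_prime_chain_def)
qed

section \<open>Connectedness and cut vertices\<close>

abbreviation adjacency :: "'v ugraph \<Rightarrow> 'v rel" where
  "adjacency G \<equiv> {(a, b). {a, b} \<in> edges G}"

lemma sym_adjacency_rtrancl: "sym ((adjacency G)\<^sup>*)"
  by (intro sym_rtrancl symI) (simp add: insert_commute)

lemma equiv_connected_rel: "equiv (verts G) (connected_rel G)"
proof (rule equivI)
  show "sym (connected_rel G)"
    using sym_adjacency_rtrancl[of G] by (auto simp: connected_rel_def sym_def)
  show "trans (connected_rel G)"
    by (rule transI) (auto simp: connected_rel_def)
qed (auto simp: connected_rel_def refl_on_def)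

lemma connected_relD: "(u, w) \<in> connected_rel G \<Longrightarrow> u \<in> verts G \<and> w \<in> verts G"
  by (auto simp: connected_rel_def)

lemma connected_rel_refl: "u \<in> verts G \<Longrightarrow> (u, u) \<in> connected_rel G"
  by (simp add: connected_rel_def)

lemma connected_rel_sym: "(u, w) \<in> connected_rel G \<Longrightarrow> (w, u) \<in> connected_rel G"
  using equiv_connected_rel[of G] by (auto elim: equivE symE)

lemma connected_rel_trans:
  "(u, w) \<in> connected_rel G \<Longrightarrow> (w, x) \<in> connected_rel G \<Longrightarrow> (u, x) \<in> connected_rel G"
  by (auto simp: connected_rel_def)

lemma edge_vertices:
  assumes "simple_graph G" "{u, w} \<in> edges G"
  shows "u \<in> verts G" "w \<in> verts G" "u \<noteq> w"
  using assms by (auto simp: simple_graph_def card_insert_if split: if_splits)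

lemma edge_connected:
  "simple_graph G \<Longrightarrow> {u, w} \<in> edges G \<Longrightarrow> (u, w) \<in> connected_rel G"
  using edge_vertices[of G u w] by (auto simp: connected_rel_def)

lemma verts_delete_verts [simp]: "verts (delete_verts G T) = verts G - T"
  and edges_delete_verts: "edges (delete_verts G T) = {e \<in> edges G. e \<inter> T = {}}"
  and delete_verts_delete_verts: "delete_verts (delete_verts G S) T = delete_verts G (S \<union> T)"
  and delete_verts_empty: "delete_verts G {} = G"
  by (auto simp: delete_verts_def)

lemma edge_delete_verts_iff [simp]:
  "{u, w} \<in> edges (delete_verts G T) \<longleftrightarrow> {u, w} \<in> edges G \<and> u \<notin> T \<and> w \<notin> T"
  by (auto simp: edges_delete_verts)

lemma connected_rel_delete_mono:
  "(u, w) \<in> connected_rel (delete_verts G T) \<Longrightarrow> (u, w) \<in> connected_rel G"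
  unfolding connected_rel_def
  by (auto simp del: edge_delete_verts_iff simp: edges_delete_verts
      elim!: rtrancl_mono[THEN subsetD, rotated])

text \<open>
  A choice function for components, extended by the identity, so that it is an idempotent labelling in
  the sense of \<open>labelling\<close>.
\<close>

definition component_rep :: "'v ugraph \<Rightarrow> 'v \<Rightarrow> 'v" where
  "component_rep G v = (if v \<in> verts G then SOME w. (v, w) \<in> connected_rel G else v)"

lemma component_rep_outside: "v \<notin> verts G \<Longrightarrow> component_rep G v = v"
  by (simp add: component_rep_def)

lemma component_rep_connected: "v \<in> verts G \<Longrightarrow> (v, component_rep G v) \<in> connected_rel G"
  unfolding component_rep_def using connected_rel_refl[of v G] by (auto intro: someI)

lemma component_rep_eq_iff:
  assumes "u \<in> verts G" "w \<in> verts G"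
  shows "component_rep G u = component_rep G w \<longleftrightarrow> (u, w) \<in> connected_rel G"
proof
  assume "component_rep G u = component_rep G w"
  then show "(u, w) \<in> connected_rel G"
    using component_rep_connected[OF assms(1)] component_rep_connected[OF assms(2)]
    by (metis connected_rel_sym connected_rel_trans)
next
  assume "(u, w) \<in> connected_rel G"
  then have "(u, x) \<in> connected_rel G \<longleftrightarrow> (w, x) \<in> connected_rel G" for x
    by (meson connected_rel_sym connected_rel_trans)
  then show "component_rep G u = component_rep G w"
    using assms by (simp add: component_rep_def)
qed

lemma component_rep_in_verts: "v \<in> verts G \<Longrightarrow> component_rep G v \<in> verts G"
  using component_rep_connected connected_relD by metis

lemma component_rep_idem: "component_rep G (component_rep G v) = component_rep G v"
proof (cases "v \<in> verts G")
  case True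
  then show ?thesis
    using component_rep_eq_iff[OF component_rep_in_verts[OF True] True]
      connected_rel_sym[OF component_rep_connected[OF True]] by simp
qed (simp add: component_rep_def)

lemma card_components:
  "card (components G) = card {v \<in> verts G. component_rep G v = v}"
proof -
  let ?F = "{v \<in> verts G. component_rep G v = v}"
  have "bij_betw (\<lambda>v. connected_rel G `` {v}) ?F (components G)"
  proof (rule bij_betw_imageI)
    show "inj_on (\<lambda>v. connected_rel G `` {v}) ?F"
    proof (rule inj_onI)
      fix u w assume uw: "u \<in> ?F" "w \<in> ?F" "connected_rel G `` {u} = connected_rel G `` {w}"
      then have "(u, w) \<in> connected_rel G" using connected_rel_refl[of w G] by auto
      then show "u = w" using uw component_rep_eq_iff[of u G w] by auto
    qed
    show "(\<lambda>v. connected_rel G `` {v}) ` ?F = components G"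
    proof safe
      fix v assume "v \<in> verts G"
      then show "connected_rel G `` {v} \<in> components G" by (auto simp: components_def quotientI)
    next
      fix C assume "C \<in> components G"
      then obtain v where v: "v \<in> verts G" "C = connected_rel G `` {v}"
        by (auto simp: components_def elim: quotientE)
      have "C = connected_rel G `` {component_rep G v}"
        using equiv_class_eq[OF equiv_connected_rel component_rep_connected[OF v(1)]] v(2) by simp
      then show "C \<in> (\<lambda>v. connected_rel G `` {v}) ` ?F"
        using component_rep_in_verts[OF v(1)] component_rep_idem[of G v] by auto
    qed
  qed
  then show ?thesis by (simp add: bij_betw_same_card)
qed

lemma finite_components: "simple_graph G \<Longrightarrow> finite (components G)"
  unfolding components_def simple_graph_def
  by (rule finite_quotient[OF _ connected_rel_def[THEN equalityD1, THEN subset_trans]]) auto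

lemma isolated_or_neighbour:
  assumes "simple_graph G" "(u, v) \<in> connected_rel G" "u \<noteq> v"
  shows "\<exists>w. {w, v} \<in> edges G"
  using assms by (auto simp: connected_rel_def elim: rtranclE)

text \<open>
  Sending a component of \<open>G - v\<close> to the component of \<open>G\<close> around it is injective precisely when no two
  remaining vertices get disconnected. If some are, \<open>v\<close> has a neighbour, so the map is also onto and
  the numbers differ.
\<close>

lemma cut_vertex_iff:
  assumes G: "simple_graph G" and v: "v \<in> verts G"
  shows "cut_vertex G v \<longleftrightarrow>
    (\<exists>u\<in>verts G - {v}. \<exists>w\<in>verts G - {v}.
       (u, w) \<in> connected_rel G \<and> (u, w) \<notin> connected_rel (delete_verts G {v}))"
proof -
  let ?H = "delete_verts G {v}"
  let ?A = "components ?H" and ?B = "components G"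
  let ?f = "\<lambda>C. connected_rel G `` C"
  have fin: "finite ?A" "finite ?B"
    using finite_components G simple_graph_delete_verts by blast+
  have f_class: "?f (connected_rel ?H `` {u}) = connected_rel G `` {u}" if "u \<in> verts G - {v}" for u
    using that connected_rel_refl[of u ?H]
    by (auto intro: connected_rel_trans connected_rel_delete_mono)
  have image: "?f ` ?A = (\<lambda>u. connected_rel G `` {u}) ` (verts G - {v})"
  proof -
    have "?A = (\<lambda>u. connected_rel ?H `` {u}) ` (verts G - {v})"
      by (auto simp: components_def quotient_def)
    then show ?thesis using f_class by (simp add: image_image cong: image_cong_simp)
  qed
  show ?thesis
  proof
    assume cut: "cut_vertex G v"
    show "\<exists>u\<in>verts G - {v}. \<exists>w\<in>verts G - {v}. (u, w) \<in> connected_rel G \<and> (u, w) \<notin> connected_rel ?H"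
    proof (rule ccontr)
      assume neg: "\<not> ?thesis"
      have "inj_on ?f ?A"
      proof (rule inj_onI)
        fix C D assume "C \<in> ?A" "D \<in> ?A" and eq: "?f C = ?f D"
        then obtain u w where u: "u \<in> verts G - {v}" "C = connected_rel ?H `` {u}"
          and w: "w \<in> verts G - {v}" "D = connected_rel ?H `` {w}"
          by (auto simp: components_def elim!: quotientE)
        have "(u, w) \<in> connected_rel G"
          using eq f_class u w connected_rel_refl[of w G] by auto
        then have "(u, w) \<in> connected_rel ?H" using neg u w by blast
        from equiv_class_eq[OF equiv_connected_rel this] show "C = D" using u w by simp
      qed
      moreover have "?f ` ?A \<subseteq> ?B"
        unfolding image by (auto simp: components_def intro: quotientI)
      ultimately have "card ?A \<le> card ?B" using fin by (simp add: card_inj_on_le)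
      then show False using cut by (simp add: cut_vertex_def)
    qed
  next
    assume "\<exists>u\<in>verts G - {v}. \<exists>w\<in>verts G - {v}. (u, w) \<in> connected_rel G \<and> (u, w) \<notin> connected_rel ?H"
    then obtain u w where u: "u \<in> verts G - {v}" and w: "w \<in> verts G - {v}"
      and uw: "(u, w) \<in> connected_rel G" "(u, w) \<notin> connected_rel ?H" by blast
    have "\<exists>x. {x, v} \<in> edges G"
    proof (rule ccontr)
      assume iso: "\<nexists>x. {x, v} \<in> edges G"
      have "(u, y) \<in> (adjacency ?H)\<^sup>* " if "(u, y) \<in> (adjacency G)\<^sup>*" for y
        using that
      proof (induction)
        case (step y z)
        then have "{y, z} \<in> edges ?H" using iso by (auto simp: insert_commute)
        then show ?case using step by (auto intro: rtrancl_into_rtrancl)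
      qed simp
      then show False using uw u w by (auto simp: connected_rel_def)
    qed
    then obtain x where x: "{x, v} \<in> edges G" by blast
    then have xv: "x \<in> verts G - {v}" "(x, v) \<in> connected_rel G"
      using edge_vertices[OF G x] edge_connected[OF G x] by auto
    have "?B \<subseteq> ?f ` ?A"
    proof
      fix C assume "C \<in> ?B"
      then obtain y where y: "y \<in> verts G" "C = connected_rel G `` {y}"
        by (auto simp: components_def elim: quotientE)
      show "C \<in> ?f ` ?A"
      proof (cases "y = v")
        case True
        then have "C = connected_rel G `` {x}"
          using equiv_class_eq[OF equiv_connected_rel xv(2)] y by simp
        then show ?thesis unfolding image using xv(1) by blast
      qed (use y in \<open>auto simp: image\<close>)
    qed
    moreover have "\<not> inj_on ?f ?A"
    proof
      assume inj: "inj_on ?f ?A"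
      have "?f (connected_rel ?H `` {u}) = ?f (connected_rel ?H `` {w})"
        using f_class[OF u] f_class[OF w] equiv_class_eq[OF equiv_connected_rel uw(1)] by simp
      then have "connected_rel ?H `` {u} = connected_rel ?H `` {w}"
        using inj_onD[OF inj] u w by (simp add: components_def quotientI)
      then show False using uw(2) connected_rel_refl[of w ?H] w by auto
    qed
    then have "card (?f ` ?A) < card ?A"
      using fin(1) by (meson card_image_le eq_card_imp_inj_on le_neq_implies_less)
    ultimately show "cut_vertex G v"
      using v fin by (auto simp: cut_vertex_def dest!: card_mono[rotated])
  qed
qed

section \<open>Cutsets and splittings\<close>

definition cutset :: "'v ugraph \<Rightarrow> 'v set \<Rightarrow> bool" where
  "cutset G T \<longleftrightarrow> T \<subseteq> verts G \<and> (\<forall>t\<in>T. cut_vertex (delete_verts G (T - {t})) t)"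

definition cutset_balanced :: "'v ugraph \<Rightarrow> bool" where
  "cutset_balanced G \<longleftrightarrow>
     (\<forall>T. cutset G T \<longrightarrow> card (components (delete_verts G T)) = card T + card (components G))"

lemma neighbours_iff: "simple_graph G \<Longrightarrow> w \<in> neighbours G v \<longleftrightarrow> {v, w} \<in> edges G"
  using edge_vertices[of G v w] by (auto simp: neighbours_def)

lemma verts_complete_nbhd [simp]: "verts (complete_nbhd G v) = verts G"
  by (simp add: complete_nbhd_def)

lemma edge_complete_nbhd_iff:
  "{a, b} \<in> edges (complete_nbhd G v) \<longleftrightarrow>
     {a, b} \<in> edges G \<or> a \<in> neighbours G v \<and> b \<in> neighbours G v \<and> a \<noteq> b"
  by (auto simp: complete_nbhd_def doubleton_eq_iff)

text \<open>
  As long as \<open>v\<close> is present, an edge added between two of its neighbours can be replaced by the path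
  through \<open>v\<close>.
\<close>

lemma connected_rel_complete_nbhd:
  assumes "simple_graph G" "v \<notin> T"
  shows "connected_rel (delete_verts (complete_nbhd G v) T) = connected_rel (delete_verts G T)"
proof -
  let ?G = "delete_verts G T" and ?H = "delete_verts (complete_nbhd G v) T"
  have "adjacency ?H \<subseteq> (adjacency ?G)\<^sup>*"
  proof clarify
    fix a b assume ab: "{a, b} \<in> edges ?H"
    show "(a, b) \<in> (adjacency ?G)\<^sup>*"
    proof (cases "{a, b} \<in> edges G")
      case True
      then show ?thesis using ab by auto
    next
      case False
      then have "{a, v} \<in> edges ?G" "{v, b} \<in> edges ?G"
        using ab assms by (auto simp: edge_complete_nbhd_iff neighbours_iff insert_commute)
      then show ?thesis by (auto intro: converse_rtrancl_into_rtrancl)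
    qed
  qed
  moreover have "adjacency ?G \<subseteq> adjacency ?H" by (auto simp: edge_complete_nbhd_iff)
  ultimately have "(adjacency ?H)\<^sup>* = (adjacency ?G)\<^sup>*" using rtrancl_subset by metis
  then show ?thesis by (simp add: connected_rel_def)
qed

lemma components_complete_nbhd:
  assumes "simple_graph G" "v \<notin> T"
  shows "components (delete_verts (complete_nbhd G v) T) = components (delete_verts G T)"
  by (simp add: components_def connected_rel_complete_nbhd[OF assms])

text \<open>
  Cutsets avoiding \<open>v\<close> are cutsets of \<open>complete_nbhd G v\<close> and leave the same components there. A
  cutset \<open>T\<close> containing \<open>v\<close> gives the cutset \<open>T - {v}\<close> of \<open>G - v\<close>; the element lost is compensated by
  the one component that \<open>G - v\<close> has more than \<open>G\<close>.
\<close>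

lemma cutset_balanced_split:
  assumes G: "simple_graph G" and v: "v \<in> verts G"
    and split: "card (components (delete_verts G {v})) = Suc (card (components G))"
    and del: "cutset_balanced (delete_verts G {v})" and nbhd: "cutset_balanced (complete_nbhd G v)"
  shows "cutset_balanced G"
  unfolding cutset_balanced_def
proof (intro allI impI)
  fix T assume T: "cutset G T"
  then have "finite T" using G finite_subset by (auto simp: cutset_def simple_graph_def)
  show "card (components (delete_verts G T)) = card T + card (components G)"
  proof (cases "v \<in> T")
    case True
    have eq: "delete_verts (delete_verts G {v}) (T - {v}) = delete_verts G T"
      using True by (simp add: delete_verts_delete_verts insert_absorb)
    have "cutset (delete_verts G {v}) (T - {v})"
      unfolding cutset_def
    proof (intro conjI ballI)
      show "T - {v} \<subseteq> verts (delete_verts G {v})" using T by (auto simp: cutset_def)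
      fix t assume t: "t \<in> T - {v}"
      have "{v} \<union> (T - {v} - {t}) = T - {t}" using True t by auto
      then show "cut_vertex (delete_verts (delete_verts G {v}) (T - {v} - {t})) t"
        using T t by (simp add: delete_verts_delete_verts cutset_def)
    qed
    then have "card (components (delete_verts G T)) = card (T - {v}) + Suc (card (components G))"
      using del[unfolded cutset_balanced_def, rule_format, of "T - {v}"] unfolding eq split by simp
    then show ?thesis using card_Suc_Diff1[OF \<open>finite T\<close> True] by simp
  next
    case False
    have "cutset (complete_nbhd G v) T"
      unfolding cutset_def
    proof (intro conjI ballI)
      show "T \<subseteq> verts (complete_nbhd G v)" using T by (simp add: cutset_def)
      fix t assume t: "t \<in> T"
      then have "cut_vertex (delete_verts G (T - {t})) t" using T by (simp add: cutset_def)
      moreover have "v \<noteq> t" using False t by blast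
      ultimately show "cut_vertex (delete_verts (complete_nbhd G v) (T - {t})) t"
        using False t components_complete_nbhd[OF G, of v "T - {t}"]
          components_complete_nbhd[OF G, of v "T - {t} \<union> {t}"]
        by (simp add: cut_vertex_def delete_verts_delete_verts)
    qed
    then have "card (components (delete_verts (complete_nbhd G v) T)) = card T + card (components (complete_nbhd G v))"
      using nbhd by (simp only: cutset_balanced_def)
    then show ?thesis
      using components_complete_nbhd[OF G False] components_complete_nbhd[OF G, of v "{}"]
      by (simp add: delete_verts_empty)
  qed
qed

lemma cutset_balanced_complete:
  assumes G: "simple_graph G" and complete: "all_components_complete G"
  shows "cutset_balanced G"
  unfolding cutset_balanced_def
proof (intro allI impI)
  fix T assume T: "cutset G T"
  have "T = {}"
  proof (rule ccontr)
    assume "T \<noteq> {}"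
    then obtain t where t: "t \<in> T" by blast
    let ?H = "delete_verts G (T - {t})"
    have "cut_vertex ?H t" "t \<in> verts ?H" using T t by (auto simp: cutset_def)
    then obtain u w where uw: "(u, w) \<in> connected_rel ?H" "(u, w) \<notin> connected_rel (delete_verts ?H {t})"
      and ne: "u \<noteq> t" "w \<noteq> t"
      using cut_vertex_iff[of ?H t] simple_graph_delete_verts[OF G] by auto
    have uw_verts: "u \<in> verts ?H" "w \<in> verts ?H" using connected_relD[OF uw(1)] by auto
    have "u \<noteq> w" using uw(2) connected_rel_refl[of u "delete_verts ?H {t}"] uw_verts ne by auto
    have "(u, w) \<in> connected_rel G" using connected_rel_delete_mono[OF uw(1)] .
    then have "connected_rel G `` {u} \<in> components G" "u \<in> connected_rel G `` {u}" "w \<in> connected_rel G `` {u}"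
      using connected_relD connected_rel_refl by (fastforce simp: components_def quotientI)+
    then have "{u, w} \<in> edges G"
      using complete \<open>u \<noteq> w\<close> unfolding all_components_complete_def by blast
    then have "{u, w} \<in> edges (delete_verts ?H {t})" using uw_verts ne by auto
    then have "(u, w) \<in> connected_rel (delete_verts ?H {t})"
      by (rule edge_connected[OF simple_graph_delete_verts[OF simple_graph_delete_verts[OF G]]])
    then show False using uw(2) by blast
  qed
  then show "card (components (delete_verts G T)) = card T + card (components G)"
    by (simp add: delete_verts_empty)
qed

text \<open>
  The recursion of \<open>strongly_unmixed\<close>, with unmixedness replaced by the requirement that deleting the
  cut vertex creates exactly one new component.
\<close>

inductive splittable :: "'v ugraph \<Rightarrow> bool" where
  complete: "all_components_complete G \<Longrightarrow> splittable G"
| split: "v \<in> verts G \<Longrightarrow> card (components (delete_verts G {v})) = Suc (card (components G)) \<Longrightarrow>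
    splittable (delete_verts G {v}) \<Longrightarrow> splittable (complete_nbhd G v) \<Longrightarrow>
    splittable (delete_verts (complete_nbhd G v) {v}) \<Longrightarrow> splittable G"

lemma splittable_cutset_balanced: "splittable G \<Longrightarrow> simple_graph G \<Longrightarrow> cutset_balanced G"
proof (induction rule: splittable.induct)
  case (complete G)
  then show ?case by (intro cutset_balanced_complete)
next
  case (split v G)
  then show ?case
    by (intro cutset_balanced_split[of G v])
       (auto intro: simple_graph_delete_verts simple_graph_complete_nbhd)
qed

text \<open>
  The component of \<open>v\<close> falls apart into the class of \<open>a\<close> and the class of \<open>b\<close>, all other components
  stay.
\<close>

lemma card_components_split:
  assumes G: "simple_graph G" and v: "v \<in> verts G"
    and N: "neighbours G v = N1 \<union> N2" "a \<in> N1" "b \<in> N2"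
    and N1: "\<And>x. x \<in> N1 \<Longrightarrow> (a, x) \<in> connected_rel (delete_verts G {v})"
    and N2: "\<And>x. x \<in> N2 \<Longrightarrow> (b, x) \<in> connected_rel (delete_verts G {v})"
    and ab: "(a, b) \<notin> connected_rel (delete_verts G {v})"
  shows "card (components (delete_verts G {v})) = Suc (card (components G))"
proof -
  let ?H = "delete_verts G {v}"
  let ?R = "connected_rel ?H"
  define C1 where "C1 = ?R `` {a}"
  define C2 where "C2 = ?R `` {b}"
  define D where "D = insert v (C1 \<union> C2)"
  have H_verts: "x \<in> verts G \<and> x \<noteq> v \<and> y \<in> verts G \<and> y \<noteq> v" if "(x, y) \<in> ?R" for x y
    using connected_relD[OF that] by simp
  have D_sub: "D \<subseteq> verts G" using v H_verts by (auto simp: D_def C1_def C2_def)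
  have N_D: "x \<in> D" if "{v, x} \<in> edges G" for x
    using that N N1 N2 by (auto simp: D_def C1_def C2_def simp flip: neighbours_iff[OF G])
  have D_closed: "y \<in> D" if "x \<in> D" "(x, y) \<in> ?R" for x y
    using that H_verts[OF that(2)] by (auto simp: D_def C1_def C2_def intro: connected_rel_trans)
  have conn_D: "(x, y) \<in> connected_rel G" if "x \<in> D" "y \<in> D" for x y
  proof -
    have edge: "(v, x) \<in> connected_rel G" if "x \<in> N1 \<union> N2" for x
      using that by (intro edge_connected[OF G]) (simp flip: neighbours_iff[OF G] N(1))
    have "(v, z) \<in> connected_rel G" if z: "z \<in> D" for z
    proof -
      consider "z = v" | "(a, z) \<in> ?R" | "(b, z) \<in> ?R" using z by (auto simp: D_def C1_def C2_def)
      then show ?thesis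
      proof cases
        case 1
        then show ?thesis using v by (simp add: connected_rel_refl)
      next
        case 2
        then show ?thesis
          using edge[of a] N(2) connected_rel_delete_mono connected_rel_trans by (metis UnI1)
      next
        case 3
        then show ?thesis
          using edge[of b] N(3) connected_rel_delete_mono connected_rel_trans by (metis UnI2)
      qed
    qed
    then show ?thesis using that connected_rel_sym connected_rel_trans by metis
  qed
  \<comment> \<open>The relation \<open>?R\<close> enlarged by \<open>D \<times> D\<close> is transitive and contains all edges of \<open>G\<close>.\<close>
  have conn: "(x, y) \<in> ?R \<or> x \<in> D \<and> y \<in> D" if "(x, y) \<in> connected_rel G" for x y
  proof -
    have "(x, y) \<in> (adjacency G)\<^sup>*" "x \<in> verts G" using that by (auto simp: connected_rel_def)
    then show ?thesis
    proof (induction)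
      case base
      then show ?case using connected_rel_refl[of x ?H] by (auto simp: D_def)
    next
      case (step y z)
      then have yz: "{y, z} \<in> edges G" by simp
      consider "y = v" | "z = v" | "(y, z) \<in> ?R"
        using yz edge_connected[OF simple_graph_delete_verts[OF G], of y z "{v}"] by auto
      then show ?case
      proof cases
        case 1
        then have "x \<in> D" "z \<in> D" using step H_verts N_D yz by auto
        then show ?thesis by simp
      next
        case 2
        then have "y \<in> D" "z \<in> D" using N_D[of y] yz by (auto simp: insert_commute D_def)
        moreover have "x \<in> D" using step \<open>y \<in> D\<close> D_closed connected_rel_sym by metis
        ultimately show ?thesis by simp
      next
        case 3
        then show ?thesis using step D_closed connected_rel_trans by metis
      qed
    qed
  qed
  define B where "B = (\<lambda>u. ?R `` {u}) ` (verts G - D)"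
  have class_in: "connected_rel G `` {u} = D" if "u \<in> D" for u
    using that conn conn_D D_closed by blast
  have class_out: "connected_rel G `` {u} = ?R `` {u}" if "u \<notin> D" for u
  proof (rule Set.set_eqI)
    show "y \<in> connected_rel G `` {u} \<longleftrightarrow> y \<in> ?R `` {u}" for y
      using that conn[of u y] connected_rel_delete_mono[of u y G "{v}"] by auto
  qed
  have "components G = (\<lambda>u. connected_rel G `` {u}) ` (D \<union> (verts G - D))"
    using D_sub by (auto simp: components_def quotient_def)
  also have "\<dots> = insert D B"
  proof -
    have "(\<lambda>u. connected_rel G `` {u}) ` D = (\<lambda>_. D) ` D"
      by (rule image_cong[OF refl class_in])
    moreover have "(\<lambda>u. connected_rel G `` {u}) ` (verts G - D) = B"
      unfolding B_def by (rule image_cong[OF refl]) (simp add: class_out)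
    moreover have "D \<noteq> {}" by (simp add: D_def)
    ultimately show ?thesis unfolding image_Un by (simp add: image_constant_conv del: Un_Diff_cancel)
  qed
  finally have G_comps: "components G = insert D B" .
  have aD: "a \<in> C1" "b \<in> C2" using N1[OF N(2)] N2[OF N(3)] by (auto simp: C1_def C2_def)
  have class1: "?R `` {u} = C1" if "u \<in> C1" for u
    using that equiv_class_eq[OF equiv_connected_rel, of a u ?H] by (simp add: C1_def)
  have class2: "?R `` {u} = C2" if "u \<in> C2" for u
    using that equiv_class_eq[OF equiv_connected_rel, of b u ?H] by (simp add: C2_def)
  have "(\<lambda>u. ?R `` {u}) ` C1 = (\<lambda>_. C1) ` C1" by (rule image_cong[OF refl class1])
  then have image1: "(\<lambda>u. ?R `` {u}) ` C1 = {C1}" using aD(1) by auto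
  have "(\<lambda>u. ?R `` {u}) ` C2 = (\<lambda>_. C2) ` C2" by (rule image_cong[OF refl class2])
  then have image2: "(\<lambda>u. ?R `` {u}) ` C2 = {C2}" using aD(2) by auto
  have "verts ?H = (C1 \<union> C2) \<union> (verts G - D)"
    using H_verts D_sub by (auto simp: D_def C1_def C2_def)
  then have "components ?H = (\<lambda>u. ?R `` {u}) ` ((C1 \<union> C2) \<union> (verts G - D))"
    by (auto simp: components_def quotient_def)
  also have "\<dots> = insert C1 (insert C2 B)"
    unfolding image_Un image1 image2 B_def by (simp add: insert_commute)
  finally have H_comps: "components ?H = insert C1 (insert C2 B)" .
  have self: "u \<in> ?R `` {u}" if "u \<in> verts G - D" for u
    using that by (auto simp: D_def intro: connected_rel_refl)
  have "D \<notin> B" "C1 \<notin> B" "C2 \<notin> B"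
    using self by (auto simp: B_def D_def)
  moreover have "C1 \<noteq> C2" using ab aD by (auto simp: C1_def C2_def dest: connected_rel_sym)
  moreover have "finite B"
    using finite_components[OF G] G_comps by simp
  ultimately show ?thesis by (simp add: G_comps H_comps)
qed

section \<open>Minimal primes of binomial edge ideals\<close>

definition minor :: "'v \<Rightarrow> 'v \<Rightarrow> ('v, 'k::field) edge_poly" where
  "minor u v = var (XVar u) * var (YVar v) - var (XVar v) * var (YVar u)"

lemma var_in_poly_ring: "z \<in> S \<Longrightarrow> var z \<in> carrier (poly_ring S)"
  unfolding var_def by (rule single_in_poly_ring) simp

lemma minor_in_poly_ring:
  "u \<in> V \<Longrightarrow> v \<in> V \<Longrightarrow> minor u v \<in> carrier (poly_ring (edge_vars V))"
  unfolding minor_def by (intro diff_in_poly_ring poly_ring_mult_closed var_in_poly_ring) simp_all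

lemma single_add_var:
  "single (m + single z 1) (1::'k::field) = single m 1 * var z"
  by (simp add: var_def mult_single)

lemma split_variable:
  fixes m :: "'x \<Rightarrow>\<^sub>0 nat"
  assumes "lookup m z > 0"
  shows "m = (m - single z 1) + single z 1"
  using assms by (intro poly_mapping_eqI) (auto simp: lookup_add lookup_minus lookup_single when_def)

text \<open>
  Two monomials of the same grade differ by exchanges \<open>x\<^sub>u y\<^sub>v \<leftrightarrow> x\<^sub>v y\<^sub>u\<close> within classes, each of which
  is a multiple of a minor. The induction removes one \<open>x\<^sub>u\<close> at a time: if \<open>m'\<close> does not contain it, the
  grade provides \<open>y\<^sub>u\<close> and some \<open>x\<^sub>v\<close> of the same class in \<open>m'\<close>, and one exchange creates it.
\<close>

lemma exchange_binomial:
  fixes P :: "('v, 'k::field) edge_poly set"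
  assumes P: "primeideal P (poly_ring (edge_vars V))" and "finite V" "W \<subseteq> V"
    and minors: "\<And>u v. u \<in> W \<Longrightarrow> v \<in> W \<Longrightarrow> c u = c v \<Longrightarrow> minor u v \<in> P"
    and m: "keys m \<subseteq> edge_vars W" "keys m' \<subseteq> edge_vars W"
    and grade: "grade V c m = grade V c m'"
  shows "single m 1 - single m' 1 \<in> P"
  using m grade
proof (induction "\<Sum>v\<in>V. lookup m (XVar v)" arbitrary: m m' rule: less_induct)
  case less
  have carr: "single n 1 \<in> carrier (poly_ring (edge_vars V))"
    if "keys n \<subseteq> edge_vars W" for n
    using that edge_vars_mono[OF \<open>W \<subseteq> V\<close>] by (intro single_in_poly_ring) auto
  show ?case
  proof (cases "\<exists>u\<in>V. lookup m (XVar u) > 0")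
    case False
    then have x: "lookup m (XVar v) = 0" if "v \<in> V" for v using that by auto
    have x': "lookup m' (XVar v) = 0" if "v \<in> V" for v
    proof -
      have "label_degree V c m' (c v) = label_degree V c m (c v)"
        using less.prems(3) by (simp add: grade_eq_iff)
      also have "\<dots> = 0" using x by (simp add: label_degree_def)
      finally show ?thesis using that \<open>finite V\<close> by (simp add: label_degree_def)
    qed
    have "m = m'"
    proof (rule monomial_eqI)
      fix v
      have out: "lookup n (XVar v) = 0" "lookup n (YVar v) = 0"
        if "keys n \<subseteq> edge_vars W" "v \<notin> V" for n
        using lookup_outside[OF that(1), of v] that(2) \<open>W \<subseteq> V\<close> by auto
      show "lookup m (XVar v) = lookup m' (XVar v)"
        using x[of v] x'[of v] out[OF less.prems(1)] out[OF less.prems(2)] by (cases "v \<in> V") auto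
      show "lookup m (YVar v) = lookup m' (YVar v)"
        using x[of v] x'[of v] out[OF less.prems(1)] out[OF less.prems(2)] less.prems(3)
        by (cases "v \<in> V") (auto simp: grade_eq_iff vertex_degree_def)
    qed
    then show ?thesis using prime_poly_ringD(2)[OF P] by simp
  next
    case True
    then obtain u where u: "u \<in> V" "lookup m (XVar u) > 0" by blast
    have in_W: "v \<in> W" if "lookup n (XVar v) > 0" "keys n \<subseteq> edge_vars W" for n :: "'v edge_var \<Rightarrow>\<^sub>0 nat" and v
    proof -
      have "XVar v \<in> keys n" using that(1) by (simp add: in_keys_iff)
      then show ?thesis using that(2) by auto
    qed
    have uW: "u \<in> W" by (rule in_W[OF u(2) less.prems(1)])
    let ?xu = "single (XVar u) 1 :: 'v edge_var \<Rightarrow>\<^sub>0 nat"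
    define n where "n = m - ?xu"
    have mn: "m = n + ?xu" unfolding n_def by (rule split_variable[OF u(2)])
    have keys_n: "keys n \<subseteq> edge_vars W" using less.prems(1) by (simp add: mn keys_add_nat)
    have smaller: "(\<Sum>v\<in>V. lookup n (XVar v)) < (\<Sum>v\<in>V. lookup m (XVar v))"
    proof (rule sum_strict_mono_ex1[OF \<open>finite V\<close>])
      show "\<exists>v\<in>V. lookup n (XVar v) < lookup m (XVar v)"
        using u(1) by (intro bexI[of _ u]) (simp_all add: mn lookup_add)
    qed (simp add: mn lookup_add)
    have IH: "single n 1 - single n' 1 \<in> P"
      if "keys n' \<subseteq> edge_vars W" "grade V c n = grade V c n'" for n'
      using less.hyps[OF smaller keys_n that] .
    have xu_carr: "var (XVar u) \<in> carrier (poly_ring (edge_vars V))"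
      using u(1) by (intro var_in_poly_ring) simp
    show ?thesis
    proof (cases "lookup m' (XVar u) > 0")
      case True
      define n' where "n' = m' - ?xu"
      have mn': "m' = n' + ?xu" unfolding n'_def by (rule split_variable[OF True])
      have "single n 1 - single n' 1 \<in> P"
        using less.prems(2,3) by (intro IH) (simp_all add: mn mn' keys_add_nat grade_add_cancel del: One_nat_def)
      from prime_poly_ringD(6)[OF P this xu_carr] show ?thesis
        unfolding mn mn' single_add_var by (simp add: algebra_simps)
    next
      case False
      have "vertex_degree m u = vertex_degree m' u" using less.prems(3) u(1) by (simp add: grade_eq_iff)
      then have yu: "lookup m' (YVar u) > 0" using u(2) False by (simp add: vertex_degree_def)
      have "0 < label_degree V c m (c u)"
        unfolding label_degree_def using u \<open>finite V\<close> by (intro sum_pos2[of _ u]) auto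
      then have "label_degree V c m' (c u) \<noteq> 0" using less.prems(3) by (simp add: grade_eq_iff)
      then obtain v where "v \<in> {v. v \<in> V \<and> c v = c u}" "lookup m' (XVar v) \<noteq> 0"
        unfolding label_degree_def by (rule sum.not_neutral_contains_not_neutral)
      then have v: "v \<in> V" "c v = c u" "lookup m' (XVar v) > 0" by auto
      have vW: "v \<in> W" by (rule in_W[OF v(3) less.prems(2)])
      let ?xv = "single (XVar v) 1 :: 'v edge_var \<Rightarrow>\<^sub>0 nat"
      let ?yu = "single (YVar u) 1 :: 'v edge_var \<Rightarrow>\<^sub>0 nat"
      let ?yv = "single (YVar v) 1 :: 'v edge_var \<Rightarrow>\<^sub>0 nat"
      \<comment> \<open>The exchange replaces \<open>x\<^sub>v y\<^sub>u\<close> in \<open>m'\<close> by \<open>x\<^sub>u y\<^sub>v\<close>, and \<open>k\<close> is the part that stays.\<close>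
      define k where "k = m' - ?xv - ?yu"
      have "lookup (m' - ?xv) (YVar u) > 0"
        using yu by (simp add: lookup_minus lookup_single)
      then have mk: "m' = k + ?yu + ?xv"
        unfolding k_def using split_variable[OF v(3)] split_variable[of "m' - ?xv" "YVar u"] by metis
      have keys_k: "keys k \<subseteq> edge_vars W" using less.prems(2) by (simp add: mk keys_add_nat)
      have "grade V c (k + ?yv + ?xu) = grade V c (k + ?yu + ?xv)"
        using \<open>finite V\<close> u v
        by (simp add: grade_eq_iff vertex_degree_add label_degree_add vertex_degree_single
            label_degree_single del: One_nat_def)
      then have "grade V c (n + ?xu) = grade V c (k + ?yv + ?xu)"
        using less.prems(3) by (simp only: mn mk)
      then have "grade V c n = grade V c (k + ?yv)" by (simp only: grade_add_cancel)
      then have "single n 1 - single (k + ?yv) 1 \<in> P"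
        using keys_k vW by (intro IH) (simp_all add: keys_add_nat)
      from prime_poly_ringD(6)[OF P this xu_carr]
      have "var (XVar u) * (single n 1 - single k 1 * var (YVar v)) \<in> P"
        unfolding single_add_var .
      moreover have "single k 1 * minor u v \<in> P"
        using prime_poly_ringD(6)[OF P minors carr[OF keys_k]] uW vW v(2) by simp
      ultimately have "var (XVar u) * (single n 1 - single k 1 * var (YVar v))
          + single k 1 * minor u v \<in> P"
        by (rule prime_poly_ringD(4)[OF P])
      then show ?thesis
        unfolding mn mk single_add_var by (simp add: minor_def algebra_simps)
    qed
  qed
qed

text \<open>
  Proportionality is transitive through a nonzero vector: multiplied by \<open>x\<^sub>w\<close> or by \<open>y\<^sub>w\<close>, the minor of
  \<open>u\<close> and \<open>z\<close> is a combination of the other two minors.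
\<close>

lemma minor_trans:
  assumes P: "primeideal P (poly_ring (edge_vars V))" and V: "u \<in> V" "w \<in> V" "z \<in> V"
    and w: "var (XVar w) \<notin> P \<or> var (YVar w) \<notin> P"
    and minors: "minor u w \<in> P" "minor w z \<in> P"
  shows "minor u z \<in> P"
proof -
  note mult = prime_poly_ringD(6)[OF P] and add = prime_poly_ringD(4)[OF P]
  have var: "var (XVar v) \<in> carrier (poly_ring (edge_vars V))"
      "var (YVar v) \<in> carrier (poly_ring (edge_vars V))" if "v \<in> V" for v
    using that by (auto intro: var_in_poly_ring)
  have "var (XVar u) * minor w z + var (XVar z) * minor u w \<in> P"
    by (intro add mult minors var V)
  then have x: "var (XVar w) * minor u z \<in> P" by (simp add: minor_def algebra_simps)
  have "var (YVar z) * minor u w + var (YVar u) * minor w z \<in> P"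
    by (intro add mult minors var V)
  then have y: "var (YVar w) * minor u z \<in> P" by (simp add: minor_def algebra_simps)
  show ?thesis
    using w prime_poly_ringD(7)[OF P var(1) minor_in_poly_ring x]
      prime_poly_ringD(7)[OF P var(2) minor_in_poly_ring y] V by blast
qed

lemma edge_ring_eq: "edge_ring G = poly_ring (edge_vars (verts G))"
  by (simp add: edge_ring_def edge_vars_def)

lemma minor_in_label_ideal:
  assumes "finite V" "u \<in> V" "v \<in> V" "u \<in> T \<or> v \<in> T \<or> c u = c v"
  shows "minor u v \<in> (label_ideal V (edge_vars T) c :: ('v, 'k::field) edge_poly set)"
proof -
  let ?m = "single (XVar u) 1 + single (YVar v) 1 :: 'v edge_var \<Rightarrow>\<^sub>0 nat"
  let ?m' = "single (XVar v) 1 + single (YVar u) 1 :: 'v edge_var \<Rightarrow>\<^sub>0 nat"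
  have eq: "minor u v = single ?m 1 - single ?m' (1::'k)"
    by (simp add: minor_def var_def mult_single)
  have carr: "minor u v \<in> carrier (poly_ring (edge_vars V))"
    using assms minor_in_poly_ring by metis
  have keys: "keys ?m = {XVar u, YVar v}" "keys ?m' = {XVar v, YVar u}"
    by (auto simp: keys_add_nat)
  have "fibre_sum (edge_vars T) (grade V c) g (minor u v :: ('v, 'k) edge_poly) = 0" for g
  proof (cases "u \<in> T \<or> v \<in> T")
    case True
    then show ?thesis unfolding eq fibre_sum_diff fibre_sum_single keys by auto
  next
    case False
    then have "grade V c ?m = grade V c ?m'"
      using assms by (simp add: grade_eq_iff vertex_degree_add label_degree_add vertex_degree_single
          label_degree_single del: One_nat_def)
    then show ?thesis unfolding eq fibre_sum_diff fibre_sum_single keys by auto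
  qed
  then show ?thesis using carr by (simp add: label_ideal_def toric_ideal_def)
qed

lemma binomial_edge_ideal_subset_iff:
  fixes P :: "('v, 'k::field) edge_poly set"
  assumes G: "simple_graph G" and P: "ideal P (edge_ring G)"
  shows "binomial_edge_ideal G \<subseteq> P \<longleftrightarrow> (\<forall>i j. {i, j} \<in> edges G \<longrightarrow> minor i j \<in> P)"
proof -
  interpret cring "edge_ring G :: ('v, 'k) edge_poly ring"
    unfolding edge_ring_def by (rule cring_poly_ring)
  let ?B = "{minor i j | i j. {i, j} \<in> edges G} :: ('v, 'k) edge_poly set"
  have "binomial_edge_ideal G = genideal (edge_ring G) ?B"
    by (simp add: binomial_edge_ideal_def minor_def)
  moreover have "?B \<subseteq> carrier (edge_ring G)"
    using edge_vertices[OF G] by (auto simp: edge_ring_eq intro!: minor_in_poly_ring)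
  then have "?B \<subseteq> genideal (edge_ring G) ?B" by (rule genideal_self)
  ultimately show ?thesis
    using genideal_minimal[OF P, of ?B] by blast
qed

definition cut_labels :: "'v ugraph \<Rightarrow> 'v set \<Rightarrow> 'v \<Rightarrow> 'v" where
  "cut_labels G T = component_rep (delete_verts G T)"

text \<open>
  The prime usually written \<open>P\<^sub>T(G)\<close>, generated by the variables of \<open>T\<close> and by the minors within the
  components of \<open>G - T\<close>. Defined as a toric ideal it is prime by construction.
\<close>

definition cut_prime :: "'v ugraph \<Rightarrow> 'v set \<Rightarrow> ('v, 'k::field) edge_poly set" where
  "cut_prime G T = label_ideal (verts G) (edge_vars T) (cut_labels G T)"

lemma labelling_cut_labels: "T \<subseteq> verts G \<Longrightarrow> labelling (verts G) T (cut_labels G T)"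
  unfolding labelling_def cut_labels_def
  using component_rep_in_verts[of _ "delete_verts G T"]
  by (auto simp: component_rep_idem component_rep_outside)

lemma cut_labels_eq_iff:
  "u \<in> verts G - T \<Longrightarrow> v \<in> verts G - T \<Longrightarrow>
     cut_labels G T u = cut_labels G T v \<longleftrightarrow> (u, v) \<in> connected_rel (delete_verts G T)"
  unfolding cut_labels_def by (rule component_rep_eq_iff) auto

lemma cut_prime_prime:
  assumes "simple_graph G" "T \<subseteq> verts G"
  shows "primeideal (cut_prime G T) (edge_ring G)"
  unfolding cut_prime_def edge_ring_eq
  using assms(1) labelling_image[OF labelling_cut_labels[OF assms(2)]]
  by (intro label_ideal_prime) (auto simp: simple_graph_def)

lemma binomial_edge_ideal_subset_cut_prime:
  assumes "simple_graph G" "T \<subseteq> verts G"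
  shows "binomial_edge_ideal G \<subseteq> cut_prime G T"
proof -
  have "minor i j \<in> cut_prime G T" if e: "{i, j} \<in> edges G" for i j
    unfolding cut_prime_def
  proof (rule minor_in_label_ideal)
    show "finite (verts G)" "i \<in> verts G" "j \<in> verts G"
      using assms(1) edge_vertices[OF assms(1) e] by (auto simp: simple_graph_def)
    show "i \<in> T \<or> j \<in> T \<or> cut_labels G T i = cut_labels G T j"
      using cut_labels_eq_iff[of i G T j] edge_vertices[OF assms(1) e] e
        edge_connected[OF simple_graph_delete_verts[OF assms(1)], of i j T] by auto
  qed
  then show ?thesis
    using binomial_edge_ideal_subset_iff[OF assms(1)] cut_prime_prime[OF assms] primeideal.axioms(1) by blast
qed

text \<open>
  The set \<open>T\<close> consists of the vertices with both variables in \<open>P\<close>. Outside \<open>T\<close>, minors spread along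
  paths by \<open>minor_trans\<close>.
\<close>

lemma prime_contains_cut_prime:
  fixes P :: "('v, 'k::field) edge_poly set"
  assumes G: "simple_graph G" and P: "primeideal P (edge_ring G)" and "binomial_edge_ideal G \<subseteq> P"
  shows "\<exists>T\<subseteq>verts G. cut_prime G T \<subseteq> P"
proof -
  let ?V = "verts G"
  have "finite ?V" using G by (simp add: simple_graph_def)
  have P': "primeideal P (poly_ring (edge_vars ?V))" using P by (simp add: edge_ring_eq)
  have edge: "minor i j \<in> P" if "{i, j} \<in> edges G" for i j
    using binomial_edge_ideal_subset_iff[OF G primeideal.axioms(1)[OF P]] assms(3) that by blast
  define T where "T = {v \<in> ?V. var (XVar v) \<in> P \<and> var (YVar v) \<in> P}"
  have "T \<subseteq> ?V" by (auto simp: T_def)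
  have path: "minor u v \<in> P"
    if "(u, v) \<in> (adjacency (delete_verts G T))\<^sup>*" "u \<in> ?V - T" for u v
    using that
  proof (induction)
    case base
    then show ?case using prime_poly_ringD(2)[OF P'] by (simp add: minor_def)
  next
    case (step w z)
    then have e: "{w, z} \<in> edges G" "w \<notin> T" by auto
    then have "var (XVar w) \<notin> P \<or> var (YVar w) \<notin> P" "w \<in> ?V" "z \<in> ?V"
      using edge_vertices[OF G e(1)] by (auto simp: T_def)
    then show ?case using minor_trans[OF P', of u w z] step edge[OF e(1)] by blast
  qed
  have "cut_prime G T \<subseteq> P"
    unfolding cut_prime_def label_ideal_def
  proof (rule toric_ideal_subset_prime[OF P'])
    fix m :: "'v edge_var \<Rightarrow>\<^sub>0 nat"
    assume m: "keys m \<subseteq> edge_vars ?V" "keys m \<inter> edge_vars T \<noteq> {}"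
    then obtain z where z: "z \<in> keys m" "z \<in> edge_vars T" by blast
    then have "var z \<in> P" by (auto simp: T_def edge_vars_def)
    have split: "m = (m - single z 1) + single z 1"
      using z by (intro split_variable) (simp add: in_keys_iff)
    have "keys (m - single z 1) \<subseteq> keys m"
      by (auto simp: in_keys_iff lookup_minus)
    then have "single (m - single z 1) 1 * var z \<in> P"
      using m(1) by (intro prime_poly_ringD(6)[OF P' \<open>var z \<in> P\<close>] single_in_poly_ring) auto
    then show "single m 1 \<in> P" using single_add_var split by metis
  next
    fix m m' :: "'v edge_var \<Rightarrow>\<^sub>0 nat"
    assume m: "keys m \<subseteq> edge_vars ?V" "keys m' \<subseteq> edge_vars ?V"
      "keys m \<inter> edge_vars T = {}" "keys m' \<inter> edge_vars T = {}"
      and grade: "grade ?V (cut_labels G T) m = grade ?V (cut_labels G T) m'"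
    show "single m 1 - single m' 1 \<in> P"
    proof (rule exchange_binomial[OF P' \<open>finite ?V\<close> _ _ _ _ grade])
      show "?V - T \<subseteq> ?V" by auto
      show "keys m \<subseteq> edge_vars (?V - T)" "keys m' \<subseteq> edge_vars (?V - T)"
        unfolding edge_vars_Diff using m by blast+
      show "minor u v \<in> P" if "u \<in> ?V - T" "v \<in> ?V - T" "cut_labels G T u = cut_labels G T v" for u v
        using path[of u v] cut_labels_eq_iff[OF that(1,2)] that by (simp add: connected_rel_def)
    qed
  qed
  then show ?thesis using \<open>T \<subseteq> ?V\<close> by blast
qed

text \<open>
  Putting \<open>t\<close> back joins no two components of \<open>G - T\<close>, so on monomials without the variables of \<open>T\<close>
  both ideals see the same classes, while \<open>x\<^sub>t\<close> belongs only to the larger one.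
\<close>

lemma cut_prime_not_minimal:
  assumes G: "simple_graph G" and T: "T \<subseteq> verts G" "t \<in> T"
    and not_cut: "\<not> cut_vertex (delete_verts G (T - {t})) t"
  shows "(cut_prime G (T - {t}) :: ('v, 'k::field) edge_poly set) \<subset> cut_prime G T"
proof -
  let ?V = "verts G" and ?T' = "T - {t}"
  let ?H = "delete_verts G ?T'"
  have "finite ?V" using G by (simp add: simple_graph_def)
  have HT: "delete_verts ?H {t} = delete_verts G T" using T by (simp add: delete_verts_delete_verts insert_absorb)
  have conn: "(u, w) \<in> connected_rel (delete_verts G T)"
    if "u \<in> ?V - T" "w \<in> ?V - T" "(u, w) \<in> connected_rel ?H" for u w
    using not_cut cut_vertex_iff[OF simple_graph_delete_verts[OF G], of t ?T'] that T HT by auto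
  have "(cut_prime G ?T' :: ('v, 'k) edge_poly set) \<subseteq> cut_prime G T"
    unfolding cut_prime_def label_ideal_def
  proof (rule toric_ideal_mono)
    fix m :: "'v edge_var \<Rightarrow>\<^sub>0 nat"
    assume "keys m \<inter> edge_vars T = {}"
    then show "keys m \<inter> edge_vars ?T' = {}"
      using edge_vars_mono[of ?T' T] by blast
  next
    fix m m' :: "'v edge_var \<Rightarrow>\<^sub>0 nat"
    assume m: "keys m \<inter> edge_vars T = {}" and m': "keys m' \<inter> edge_vars ?T' = {}"
      and grade: "grade ?V (cut_labels G ?T') m = grade ?V (cut_labels G ?T') m'"
    have free: "lookup n z = 0" if "keys n \<inter> Z = {}" "z \<in> Z"
      for n :: "'v edge_var \<Rightarrow>\<^sub>0 nat" and Z z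
      using that by (auto simp: in_keys_iff)
    have "vertex_degree m t = vertex_degree m' t" using grade T by (auto simp: grade_eq_iff)
    then have t: "lookup m' (XVar t) = 0" "lookup m' (YVar t) = 0"
      using free[OF m, of "XVar t"] free[OF m, of "YVar t"] T by (auto simp: vertex_degree_def)
    have m'_T: "lookup m' (XVar v) = 0" "lookup m' (YVar v) = 0" if "v \<in> T" for v
      using that t free[OF m', of "XVar v"] free[OF m', of "YVar v"] by (cases "v = t"; auto)+
    have "keys m' \<inter> edge_vars T = {}"
      using m'_T by (auto simp: edge_vars_def in_keys_iff)
    moreover have "grade ?V (cut_labels G T) m = grade ?V (cut_labels G T) m'"
    proof (rule grade_coarsen[OF \<open>finite ?V\<close> _ _ _ _ grade])
      show "?V - T \<subseteq> ?V" by auto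
      show "cut_labels G T u = cut_labels G T v"
        if "u \<in> ?V - T" "v \<in> ?V - T" "cut_labels G ?T' u = cut_labels G ?T' v" for u v
        using conn[OF that(1,2)] cut_labels_eq_iff[OF that(1,2)] cut_labels_eq_iff[of u G ?T' v] that by auto
      show "lookup m (XVar v) = 0" if "v \<in> ?V - (?V - T)" for v
        using free[OF m, of "XVar v"] that by auto
      show "lookup m' (XVar v) = 0" if "v \<in> ?V - (?V - T)" for v
        using m'_T that by auto
    qed
    ultimately show "keys m' \<inter> edge_vars T = {} \<and>
        grade ?V (cut_labels G T) m = grade ?V (cut_labels G T) m'" by blast
  qed
  moreover have "single (single (XVar t) 1) 1
      \<in> (cut_prime G T :: ('v, 'k) edge_poly set) - cut_prime G ?T'"
    using T unfolding cut_prime_def label_ideal_def by (auto simp: single_in_toric_ideal_iff)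
  ultimately show ?thesis by blast
qed

lemma minimal_prime_cut_prime:
  fixes P :: "('v, 'k::field) edge_poly set"
  assumes G: "simple_graph G" and P: "P \<in> minimal_primes (edge_ring G) (binomial_edge_ideal G)"
  shows "\<exists>T. cutset G T \<and> P = cut_prime G T"
proof -
  have min: "Q = P" if "primeideal Q (edge_ring G)" "binomial_edge_ideal G \<subseteq> Q" "Q \<subseteq> P" for Q
    using P that by (auto simp: minimal_primes_def)
  obtain T where T: "T \<subseteq> verts G" "cut_prime G T \<subseteq> P"
    using prime_contains_cut_prime[OF G, of P] P by (auto simp: minimal_primes_def)
  then have eq: "cut_prime G T = P"
    by (intro min cut_prime_prime binomial_edge_ideal_subset_cut_prime G)
  have "cut_vertex (delete_verts G (T - {t})) t" if "t \<in> T" for t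
  proof (rule ccontr)
    assume "\<not> ?thesis"
    then have less: "cut_prime G (T - {t}) \<subset> P" using cut_prime_not_minimal[OF G T(1) that] eq by blast
    have "T - {t} \<subseteq> verts G" using T by auto
    then have "cut_prime G (T - {t}) = P"
      using less by (intro min cut_prime_prime binomial_edge_ideal_subset_cut_prime G) auto
    then show False using less by blast
  qed
  then show ?thesis using T eq by (auto simp: cutset_def)
qed

text \<open>
  The number of moved vertices is \<open>|V| - |T| - c(T)\<close>, since each component contributes one fixed
  vertex and the vertices of \<open>T\<close> are fixed. The subtraction does not truncate, as components are
  nonempty.
\<close>

lemma prime_height_cut_prime:
  assumes G: "simple_graph G" and T: "T \<subseteq> verts G"
  shows "prime_height (edge_ring G) (cut_prime G T :: ('v, 'k::field) edge_poly set)
    = enat (card (verts G) + card T - card (components (delete_verts G T)))"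
proof -
  let ?V = "verts G" and ?c = "cut_labels G T"
  have "finite ?V" using G by (simp add: simple_graph_def)
  then have "finite T" using T finite_subset by blast
  have fixed: "?c t = t" if "t \<in> T" for t using that by (simp add: cut_labels_def component_rep_def)
  have comps: "card (components (delete_verts G T)) = card {v \<in> ?V - T. ?c v = v}"
    by (simp add: card_components cut_labels_def)
  have "card ?V = card ({v \<in> ?V - T. ?c v = v} \<union> {v \<in> ?V. ?c v \<noteq> v} \<union> T)"
    using fixed T by (intro arg_cong[of _ _ card]) auto
  also have "\<dots> = card {v \<in> ?V - T. ?c v = v} + card {v \<in> ?V. ?c v \<noteq> v} + card T"
    using \<open>finite ?V\<close> \<open>finite T\<close> fixed by (subst card_Un_disjoint; auto)+
  finally have "2 * card T + card {v \<in> ?V. ?c v \<noteq> v} = card ?V + card T - card (components (delete_verts G T))"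
    by (simp add: comps)
  then show ?thesis
    using prime_height_label_ideal[OF \<open>finite ?V\<close> labelling_cut_labels[OF T], where 'k='k]
    by (simp add: cut_prime_def edge_ring_eq)
qed

theorem unmixed_if_cutset_balanced:
  assumes G: "simple_graph G" and balanced: "cutset_balanced G"
  shows "unmixed (edge_ring G :: ('v, 'k::field) edge_poly ring) (binomial_edge_ideal G)"
proof -
  have "prime_height (edge_ring G) P = enat (card (verts G) - card (components G))"
    if P: "P \<in> minimal_primes (edge_ring G) (binomial_edge_ideal G)" for P :: "('v, 'k) edge_poly set"
  proof -
    obtain T where T: "cutset G T" "P = cut_prime G T" using minimal_prime_cut_prime[OF G P] by blast
    have "T \<subseteq> verts G" using T(1) by (simp add: cutset_def)
    moreover have "card (components (delete_verts G T)) = card T + card (components G)"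
      using balanced T(1) by (simp add: cutset_balanced_def)
    ultimately show ?thesis using prime_height_cut_prime[OF G, of T] T(2) by simp
  qed
  then show ?thesis by (simp add: unmixed_def)
qed

theorem strongly_unmixed_if_splittable:
  "splittable G \<Longrightarrow> simple_graph G \<Longrightarrow> strongly_unmixed TYPE('k::field) G"
proof (induction rule: splittable.induct)
  case (complete G)
  then show ?case by (intro strongly_unmixed.complete)
next
  case (split v G)
  have "splittable G" using split.hyps by (rule splittable.split)
  show ?case
  proof (rule strongly_unmixed.cut[of _ v])
    show "unmixed (edge_ring G :: ('a, 'k) edge_poly ring) (binomial_edge_ideal G)"
      using \<open>splittable G\<close> split.prems by (intro unmixed_if_cutset_balanced splittable_cutset_balanced)
    show "cut_vertex G v" using split.hyps by (simp add: cut_vertex_def)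
  qed (use split in \<open>auto intro: simple_graph_delete_verts simple_graph_complete_nbhd\<close>)
qed

section \<open>Two cliques with whiskers and links\<close>

text \<open>
  The pairs in \<open>Q\<close> are arbitrary further edges: matching edges between the cliques and whiskers.
\<close>

definition two_cliques :: "'v set \<Rightarrow> 'v set \<Rightarrow> 'v set \<Rightarrow> 'v rel \<Rightarrow> 'v ugraph" where
  "two_cliques V A B Q =
     \<lparr>verts = V, edges = edges (complete_graph A) \<union> edges (complete_graph B) \<union> {{u, w} | u w. (u, w) \<in> Q}\<rparr>"

lemma verts_two_cliques [simp]: "verts (two_cliques V A B Q) = V"
  by (simp add: two_cliques_def)

lemma edge_two_cliques_iff:
  "{u, w} \<in> edges (two_cliques V A B Q) \<longleftrightarrow>
     u \<noteq> w \<and> (u \<in> A \<and> w \<in> A \<or> u \<in> B \<and> w \<in> B) \<or> (u, w) \<in> Q \<or> (w, u) \<in> Q"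
  by (auto simp: two_cliques_def complete_graph_def doubleton_eq_iff)

lemma simple_two_cliques:
  assumes "finite V" "A \<subseteq> V" "B \<subseteq> V" "Q \<subseteq> V \<times> V" "irrefl Q"
  shows "simple_graph (two_cliques V A B Q)"
  using assms
  by (auto simp: simple_graph_def two_cliques_def complete_graph_def irrefl_def card_insert_if)

lemma simple_graph_eqI:
  assumes "simple_graph G" "simple_graph H" "verts G = verts H"
    and "\<And>u w. {u, w} \<in> edges G \<longleftrightarrow> {u, w} \<in> edges H"
  shows "G = H"
proof -
  have "e \<in> edges G \<longleftrightarrow> e \<in> edges H" for e
  proof (cases "\<exists>u w. e = {u, w}")
    case False
    then have "card e \<noteq> 2" by (auto simp: card_2_iff)
    then show ?thesis using assms(1,2) by (auto simp: simple_graph_def)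
  qed (use assms(4) in auto)
  then show ?thesis using assms(3) by (intro ugraph.equality) auto
qed

lemma two_cliques_commute: "two_cliques V A B Q = two_cliques V B A Q"
  by (simp add: two_cliques_def Un_commute)

lemma delete_two_cliques:
  "delete_verts (two_cliques V A B Q) {v} =
    two_cliques (V - {v}) (A - {v}) (B - {v}) {(x, y) \<in> Q. x \<noteq> v \<and> y \<noteq> v}"
  by (auto simp: delete_verts_def two_cliques_def complete_graph_def)

lemma complete_nbhd_two_cliques:
  assumes G: "simple_graph (two_cliques V A B Q)" and "A \<subseteq> V" "B \<subseteq> V" "Q \<subseteq> V \<times> V" "irrefl Q"
  shows "v \<in> A - B \<Longrightarrow> complete_nbhd (two_cliques V A B Q) v
      = two_cliques V (A \<union> {x. (v, x) \<in> Q \<or> (x, v) \<in> Q}) B Q"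
    and "v \<in> A \<inter> B \<Longrightarrow> complete_nbhd (two_cliques V A B Q) v
      = two_cliques V (A \<union> B \<union> {x. (v, x) \<in> Q \<or> (x, v) \<in> Q}) {} Q"
proof -
  have "finite V" using G by (simp add: simple_graph_def)
  note edge = edge_complete_nbhd_iff neighbours_iff[OF G] edge_two_cliques_iff
  show "complete_nbhd (two_cliques V A B Q) v
      = two_cliques V (A \<union> {x. (v, x) \<in> Q \<or> (x, v) \<in> Q}) B Q" if "v \<in> A - B"
  proof (rule simple_graph_eqI)
    show "simple_graph (two_cliques V (A \<union> {x. (v, x) \<in> Q \<or> (x, v) \<in> Q}) B Q)"
      using assms \<open>finite V\<close> by (intro simple_two_cliques) auto
  qed (use that G in \<open>auto simp: edge intro: simple_graph_complete_nbhd\<close>)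
  show "complete_nbhd (two_cliques V A B Q) v
      = two_cliques V (A \<union> B \<union> {x. (v, x) \<in> Q \<or> (x, v) \<in> Q}) {} Q" if "v \<in> A \<inter> B"
  proof (rule simple_graph_eqI)
    show "simple_graph (two_cliques V (A \<union> B \<union> {x. (v, x) \<in> Q \<or> (x, v) \<in> Q}) {} Q)"
      using assms \<open>finite V\<close> by (intro simple_two_cliques) auto
  qed (use that G in \<open>auto simp: edge intro: simple_graph_complete_nbhd\<close>)
qed

lemma two_cliques_drop:
  assumes "irrefl Q" "Q' \<subseteq> Q" "Q - Q' \<subseteq> A \<times> A \<union> B \<times> B"
  shows "two_cliques V A B Q = two_cliques V A B Q'"
proof -
  have "{u, w} \<in> edges (complete_graph A) \<union> edges (complete_graph B) \<union> {{u, w} | u w. (u, w) \<in> Q'}"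
    if "(u, w) \<in> Q" for u w
  proof (cases "(u, w) \<in> Q'")
    case False
    then have "u \<noteq> w" "u \<in> A \<and> w \<in> A \<or> u \<in> B \<and> w \<in> B"
      using assms that by (auto simp: irrefl_def)
    then show ?thesis by (auto simp: complete_graph_def)
  qed auto
  then have "edges (complete_graph A) \<union> edges (complete_graph B) \<union> {{u, w} | u w. (u, w) \<in> Q}
      = edges (complete_graph A) \<union> edges (complete_graph B) \<union> {{u, w} | u w. (u, w) \<in> Q'}"
    using assms(2) by blast
  then show ?thesis by (simp add: two_cliques_def)
qed

text \<open>
  The relation \<open>P\<close> attaches to some vertices of \<open>K\<close> one private leaf outside \<open>K\<close> each; \<open>V\<close> may contain
  further isolated vertices.
\<close>

definition whiskers :: "'v set \<Rightarrow> 'v set \<Rightarrow> 'v rel \<Rightarrow> bool" where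
  "whiskers V K P \<longleftrightarrow>
     finite V \<and> K \<subseteq> V \<and> P \<subseteq> K \<times> (V - K) \<and> single_valued P \<and> single_valued (P\<inverse>)"

lemma whiskersD:
  assumes "whiskers V K P"
  shows "(x, y) \<in> P \<Longrightarrow> x \<in> K \<and> x \<in> V \<and> y \<in> V \<and> y \<notin> K"
    and "(x, y) \<in> P \<Longrightarrow> (x, z) \<in> P \<Longrightarrow> y = z"
    and "(y, x) \<in> P \<Longrightarrow> (z, x) \<in> P \<Longrightarrow> y = z"
  using assms by (auto simp: whiskers_def single_valued_def)

lemma whiskers_irrefl: "whiskers V K P \<Longrightarrow> irrefl P" "whiskers V K P \<Longrightarrow> P \<subseteq> V \<times> V"
  by (auto simp: whiskers_def irrefl_def)

lemma whiskers_finite: "whiskers V K P \<Longrightarrow> finite P"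
  by (rule finite_subset[OF whiskers_irrefl(2)], assumption) (simp add: whiskers_def)

lemma whiskers_absorb:
  "whiskers V K P \<Longrightarrow> (w, l) \<in> P \<Longrightarrow> whiskers V (insert l K) (P - {(w, l)})"
  by (auto simp: whiskers_def single_valued_def)

lemma whiskers_delete_end:
  assumes "whiskers V K P" "(w, l) \<in> P"
  shows "whiskers (V - {w}) (K - {w}) (P - {(w, l)})"
proof -
  have "P - {(w, l)} \<subseteq> (K - {w}) \<times> (V - {w} - (K - {w}))"
  proof (rule subrelI)
    fix x y assume "(x, y) \<in> P - {(w, l)}"
    then show "(x, y) \<in> (K - {w}) \<times> (V - {w} - (K - {w}))"
      using whiskersD(1)[OF assms(1), of x y] whiskersD(1)[OF assms] whiskersD(2)[OF assms, of y] by auto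
  qed
  then show ?thesis using assms(1) by (auto simp: whiskers_def single_valued_def)
qed

lemma whiskers_delete:
  "whiskers V K P \<Longrightarrow> w \<in> K \<Longrightarrow> w \<notin> Domain P \<Longrightarrow> whiskers (V - {w}) (K - {w}) P"
  by (auto simp: whiskers_def single_valued_def)

lemma whiskers_filter:
  assumes "whiskers V K P"
  shows "(w, l) \<in> P \<Longrightarrow> {(x, y) \<in> P. x \<noteq> w \<and> y \<noteq> w} = P - {(w, l)}"
    and "w \<in> K \<Longrightarrow> w \<notin> Domain P \<Longrightarrow> {(x, y) \<in> P. x \<noteq> w \<and> y \<noteq> w} = P"
    and "(w, l) \<in> P \<Longrightarrow> {x. (w, x) \<in> P \<or> (x, w) \<in> P} = {l}"
    and "w \<in> K \<Longrightarrow> w \<notin> Domain P \<Longrightarrow> {x. (w, x) \<in> P \<or> (x, w) \<in> P} = {}"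
proof -
  have leaf: "(x, w) \<notin> P" if "w \<in> K" for x w using whiskersD(1)[OF assms, of x w] that by blast
  have unique: "y = l" if "(w, l) \<in> P" "(w, y) \<in> P" for w l y using whiskersD(2)[OF assms that] by simp
  have end_in: "w \<in> K" if "(w, l) \<in> P" for w l using whiskersD(1)[OF assms that] by simp
  show "{(x, y) \<in> P. x \<noteq> w \<and> y \<noteq> w} = P - {(w, l)}" if "(w, l) \<in> P"
    using that leaf[OF end_in[OF that]] by (auto dest: unique[OF that])
  show "{(x, y) \<in> P. x \<noteq> w \<and> y \<noteq> w} = P" if "w \<in> K" "w \<notin> Domain P"
    using that leaf[of w] by auto
  show "{x. (w, x) \<in> P \<or> (x, w) \<in> P} = {l}" if "(w, l) \<in> P"
    using that leaf[OF end_in[OF that]] by (auto dest: unique[OF that])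
  show "{x. (w, x) \<in> P \<or> (x, w) \<in> P} = {}" if "w \<in> K" "w \<notin> Domain P"
    using that leaf[of w] by auto
qed

lemma simple_whiskered:
  assumes "whiskers V (A \<union> B) P" "M \<subseteq> (A - B) \<times> (B - A)"
  shows "simple_graph (two_cliques V A B (M \<union> P))"
  using assms by (intro simple_two_cliques) (auto simp: whiskers_def irrefl_def)

lemma connectedI:
  "simple_graph G \<Longrightarrow> u \<in> verts G \<Longrightarrow> u = w \<or> {u, w} \<in> edges G \<Longrightarrow> (u, w) \<in> connected_rel G"
  using connected_rel_refl edge_connected by metis

text \<open>
  Deleting the vertex \<open>w\<close> of a whisker isolates its leaf \<open>l\<close> and leaves the other neighbours together.
\<close>

lemma card_components_whisker:
  assumes G: "simple_graph G" and wl: "{w, l} \<in> edges G" and leaf: "\<And>x. {l, x} \<in> edges G \<Longrightarrow> x = w"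
    and a: "{w, a} \<in> edges G" "a \<noteq> l"
    and conn: "\<And>x. {w, x} \<in> edges G \<Longrightarrow> x \<noteq> l \<Longrightarrow> (a, x) \<in> connected_rel (delete_verts G {w})"
  shows "card (components (delete_verts G {w})) = Suc (card (components G))"
proof (rule card_components_split[OF G, of w "neighbours G w - {l}" "{l}" a l])
  show "w \<in> verts G" using edge_vertices[OF G wl] by simp
  show "neighbours G w = neighbours G w - {l} \<union> {l}" using wl by (auto simp: neighbours_iff[OF G])
  show "(l, x) \<in> connected_rel (delete_verts G {w})" if "x \<in> {l}" for x
    using that edge_vertices[OF G wl] by (auto intro: connected_rel_refl)
  show "(a, l) \<notin> connected_rel (delete_verts G {w})"
  proof
    assume "(a, l) \<in> connected_rel (delete_verts G {w})"
    then obtain x where "{x, l} \<in> edges (delete_verts G {w})"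
      using isolated_or_neighbour[OF simple_graph_delete_verts[OF G]] a(2) by blast
    then show False using leaf[of x] by (simp add: insert_commute)
  qed
qed (use a conn in \<open>auto simp: neighbours_iff[OF G]\<close>)

lemma connected_closed:
  assumes "(u, w) \<in> connected_rel G" "u \<in> S" "\<And>x y. x \<in> S \<Longrightarrow> {x, y} \<in> edges G \<Longrightarrow> y \<in> S"
  shows "w \<in> S"
proof -
  have "(u, w) \<in> (adjacency G)\<^sup>*" using assms(1) by (simp add: connected_rel_def)
  then show ?thesis using assms(2,3) by induction auto
qed

lemma disjoint_cliques_not_connected:
  assumes P: "whiskers V (A \<union> B) P" and "A \<inter> B = {}" "a \<in> A" "b \<in> B"
  shows "(a, b) \<notin> connected_rel (two_cliques V A B P)"
proof
  assume "(a, b) \<in> connected_rel (two_cliques V A B P)"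
  then have "b \<in> A \<union> P `` A"
  proof (rule connected_closed)
    fix x y assume "x \<in> A \<union> P `` A" "{x, y} \<in> edges (two_cliques V A B P)"
    then show "y \<in> A \<union> P `` A"
      using whiskersD[OF P] assms(2) unfolding edge_two_cliques_iff by blast
  qed (use assms in simp)
  then show False using assms by (auto simp: whiskers_def)
qed

text \<open>
  Cut at a whiskered vertex \<open>w\<close>: its leaf is either isolated or absorbed into the clique, so that one
  whisker disappears in all three graphs. If \<open>w\<close> is alone in its clique, it is no cut vertex, but then
  the whisker itself may be regarded as the clique.
\<close>

lemma disjoint_cliques_splittable:
  assumes "whiskers V (A \<union> B) P" "A \<inter> B = {}"
  shows "splittable (two_cliques V A B P)"
  using assms
proof (induction "card P" arbitrary: V A B P)
  case 0
  then have P: "P = {}" using whiskers_finite[OF 0(2)] by simp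
  let ?G = "two_cliques V A B P"
  have "u = w \<or> {u, w} \<in> edges ?G" if "(u, w) \<in> connected_rel ?G" for u w
  proof -
    have "(u, w) \<in> (adjacency ?G)\<^sup>*" using that by (simp add: connected_rel_def)
    then show ?thesis
      by induction (use 0 P in \<open>auto simp: edge_two_cliques_iff\<close>)
  qed
  moreover have "(u, w) \<in> connected_rel ?G" if "C \<in> components ?G" "u \<in> C" "w \<in> C" for C u w
    using that by (auto simp: components_def elim!: quotientE intro: connected_rel_trans connected_rel_sym)
  ultimately have "all_components_complete ?G"
    unfolding all_components_complete_def by blast
  then show ?case by (rule splittable.complete)
next
  case (Suc n)
  have step: "splittable (two_cliques V A B P)"
    if P: "whiskers V (A \<union> B) P" "A \<inter> B = {}" and wl: "(w, l) \<in> P" "w \<in> A" for A B w l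
  proof -
    have IH: "splittable (two_cliques V' A' B' (P - {(w, l)}))"
      if "whiskers V' (A' \<union> B') (P - {(w, l)})" "A' \<inter> B' = {}" for V' A' B'
      using Suc.hyps(2) wl(1) whiskers_finite[OF P(1)] that by (intro Suc.hyps(1)) auto
    let ?G = "two_cliques V A B P"
    have G: "simple_graph ?G" using simple_whiskered[OF P(1), of "{}"] by simp
    have sets: "A \<subseteq> V" "B \<subseteq> V" "l \<notin> A" "l \<notin> B" "w \<notin> B" using P wl by (auto simp: whiskers_def)
    note filter = whiskers_filter(1,3)[OF P(1) wl(1)]
    have absorb: "whiskers V (insert l A \<union> B) (P - {(w, l)})"
      using whiskers_absorb[OF P(1) wl(1)] by simp
    have nbhd: "two_cliques V (insert l A) B P = two_cliques V (insert l A) B (P - {(w, l)})"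
      using wl by (intro two_cliques_drop whiskers_irrefl[OF P(1)]) auto
    show ?thesis
    proof (cases "A = {w}")
      case True
      have "two_cliques V A B P = two_cliques V (insert l A) B P"
        using True wl(1) by (auto simp: two_cliques_def complete_graph_def)
      then show ?thesis using IH[OF absorb] nbhd P(2) sets by auto
    next
      case False
      then obtain a where a: "a \<in> A" "a \<noteq> w" using wl(2) by blast
      have Gv: "complete_nbhd ?G w = two_cliques V (insert l A) B (P - {(w, l)})"
        using complete_nbhd_two_cliques(1)[OF G sets(1,2) whiskers_irrefl(2,1)[OF P(1)], of w] wl sets
        by (simp add: filter nbhd)
      have Gd: "delete_verts ?G {w} = two_cliques (V - {w}) (A - {w}) B (P - {(w, l)})"
        using delete_two_cliques[of _ _ _ _ w] sets by (simp add: filter)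
      have filter': "{(x, y) \<in> P - {(w, l)}. x \<noteq> w \<and> y \<noteq> w} = P - {(w, l)}"
        using filter(1) by auto
      have Gvd: "delete_verts (complete_nbhd ?G w) {w} = two_cliques (V - {w}) (insert l A - {w}) B (P - {(w, l)})"
        unfolding Gv delete_two_cliques filter' using sets by simp
      show ?thesis
      proof (rule splittable.split[of w])
        show "w \<in> verts ?G" using sets wl by auto
        show "card (components (delete_verts ?G {w})) = Suc (card (components ?G))"
        proof (rule card_components_whisker[OF G, of w l a])
          show "x = w" if "{l, x} \<in> edges ?G" for x
            using that sets whiskersD(1)[OF P(1), of l x] whiskersD(3)[OF P(1) wl(1), of x]
            unfolding edge_two_cliques_iff by blast
          show "(a, x) \<in> connected_rel (delete_verts ?G {w})" if "{w, x} \<in> edges ?G" "x \<noteq> l" for x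
          proof -
            have "x \<in> A - {w}"
              using that wl sets filter(2) by (auto simp: edge_two_cliques_iff)
            then show ?thesis
              using a sets
              by (intro connectedI simple_graph_delete_verts[OF G]) (auto simp: edge_two_cliques_iff)
          qed
        qed (use wl a sets in \<open>auto simp: edge_two_cliques_iff\<close>)
        show "splittable (delete_verts ?G {w})"
          unfolding Gd
        proof (rule IH)
          have "A - {w} \<union> B = A \<union> B - {w}" using sets by auto
          then show "whiskers (V - {w}) (A - {w} \<union> B) (P - {(w, l)})"
            using whiskers_delete_end[OF P(1) wl(1)] by (simp only:)
        qed (use P(2) in auto)
        show "splittable (complete_nbhd ?G w)"
          unfolding Gv using sets P(2) by (intro IH absorb) auto
        show "splittable (delete_verts (complete_nbhd ?G w) {w})"
          unfolding Gvd
        proof (rule IH)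
          have "w \<notin> Domain (P - {(w, l)})" using whiskersD(2)[OF P(1) wl(1)] by blast
          then have "whiskers (V - {w}) (insert l A \<union> B - {w}) (P - {(w, l)})"
            using wl by (intro whiskers_delete absorb) auto
          moreover have "insert l A \<union> B - {w} = insert l A - {w} \<union> B" using sets by auto
          ultimately show "whiskers (V - {w}) (insert l A - {w} \<union> B) (P - {(w, l)})"
            by (simp only:)
        qed (use sets P(2) in auto)
      qed
    qed
  qed
  have "P \<noteq> {}" using Suc.hyps(2) by auto
  then obtain w l where wl: "(w, l) \<in> P" by auto
  then consider "w \<in> A" | "w \<in> B" using whiskersD(1)[OF Suc.prems(1) wl] by blast
  then show ?case
  proof cases
    case 1
    then show ?thesis using step[OF Suc.prems wl] by simp
  next
    case 2
    have "whiskers V (B \<union> A) P" "B \<inter> A = {}" using Suc.prems by (simp_all add: Un_commute Int_commute)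
    from step[OF this wl 2] show ?thesis by (subst two_cliques_commute)
  qed
qed

text \<open>
  Cutting at the shared vertex separates the cliques, completing its neighbourhood fuses them. If one
  clique is just the shared vertex, there is only one clique to begin with.
\<close>

lemma shared_vertex_splittable:
  assumes P: "whiskers V (A \<union> B) P" and s: "A \<inter> B = {s}" "s \<notin> Domain P"
  shows "splittable (two_cliques V A B P)"
proof -
  have one: "splittable (two_cliques V {s} B P)" if "whiskers V B P" for B
  proof -
    have "two_cliques V {s} B P = two_cliques V {} B P" by (auto simp: two_cliques_def complete_graph_def)
    then show ?thesis using disjoint_cliques_splittable[of V "{}" B P] that by simp
  qed
  let ?G = "two_cliques V A B P"
  have sets: "A \<subseteq> V" "B \<subseteq> V" "s \<in> A" "s \<in> B" using P s by (auto simp: whiskers_def)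
  consider "A = {s}" | "B = {s}" | a b where "a \<in> A - {s}" "b \<in> B - {s}" using sets by blast
  then show ?thesis
  proof cases
    case 1
    then show ?thesis using one[of B] P sets by (simp add: insert_absorb)
  next
    case 2
    then show ?thesis using one[of A] P sets by (simp add: insert_absorb two_cliques_commute[of V A])
  next
    case 3
    have G: "simple_graph ?G" using simple_whiskered[OF P, of "{}"] by simp
    have Gd: "delete_verts ?G {s} = two_cliques (V - {s}) (A - {s}) (B - {s}) P"
      using delete_two_cliques[of _ _ _ _ s] whiskers_filter(2)[OF P, of s] s sets by simp
    have Gv: "complete_nbhd ?G s = two_cliques V (A \<union> B) {} P"
      using complete_nbhd_two_cliques(2)[OF G sets(1,2) whiskers_irrefl(2,1)[OF P], of s]
        whiskers_filter(4)[OF P, of s] s sets by simp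
    have Gvd: "delete_verts (complete_nbhd ?G s) {s} = two_cliques (V - {s}) (A \<union> B - {s}) {} P"
      unfolding Gv using delete_two_cliques[of _ _ _ _ s] whiskers_filter(2)[OF P, of s] s sets by simp
    have P': "whiskers (V - {s}) (A \<union> B - {s}) P" using s sets by (intro whiskers_delete[OF P]) auto
    have P'': "whiskers (V - {s}) ((A - {s}) \<union> (B - {s})) P" using P' by (simp only: Un_Diff)
    show ?thesis
    proof (rule splittable.split[of s])
      show "s \<in> verts ?G" using sets by auto
      show "card (components (delete_verts ?G {s})) = Suc (card (components ?G))"
      proof (rule card_components_split[OF G, of s "A - {s}" "B - {s}" a b])
        show "neighbours ?G s = A - {s} \<union> (B - {s})"
          using sets whiskers_filter(4)[OF P _ s(2)] edge_vertices(3)[OF G, of s s]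
          by (auto simp: neighbours_iff[OF G] edge_two_cliques_iff)
        show "(a, x) \<in> connected_rel (delete_verts ?G {s})" if "x \<in> A - {s}" for x
          using that 3 sets by (intro connectedI simple_graph_delete_verts[OF G]) (auto simp: edge_two_cliques_iff)
        show "(b, x) \<in> connected_rel (delete_verts ?G {s})" if "x \<in> B - {s}" for x
          using that 3 sets by (intro connectedI simple_graph_delete_verts[OF G]) (auto simp: edge_two_cliques_iff)
        show "(a, b) \<notin> connected_rel (delete_verts ?G {s})"
          unfolding Gd using 3 s by (intro disjoint_cliques_not_connected P'') auto
      qed (use 3 sets in auto)
      show "splittable (delete_verts ?G {s})"
        unfolding Gd using s by (intro disjoint_cliques_splittable P'') auto
      show "splittable (complete_nbhd ?G s)"
        unfolding Gv using P by (intro disjoint_cliques_splittable) auto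
      show "splittable (delete_verts (complete_nbhd ?G s) {s})"
        unfolding Gvd using P' by (intro disjoint_cliques_splittable) auto
    qed
  qed
qed

text \<open>
  Completing the neighbourhood of the end \<open>a\<close> of the bridge pulls \<open>b\<close> into the clique of \<open>a\<close>, which
  makes \<open>b\<close> a shared vertex. If \<open>a\<close> is alone in its clique, the bridge itself may be regarded as the
  clique.
\<close>

lemma bridged_cliques_splittable:
  assumes P: "whiskers V (A \<union> B) P" and "A \<inter> B = {}"
    and ab: "a \<in> A" "b \<in> B" "a \<notin> Domain P" "b \<notin> Domain P"
  shows "splittable (two_cliques V A B (insert (a, b) P))"
proof -
  let ?Q = "insert (a, b) P"
  let ?G = "two_cliques V A B ?Q"
  have sets: "A \<subseteq> V" "B \<subseteq> V" "a \<notin> B" "b \<notin> A" "a \<noteq> b"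
    using P assms(2) ab by (auto simp: whiskers_def)
  have Q: "?Q \<subseteq> V \<times> V" "irrefl ?Q"
    using whiskers_irrefl[OF P] sets ab by (auto simp: irrefl_def)
  have drop: "two_cliques V (insert b A) B ?Q = two_cliques V (insert b A) B P"
    using ab by (intro two_cliques_drop Q) auto
  have P1: "whiskers V (insert b A \<union> B) P" using P ab by (simp add: insert_absorb)
  show ?thesis
  proof (cases "A = {a}")
    case True
    have "edges (complete_graph {a}) = {}" "edges (complete_graph {b, a}) = {{a, b}}"
      using sets by (auto simp: complete_graph_def)
    moreover have "{{u, w} | u w. (u, w) \<in> ?Q} = insert {a, b} {{u, w} | u w. (u, w) \<in> P}" by blast
    ultimately have "?G = two_cliques V (insert b A) B P"
      using True by (simp add: two_cliques_def)
    then show ?thesis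
      using shared_vertex_splittable[OF P1, of b] ab sets assms(2) by auto
  next
    case False
    then obtain a' where a': "a' \<in> A - {a}" using ab by blast
    have G: "simple_graph ?G"
      using simple_whiskered[OF P, of "{(a, b)}"] ab sets by simp
    have filter: "{(x, y) \<in> ?Q. x \<noteq> a \<and> y \<noteq> a} = P" "{x. (a, x) \<in> ?Q \<or> (x, a) \<in> ?Q} = {b}"
      "{(x, y) \<in> P. x \<noteq> a \<and> y \<noteq> a} = P"
      using whiskers_filter(2,4)[OF P, of a] ab sets by auto
    have Gd: "delete_verts ?G {a} = two_cliques (V - {a}) (A - {a}) B P"
      using delete_two_cliques[of _ _ _ _ a] filter(1) sets by simp
    have Gv: "complete_nbhd ?G a = two_cliques V (insert b A) B P"
      using complete_nbhd_two_cliques(1)[OF G sets(1,2) Q, of a] filter(2) ab sets drop by simp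
    have Gvd: "delete_verts (complete_nbhd ?G a) {a} = two_cliques (V - {a}) (insert b A - {a}) B P"
      unfolding Gv using delete_two_cliques[of _ _ _ _ a] filter(3) sets by simp
    have P': "whiskers (V - {a}) (A \<union> B - {a}) P" using ab by (intro whiskers_delete[OF P]) auto
    have "A - {a} \<union> B = A \<union> B - {a}" "(insert b A - {a}) \<union> B = A \<union> B - {a}" using sets ab by auto
    then have P2: "whiskers (V - {a}) (A - {a} \<union> B) P" "whiskers (V - {a}) ((insert b A - {a}) \<union> B) P"
      using P' by simp_all
    show ?thesis
    proof (rule splittable.split[of a])
      show "a \<in> verts ?G" using sets ab by auto
      show "card (components (delete_verts ?G {a})) = Suc (card (components ?G))"
      proof (rule card_components_split[OF G, of a "A - {a}" "{b}" a' b])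
        show "neighbours ?G a = A - {a} \<union> {b}"
          using sets ab filter(2) edge_vertices(3)[OF G, of a a]
          by (auto simp: neighbours_iff[OF G] edge_two_cliques_iff)
        show "(a', x) \<in> connected_rel (delete_verts ?G {a})" if "x \<in> A - {a}" for x
          using that a' sets by (intro connectedI simple_graph_delete_verts[OF G]) (auto simp: edge_two_cliques_iff)
        show "(b, x) \<in> connected_rel (delete_verts ?G {a})" if "x \<in> {b}" for x
          using that subsetD[OF sets(2) ab(2)] sets by (simp add: connected_rel_refl)
        show "(a', b) \<notin> connected_rel (delete_verts ?G {a})"
          unfolding Gd using a' ab assms(2) by (intro disjoint_cliques_not_connected P2) auto
      qed (use a' ab sets in auto)
      show "splittable (delete_verts ?G {a})"
        unfolding Gd using assms(2) by (intro disjoint_cliques_splittable P2) auto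
      show "splittable (complete_nbhd ?G a)"
        unfolding Gv using ab assms(2) by (intro shared_vertex_splittable[OF P1, of b]) auto
      show "splittable (delete_verts (complete_nbhd ?G a) {a})"
        unfolding Gvd using ab sets assms(2) by (intro shared_vertex_splittable[OF P2(2), of b]) auto
    qed
  qed
qed

definition matching_between :: "'v set \<Rightarrow> 'v set \<Rightarrow> 'v rel \<Rightarrow> bool" where
  "matching_between A B M \<longleftrightarrow> M \<subseteq> (A - B) \<times> (B - A) \<and> single_valued M \<and> single_valued (M\<inverse>)"

text \<open>
  All links between the cliques, except the edge from \<open>a0\<close> to \<open>b0\<close>, have whiskers at all their
  vertices. Cutting at such a vertex therefore splits off just its leaf, because that edge holds the two
  cliques together. Shared vertices are treated first: their neighbourhood contains both
  cliques, and completing it fuses them. Without shared vertices, a matching edge from \<open>a\<close>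
  to \<open>b\<close> is cut at \<open>a\<close>; completing turns \<open>b\<close> into a shared vertex, whose own whisker is
  still there. The number of whiskers decreases each time, and in the end the bridge is left.
\<close>

lemma matched_cliques_splittable:
  assumes "whiskers V (A \<union> B) P" "matching_between A B M"
    and "(a0, b0) \<in> M" "a0 \<notin> Domain P" "b0 \<notin> Domain P"
    and "A \<inter> B \<subseteq> Domain P" "\<And>a b. (a, b) \<in> M \<Longrightarrow> (a, b) \<noteq> (a0, b0) \<Longrightarrow> a \<in> Domain P \<and> b \<in> Domain P"
  shows "splittable (two_cliques V A B (M \<union> P))"
  using assms
proof (induction "card P" arbitrary: V A B P M rule: less_induct)
  case less
  note P = less.prems(1) and M = less.prems(2) and a0b0 = less.prems(3-5)
    and shared = less.prems(6) and matched = less.prems(7)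
  let ?G = "two_cliques V A B (M \<union> P)"
  have M_sub: "M \<subseteq> (A - B) \<times> (B - A)" using M by (simp add: matching_between_def)
  have M_unique: "y = z" if "(x, y) \<in> M" "(x, z) \<in> M" for x y z
    using M that by (auto simp: matching_between_def single_valued_def)
  have M_unique': "y = z" if "(y, x) \<in> M" "(z, x) \<in> M" for x y z
    using M that by (auto simp: matching_between_def single_valued_def)
  have M_ends: "x \<in> A \<and> x \<notin> B \<and> y \<in> B \<and> y \<notin> A" if "(x, y) \<in> M" for x y using that M_sub by auto
  have sets: "A \<subseteq> V" "B \<subseteq> V" "a0 \<in> A" "b0 \<in> B" "a0 \<notin> B" "b0 \<notin> A"
    using P M_ends[OF a0b0(1)] by (auto simp: whiskers_def)
  have G: "simple_graph ?G" by (rule simple_whiskered[OF P M_sub])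
  have Q: "M \<union> P \<subseteq> V \<times> V" "irrefl (M \<union> P)"
    using whiskers_irrefl[OF P] M_sub sets by (auto simp: irrefl_def)
  have smaller: "card (P - {p}) < card P" if "p \<in> P" for p
    using that whiskers_finite[OF P] by (rule card_Diff1_less[rotated])
  have connected: "(u, v) \<in> connected_rel (delete_verts ?G {w})"
    if "u \<in> A \<union> B - {w}" "v \<in> A \<union> B - {w}" "w \<noteq> a0" "w \<noteq> b0" for u v w
  proof -
    have conn: "(x, y) \<in> connected_rel (delete_verts ?G {w})"
      if "x \<in> V - {w}" "y \<noteq> w" "x = y \<or> {x, y} \<in> edges ?G" for x y
      using that by (intro connectedI simple_graph_delete_verts[OF G]) auto
    have "(a0, x) \<in> connected_rel (delete_verts ?G {w})" if "x \<in> A \<union> B - {w}" for x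
    proof (cases "x \<in> A")
      case True
      then show ?thesis
        using that sets \<open>w \<noteq> a0\<close> by (intro conn) (auto simp: edge_two_cliques_iff)
    next
      case False
      then have "(b0, x) \<in> connected_rel (delete_verts ?G {w})"
        using that sets \<open>w \<noteq> b0\<close> by (intro conn) (auto simp: edge_two_cliques_iff)
      moreover have "(a0, b0) \<in> connected_rel (delete_verts ?G {w})"
        using sets \<open>w \<noteq> a0\<close> \<open>w \<noteq> b0\<close> a0b0(1) by (intro conn) (auto simp: edge_two_cliques_iff)
      ultimately show ?thesis using connected_rel_trans by metis
    qed
    then show ?thesis using that connected_rel_sym connected_rel_trans by metis
  qed
  have split_off: "card (components (delete_verts ?G {w})) = Suc (card (components ?G))"
    if wl: "(w, l) \<in> P" for w l
  proof -
    have w: "w \<in> A \<union> B" "w \<noteq> a0" "w \<noteq> b0" "l \<notin> A \<union> B" using whiskersD(1)[OF P wl] wl a0b0 by auto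
    \<comment> \<open>A neighbour of \<open>w\<close> that survives and reaches both cliques, taken from the unwhiskered edge.\<close>
    define a where "a = (if w \<in> A then a0 else b0)"
    have a: "a \<in> A \<union> B" "a \<noteq> w" "{w, a} \<in> edges ?G" "a \<noteq> l"
      using w sets by (auto simp: a_def edge_two_cliques_iff)
    show ?thesis
    proof (rule card_components_whisker[OF G _ _ a(3,4)])
      show "{w, l} \<in> edges ?G" using wl by (simp add: edge_two_cliques_iff)
      show "x = w" if "{l, x} \<in> edges ?G" for x
        using that w(4) M_ends[of l x] M_ends[of x l] whiskersD(1)[OF P, of l x] whiskersD(3)[OF P wl, of x]
        unfolding edge_two_cliques_iff by blast
      show "(a, x) \<in> connected_rel (delete_verts ?G {w})" if "{w, x} \<in> edges ?G" "x \<noteq> l" for x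
      proof -
        have "x \<noteq> w" using edge_vertices[OF G that(1)] by simp
        moreover have "x \<in> A \<union> B"
          using that whiskers_filter(3)[OF P wl] M_ends[of w x] M_ends[of x w] unfolding edge_two_cliques_iff by blast
        ultimately show ?thesis using connected[of a w x] a w by simp
      qed
    qed
  qed
  show ?case
  proof (cases "A \<inter> B = {}")
    case False
    then obtain w where w: "w \<in> A" "w \<in> B" by blast
    then obtain l where wl: "(w, l) \<in> P" using shared by blast
    let ?P = "P - {(w, l)}"
    have l: "l \<notin> A" "l \<notin> B" "w \<noteq> l" using whiskersD(1)[OF P wl] by auto
    have M_w: "x \<noteq> w \<and> y \<noteq> w" if "(x, y) \<in> M" for x y using M_ends[OF that] w by auto
    have filter: "{(x, y) \<in> M \<union> P. x \<noteq> w \<and> y \<noteq> w} = M \<union> ?P"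
        "{x. (w, x) \<in> M \<union> P \<or> (x, w) \<in> M \<union> P} = {l}" "{(x, y) \<in> ?P. x \<noteq> w \<and> y \<noteq> w} = ?P"
      using whiskers_filter(1,3)[OF P wl] M_w by auto
    have Gd: "delete_verts ?G {w} = two_cliques (V - {w}) (A - {w}) (B - {w}) (M \<union> ?P)"
      using delete_two_cliques[of _ _ _ _ w] filter(1) by simp
    have absorb: "whiskers V (insert l (A \<union> B)) ?P" by (rule whiskers_absorb[OF P wl])
    have drop: "two_cliques V (insert l (A \<union> B)) {} (M \<union> P) = two_cliques V (insert l (A \<union> B)) {} ?P"
      using M_ends w by (intro two_cliques_drop Q) auto
    have Gv: "complete_nbhd ?G w = two_cliques V (insert l (A \<union> B)) {} ?P"
      using complete_nbhd_two_cliques(2)[OF G sets(1,2) Q, of w] filter(2) w drop by simp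
    have Gvd: "delete_verts (complete_nbhd ?G w) {w} = two_cliques (V - {w}) (insert l (A \<union> B) - {w}) {} ?P"
      unfolding Gv using delete_two_cliques[of _ _ _ _ w] filter(3) by simp
    show ?thesis
    proof (rule splittable.split[of w])
      show "w \<in> verts ?G" using w sets by auto
      show "card (components (delete_verts ?G {w})) = Suc (card (components ?G))"
        by (rule split_off[OF wl])
      show "splittable (delete_verts ?G {w})"
        unfolding Gd
      proof (rule less.hyps)
        show "card ?P < card P" by (rule smaller[OF wl])
        show "whiskers (V - {w}) (A - {w} \<union> (B - {w})) ?P"
          using whiskers_delete_end[OF P wl] by (simp only: Un_Diff)
        show "matching_between (A - {w}) (B - {w}) M"
          using M M_w unfolding matching_between_def by blast
        show "(a0, b0) \<in> M" "a0 \<notin> Domain ?P" "b0 \<notin> Domain ?P" using a0b0 by auto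
        show "(A - {w}) \<inter> (B - {w}) \<subseteq> Domain ?P" using shared by auto
        show "a \<in> Domain ?P \<and> b \<in> Domain ?P" if "(a, b) \<in> M" "(a, b) \<noteq> (a0, b0)" for a b
          using matched[OF that] M_w[OF that(1)] by auto
      qed
      show "splittable (complete_nbhd ?G w)"
        unfolding Gv using absorb by (intro disjoint_cliques_splittable) auto
      have "w \<notin> Domain ?P" using whiskersD(2)[OF P wl] by blast
      then have "whiskers (V - {w}) (insert l (A \<union> B) - {w}) ?P"
        using w by (intro whiskers_delete absorb) auto
      then show "splittable (delete_verts (complete_nbhd ?G w) {w})"
        unfolding Gvd by (intro disjoint_cliques_splittable) auto
    qed
  next
    case disjoint: True
    show ?thesis
    proof (cases "M = {(a0, b0)}")
      case True
      then show ?thesis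
        using bridged_cliques_splittable[OF P disjoint] sets a0b0 by simp
    next
      case False
      then obtain a b where ab: "(a, b) \<in> M" "(a, b) \<noteq> (a0, b0)" using a0b0 by auto
      then obtain l where al: "(a, l) \<in> P" and b_dom: "b \<in> Domain P" using matched by blast
      let ?P = "P - {(a, l)}" and ?M = "M - {(a, b)}"
      have ends: "a \<in> A" "b \<in> B" "a \<notin> B" "b \<notin> A" "a \<noteq> b" using M_ends[OF ab(1)] by auto
      have l: "l \<in> V" "l \<notin> A" "l \<notin> B" "a \<noteq> l" using whiskersD(1)[OF P al] by auto
      have M_a: "x \<noteq> a \<and> y \<noteq> a \<and> y \<noteq> b" if "(x, y) \<in> ?M" for x y
        using that M_ends[of x y] ends by (auto dest: M_unique[OF ab(1)] M_unique'[OF ab(1)])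
      have M_iff: "x \<noteq> a \<and> y \<noteq> a \<longleftrightarrow> (x, y) \<noteq> (a, b)" if "(x, y) \<in> M" for x y
        using M_a[of x y] that by blast
      have M_in: "(x, a) \<notin> M" for x using M_ends[of x a] ends by blast
      have "{(x, y) \<in> M. x \<noteq> a \<and> y \<noteq> a} = ?M" using M_iff by auto
      then have filter1: "{(x, y) \<in> M \<union> P. x \<noteq> a \<and> y \<noteq> a} = ?M \<union> ?P"
        using whiskers_filter(1)[OF P al] by blast
      have "{x. (a, x) \<in> M \<or> (x, a) \<in> M} = {b}"
        using ab(1) M_in by (auto dest: M_unique[OF ab(1)])
      then have filter2: "{x. (a, x) \<in> M \<union> P \<or> (x, a) \<in> M \<union> P} = {b, l}"
        using whiskers_filter(3)[OF P al] by blast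
      have filter3: "{(x, y) \<in> ?M \<union> ?P. x \<noteq> a \<and> y \<noteq> a} = ?M \<union> ?P"
        unfolding filter1[symmetric] by auto
      note filter = filter1 filter2 filter3
      let ?A = "insert b (insert l A)"
      have Gd: "delete_verts ?G {a} = two_cliques (V - {a}) (A - {a}) B (?M \<union> ?P)"
        using delete_two_cliques[of _ _ _ _ a] filter(1) ends by simp
      have drop: "two_cliques V ?A B (M \<union> P) = two_cliques V ?A B (?M \<union> ?P)"
        using ends by (intro two_cliques_drop Q) auto
      have "A \<union> {b, l} = ?A" by auto
      then have Gv: "complete_nbhd ?G a = two_cliques V ?A B (?M \<union> ?P)"
        using complete_nbhd_two_cliques(1)[OF G sets(1,2) Q, of a] filter(2) ends drop by simp
      have absorb: "whiskers V (?A \<union> B) ?P"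
        using whiskers_absorb[OF P al] ends by (simp add: insert_absorb)
      have sub_matching: "matching_between C B ?M"
        if "\<And>x. x \<in> A \<Longrightarrow> x \<noteq> a \<Longrightarrow> x \<in> C" "C \<subseteq> ?A" for C
        unfolding matching_between_def
      proof (intro conjI)
        show "?M \<subseteq> (C - B) \<times> (B - C)"
        proof (rule subrelI)
          fix x y assume xy: "(x, y) \<in> ?M"
          then show "(x, y) \<in> (C - B) \<times> (B - C)"
            using M_a[OF xy] M_ends[of x y] l that by auto
        qed
      qed (use M in \<open>auto simp: matching_between_def single_valued_def\<close>)
      have M': "matching_between ?A B ?M" by (rule sub_matching) auto
      have Gvd: "delete_verts (complete_nbhd ?G a) {a} = two_cliques (V - {a}) (?A - {a}) B (?M \<union> ?P)"
        unfolding Gv using delete_two_cliques[of _ _ _ _ a] filter(3) ends by simp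
      have link: "(a0, b0) \<in> ?M" "a0 \<notin> Domain ?P" "b0 \<notin> Domain ?P" using a0b0 ab by auto
      have matched': "x \<in> Domain ?P \<and> y \<in> Domain ?P" if "(x, y) \<in> ?M" "(x, y) \<noteq> (a0, b0)" for x y
        using matched[of x y] that M_a[OF that(1)] by auto
      have b_dom': "b \<in> Domain ?P" using b_dom ends by auto
      note IH = less.hyps[OF smaller[OF al] _ _ link _ matched']
      show ?thesis
      proof (rule splittable.split[of a])
        show "a \<in> verts ?G" using ends sets by auto
        show "card (components (delete_verts ?G {a})) = Suc (card (components ?G))"
          by (rule split_off[OF al])
        show "splittable (delete_verts ?G {a})"
          unfolding Gd
        proof (rule IH)
          have "A - {a} \<union> B = A \<union> B - {a}" using ends by auto
          then show "whiskers (V - {a}) (A - {a} \<union> B) ?P"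
            using whiskers_delete_end[OF P al] by (simp only:)
          show "matching_between (A - {a}) B ?M"
            by (rule sub_matching) auto
          show "(A - {a}) \<inter> B \<subseteq> Domain ?P" using disjoint by auto
        qed
        show "splittable (complete_nbhd ?G a)"
          unfolding Gv
        proof (rule IH[OF absorb M'])
          show "?A \<inter> B \<subseteq> Domain ?P" using disjoint l b_dom' by auto
        qed
        show "splittable (delete_verts (complete_nbhd ?G a) {a})"
          unfolding Gvd
        proof (rule IH)
          have "a \<notin> Domain ?P" using whiskersD(2)[OF P al] by blast
          then have "whiskers (V - {a}) (?A \<union> B - {a}) ?P"
            using ends by (intro whiskers_delete[OF absorb]) auto
          moreover have "?A \<union> B - {a} = ?A - {a} \<union> B" using ends by auto
          ultimately show "whiskers (V - {a}) (?A - {a} \<union> B) ?P" by (simp only:)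
          show "matching_between (?A - {a}) B ?M"
            by (rule sub_matching) auto
          show "(?A - {a}) \<inter> B \<subseteq> Domain ?P" using disjoint l b_dom' by auto
        qed
      qed
    qed
  qed
qed

lemma star_product_bar_two_cliques:
  "star_product_bar m n r =
     two_cliques (verts (star_product_bar m n r)) (X ` {1..m}) (Y ` {1..n})
       ((\<lambda>i. (X i, Y i)) ` {1..r} \<union> ((\<lambda>i. (X i, FX i)) ` {2..r} \<union> (\<lambda>i. (Y i, FY i)) ` {2..r}))"
proof -
  have image: "{{u, w} | u w. (u, w) \<in> (\<lambda>i. (f i, g i)) ` I} = {{f i, g i} | i. i \<in> I}"
    for f g :: "nat \<Rightarrow> star_vertex" and I by auto
  have union: "{{u, w} | u w. (u, w) \<in> Q \<union> R} = {{u, w} | u w. (u, w) \<in> Q} \<union> {{u, w} | u w. (u, w) \<in> R}"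
    for Q R :: "star_vertex rel" by blast
  show ?thesis
    unfolding two_cliques_def union image
    by (simp add: star_product_bar_def star_product_def Let_def Un_assoc)
qed

lemma star_product_bar_splittable:
  assumes "0 < r" "r \<le> m" "r \<le> n"
  shows "splittable (star_product_bar m n r)"
proof -
  let ?V = "verts (star_product_bar m n r)"
  let ?M = "(\<lambda>i. (X i, Y i)) ` {1..r}"
  let ?P = "(\<lambda>i. (X i, FX i)) ` {2..r} \<union> (\<lambda>i. (Y i, FY i)) ` {2..r}"
  have V: "?V = X ` {1..m} \<union> Y ` {1..n} \<union> FX ` {2..r} \<union> FY ` {2..r}"
    by (simp add: star_product_bar_def star_product_def complete_graph_def Let_def)
  have "splittable (two_cliques ?V (X ` {1..m}) (Y ` {1..n}) (?M \<union> ?P))"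
  proof (rule matched_cliques_splittable[of _ _ _ _ _ "X 1" "Y 1"])
    show "whiskers ?V (X ` {1..m} \<union> Y ` {1..n}) ?P"
      unfolding V whiskers_def using assms by (auto simp: single_valued_def)
    show "matching_between (X ` {1..m}) (Y ` {1..n}) ?M"
      unfolding matching_between_def using assms by (auto simp: single_valued_def)
    show "a \<in> Domain ?P \<and> b \<in> Domain ?P" if ab: "(a, b) \<in> ?M" "(a, b) \<noteq> (X 1, Y 1)" for a b
    proof -
      obtain i where "i \<in> {1..r}" "a = X i" "b = Y i" using ab(1) by auto
      moreover from this have "i \<in> {2..r}" using ab(2) by (cases "i = 1") auto
      ultimately show ?thesis by blast
    qed
  qed (use assms in auto)
  then show ?thesis by (simp only: star_product_bar_two_cliques[symmetric])
qed

theorem theorem4p3: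
  fixes m n r :: nat
  assumes "0 < m" and "0 < n" and "0 < r" and "r \<le> m" and "r \<le> n"
  shows "strongly_unmixed TYPE('k::field) (star_product_bar m n r)"
  using assms
  by (intro strongly_unmixed_if_splittable star_product_bar_splittable simple_graph_star_product_bar)

end
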